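(* Let $1\ll n_1\ll n_2$ and let $G=G(n_1,n_2,p)$ with $p=\frac{d}{\sqrt{n_1n_2}}$ for a constant $d>1$. Then whp $$g(G)=(1+o(1))\,\mu\!\left(d^2\right)\frac{d^2n_1}{2},$$ where for $c>1$, $$\mu(c)=\frac{1}{2}-\frac{1}{c}+\frac{1}{c^2}\sum_{k=1}^\infty\left(c e^{-c}\right)^k \frac{k^{k-2}}{k!}.$$
   Context: $G(n_1,n_2,p)$ denotes the binomial random bipartite graph: a random subgraph of $K_{n_1,n_2}$ (partition classes of sizes $n_1,n_2$) in which each edge is included independently with probability $p$. $g(G)$ is the genus of $G$. The notation $f\ll g$ means $f/g\to0$; $1\ll n_1$ means $n_1\to\infty$; "whp" means with probability tending to $1$ as $n_1\to\infty$. *)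

theory Defs
  imports "HOL-Analysis.Analysis"
begin

(* A finite simple graph is given by its set of darts D (ordered pairs (u,v),
   symmetric, irreflexive); each undirected edge gives two darts. *)

(* rotation system: a permutation of the darts mapping each dart to a dart with
   the same tail, cyclic (a single cycle) on the darts at each vertex *)
definition is_rotation :: "('a \<times> 'a) set \<Rightarrow> (('a \<times> 'a) \<Rightarrow> ('a \<times> 'a)) \<Rightarrow> bool" where
  "is_rotation D \<sigma> \<longleftrightarrow> bij_betw \<sigma> D D \<and> (\<forall>d\<in>D. fst (\<sigma> d) = fst d) \<and>
     (\<forall>d\<in>D. \<forall>d'\<in>D. fst d = fst d' \<longrightarrow> (\<exists>k. (\<sigma> ^^ k) d = d'))"

(* face permutation: reverse the dart, then rotate *)
definition face_perm :: "(('a \<times> 'a) \<Rightarrow> ('a \<times> 'a)) \<Rightarrow> ('a \<times> 'a) \<Rightarrow> ('a \<times> 'a)" where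
  "face_perm \<sigma> d = \<sigma> (snd d, fst d)"

(* number of faces of the embedding = number of orbits of the face permutation *)
definition num_faces :: "('a \<times> 'a) set \<Rightarrow> (('a \<times> 'a) \<Rightarrow> ('a \<times> 'a)) \<Rightarrow> nat" where
  "num_faces D \<sigma> = card ((\<lambda>d. {(face_perm \<sigma> ^^ k) d | k. True}) ` D)"

(* non-isolated vertices and number of connected components among them *)
definition dverts :: "('a \<times> 'a) set \<Rightarrow> 'a set" where
  "dverts D = fst ` D"

definition num_components :: "('a \<times> 'a) set \<Rightarrow> nat" where
  "num_components D = card (dverts D // (D\<^sup>*))"

(* Orientable genus via rotation systems (Heffter-Edmonds-Ringel); for a
   disconnected graph the genus is the sum over components (Battle-Harary-
   Kodama-Youngs), i.e. 2c - V + E - F = 2g summed over components.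
   Isolated vertices contribute 0 and are omitted. *)
definition graph_genus :: "('a \<times> 'a) set \<Rightarrow> nat" where
  "graph_genus D = (LEAST g. \<exists>\<sigma>. is_rotation D \<sigma> \<and>
      2 * num_components D + card D div 2 = card (dverts D) + num_faces D \<sigma> + 2 * g)"

(* darts of the bipartite graph with edge set S \<subseteq> {0..<n1} \<times> {0..<n2};
   left vertices Inl i, right vertices Inr j *)
definition bip_darts :: "(nat \<times> nat) set \<Rightarrow> ((nat + nat) \<times> (nat + nat)) set" where
  "bip_darts S = {(Inl i, Inr j) | i j. (i, j) \<in> S} \<union> {(Inr j, Inl i) | i j. (i, j) \<in> S}"

definition bip_genus :: "(nat \<times> nat) set \<Rightarrow> nat" where
  "bip_genus S = graph_genus (bip_darts S)"

(* probability that G(n1,n2,p) (edge set S) satisfies Q *)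
definition Gbip_prob :: "nat \<Rightarrow> nat \<Rightarrow> real \<Rightarrow> ((nat \<times> nat) set \<Rightarrow> bool) \<Rightarrow> real" where
  "Gbip_prob n1 n2 p Q = (\<Sum>S\<in>{S. S \<subseteq> {0..<n1} \<times> {0..<n2} \<and> Q S}.
       p ^ card S * (1 - p) ^ (n1 * n2 - card S))"

definition mu :: "real \<Rightarrow> real" where
  "mu c = 1/2 - 1/c + 1/c^2 *
     (\<Sum>k. (c * exp (- c)) ^ Suc k * (real (Suc k) powr (real (Suc k) - 2)) / fact (Suc k))"

end

theory Submission
  imports Defs "HOL-Combinatorics.Cycles"
begin

text \<open>
Write $c$, $E$, $V$, $F$ for the numbers of components, edges, vertices and faces, so that twice
the genus is $(c + E - V) - (F - c)$. If a face uses a dart but not its reverse, the rest of the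
facial walk contains a path joining the endpoints of that dart, and the face meets a cycle. Hence
every face is the only face of its component, or makes at least $L$ visits to right vertices of degree at least
2, or meets one of the boundedly many (in expectation) cycles of length at most $2L$; since all visits
of the second kind number $O(n_1)$ in total, $F - c = o(n_1)$ for every rotation system.

The cyclomatic number $c + E - V$ grows by at most 1 when an edge is added, and does not grow if the
right endpoint was isolated, so the Efron-Stein inequality bounds its variance by $O(n_1)$. For its mean,
$E - V$ is handled column by column, while $c$ is the sum of $1/|C(v)|$ over left vertices $v$: up to an
error from right vertices of degree at least 3, a component with $k$ left vertices arises from a tree on
these vertices whose edges are right vertices of degree 2, which gives the Borel distribution with mean
$d^2$ through Cayley's formula.

Positivity of $\mu(c)$ for $c > 1$: the function $c^2 \mu(c)$ is nonnegative for all $c > 0$, being a limit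
of normalised cyclomatic numbers, and its derivative $(c - 1)(1 - B(c))$ is positive for $c > 1$,
where $B(c) < 1$ is the mass of the Borel distribution.
\<close>

section \<open>Rotation systems and faces\<close>

text \<open>\<open>graph_genus\<close> is a least number, so something can be derived from it only
  once some rotation system is known to satisfy the Euler equation with a natural number.
  Integrality is a sign argument: faces, vertices and edges are the cycles of three permutations,
  one of them the product of the other two. Nonnegativity comes from F - c = o(n_1) combined with a
  cyclomatic number of order n_1, so positivity of \<open>mu\<close> serves here as well as in
  making the error relative. Scale is the obstacle. The number of edges is of order sqrt(n_1 n_2),
  far above n_1, so a bound that charges every edge is too weak. Both in the count of facial visits
  and in the variance, an edge is charged only if its right endpoint has a second edge; the expected
  number of such edges is at most n_1 n_2 * n_1 * p^2 = d^2 n_1. The length threshold L is fixed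
  before n_1 grows: the faces with many visits cost O(n_1 / L), while the short cycles contribute an
  error depending on L but not on n_1.\<close>

definition orb :: "('b \<Rightarrow> 'b) \<Rightarrow> 'b \<Rightarrow> 'b set" where
  "orb f x = {(f ^^ k) x | k. True}"

lemma orb_self [simp]: "x \<in> orb f x"
  unfolding orb_def by (metis (mono_tags, lifting) funpow_0 mem_Collect_eq)

lemma orb_closed: "y \<in> orb f x \<Longrightarrow> f y \<in> orb f x"
  unfolding orb_def by clarify (metis comp_apply funpow.simps(2))

lemma orb_subset:
  assumes "x \<in> B" "\<And>y. y \<in> B \<Longrightarrow> f y \<in> B"
  shows "orb f x \<subseteq> B"
proof -
  have "(f ^^ k) x \<in> B" for k by (induction k) (use assms in auto)
  then show ?thesis by (auto simp: orb_def)
qed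

lemma orb_trans: "y \<in> orb f x \<Longrightarrow> orb f y \<subseteq> orb f x"
  by (rule orb_subset) (auto intro: orb_closed)

lemma orb_eq:
  assumes "finite D" "p permutes D" "y \<in> orb p x"
  shows "orb p y = orb p x"
proof (rule antisym)
  show "orb p y \<subseteq> orb p x" using assms(3) by (rule orb_trans)
  obtain k where k: "y = (p ^^ k) x" using assms(3) by (auto simp: orb_def)
  have "permutation p" using assms(1,2) by (auto simp: permutation_permutes)
  then obtain n where n: "p ^^ n = id" "n > 0" using permutation_is_nilpotent by blast
  have "(p ^^ (n * k)) x = x" by (simp add: funpow_mult[symmetric] n)
  moreover have "n * k = (n * k - k) + k" using n(2) by (cases n) auto
  ultimately have "x = (p ^^ (n * k - k)) y" unfolding k
    by (metis comp_apply funpow_add)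
  then have "x \<in> orb p y" by (auto simp: orb_def)
  then show "orb p x \<subseteq> orb p y" by (rule orb_trans)
qed

lemma orb_cong:
  assumes "x \<in> D" "\<And>y. y \<in> D \<Longrightarrow> f y \<in> D" "\<And>y. y \<in> D \<Longrightarrow> f y = g y"
  shows "orb f x = orb g x"
proof -
  have "(f ^^ k) x = (g ^^ k) x \<and> (f ^^ k) x \<in> D" for k
    by (induction k) (use assms in auto)
  then show ?thesis by (auto simp: orb_def)
qed

lemma orb_subset_permutes: "p permutes D \<Longrightarrow> x \<in> D \<Longrightarrow> orb p x \<subseteq> D"
  by (rule orb_subset) (auto simp: permutes_in_image)

text \<open>Composing with this transposition sends the predecessor of \<open>x\<close> directly to
  \<open>p x\<close> and fixes \<open>x\<close>. The cycle through \<open>x\<close> loses one point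
  and all other cycles are unchanged.\<close>

lemma orb_remove_point:
  assumes "p permutes insert x F" "p x \<noteq> x" "d \<in> F" "x \<notin> F"
  shows "orb p d - {x} = orb (Transposition.transpose x (p x) \<circ> p) d"
proof -
  define r where "r = Transposition.transpose x (p x) \<circ> p"
  have ne: "p y \<noteq> p x" if "y \<noteq> x" for y using assms(1) that by (metis permutes_inj injD)
  have r: "r y = (if p y = x then p x else p y)" if "y \<noteq> x" for y
    using ne[OF that] by (auto simp: r_def Transposition.transpose_def)
  have "orb r d \<subseteq> orb p d - {x}"
  proof (rule orb_subset)
    show "d \<in> orb p d - {x}" using assms by auto
    fix y assume y: "y \<in> orb p d - {x}"
    then have "p y \<in> orb p d" by (auto intro: orb_closed)
    moreover from this have "p (p y) \<in> orb p d" by (rule orb_closed)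
    ultimately show "r y \<in> orb p d - {x}" using y assms(2) by (auto simp: r)
  qed
  moreover have "orb p d \<subseteq> orb r d \<union> (if p x \<in> orb r d then {x} else {})"
  proof (rule orb_subset)
    fix y assume y: "y \<in> orb r d \<union> (if p x \<in> orb r d then {x} else {})"
    show "p y \<in> orb r d \<union> (if p x \<in> orb r d then {x} else {})"
    proof (cases "y = x")
      case True
      then have "p x \<in> orb r d"
      proof (cases "p x \<in> orb r d")
        case False then have "x \<in> orb r d" using y True by auto
        then show ?thesis using \<open>orb r d \<subseteq> orb p d - {x}\<close> by auto
      qed
      then show ?thesis using True by auto
    next
      case False
      then have "y \<in> orb r d" using y by (auto split: if_splits)
      then have "r y \<in> orb r d" by (rule orb_closed)
      then show ?thesis using r[OF False] by (auto split: if_splits)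
    qed
  qed simp
  ultimately show ?thesis unfolding r_def by (auto split: if_splits)
qed

text \<open>The sign of a permutation is (-1)^(points - cycles). Induction removes one point
  \<open>x\<close>: if it is fixed, points and cycles both drop by one; otherwise the cycles keep
  their number and the parity changes with the transposition.\<close>

lemma evenperm_orbits:
  assumes "finite D" "p permutes D"
  shows "evenperm p \<longleftrightarrow> even (card D + card (orb p ` D))"
  using assms
proof (induction D arbitrary: p rule: finite_induct)
  case empty
  then have "p = id" by simp
  then show ?case by simp
next
  case (insert x F)
  define r where "r = Transposition.transpose x (p x) \<circ> p"
  have rF: "r permutes F" unfolding r_def using insert.prems by (rule permutes_insert_lemma)
  have IH: "evenperm r \<longleftrightarrow> even (card F + card (orb r ` F))" using insert.IH[OF rF] .
  have p: "permutation p" using insert.prems insert.hyps by (auto simp: permutation_permutes)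
  have ev: "evenperm r \<longleftrightarrow> ((x = p x) = evenperm p)" unfolding r_def
    using p by (subst evenperm_comp) (auto simp: evenperm_swap permutation_swap_id)
  show ?case
  proof (cases "p x = x")
    case True
    then have rp: "r = p" by (auto simp: r_def)
    have "orb p x = {x}" using orb_subset[of x "{x}" p] True by auto
    moreover have "{x} \<notin> orb p ` F"
      using insert.hyps(2) by (metis imageE insertI1 orb_self singletonD)
    ultimately have "card (orb p ` insert x F) = Suc (card (orb p ` F))"
      using insert.hyps by auto
    then show ?thesis using IH rp insert.hyps by auto
  next
    case False
    have px: "p x \<in> F" using insert.prems False by (metis insertCI insertE permutes_in_image)
    have fin: "finite (insert x F)" using insert.hyps by auto
    have "orb p x = orb p (p x)" using orb_eq[OF fin insert.prems, of "p x" x] orb_closed[OF orb_self] by metis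
    then have im: "orb p ` insert x F = orb p ` F" using px by auto
    have im2: "orb r ` F = (\<lambda>W. W - {x}) ` orb p ` F"
      using orb_remove_point[OF insert.prems False _ insert.hyps(2)] by (auto simp: r_def image_iff)
    have "inj_on (\<lambda>W. W - {x}) (orb p ` F)"
    proof (rule inj_onI, clarify)
      fix a b assume ab: "a \<in> F" "b \<in> F" "orb p a - {x} = orb p b - {x}"
      have "a \<in> orb p a - {x}" using insert.hyps(2) ab(1) by auto
      then have "a \<in> orb p b" using ab(3) by blast
      then show "orb p a = orb p b" using orb_eq[OF fin insert.prems] by blast
    qed
    then have "card (orb r ` F) = card (orb p ` F)" unfolding im2 by (rule card_image)
    then show ?thesis using IH im ev False insert.hyps by auto
  qed
qed

lemma cyclic_permutation_exists:
  assumes "finite A"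
  shows "\<exists>f. bij_betw f A A \<and> (\<forall>x\<in>A. \<forall>y\<in>A. \<exists>k. (f ^^ k) x = y)"
proof -
  obtain cs where cs: "set cs = A" "distinct cs" using finite_distinct_list[OF assms] by blast
  let ?f = "cycle_of_list cs"
  have "bij_betw ?f A A" using cycle_permutes[of cs] unfolding cs(1) by (rule permutes_imp_bij)
  moreover have "\<exists>k. (?f ^^ k) x = y" if xy: "x \<in> A" "y \<in> A" for x y
  proof -
    obtain i j where i: "i < length cs" "x = cs ! i" and j: "j < length cs" "y = cs ! j"
      using xy unfolding cs(1)[symmetric] in_set_conv_nth by blast
    \<comment> \<open>One full turn is added because \<open>j - i\<close> would be truncated for
      \<open>j < i\<close>.\<close>
    let ?k = "length cs - i + j"
    have "(?f ^^ ?k) x = rotate ?k cs ! i"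
      using i by (simp add: cyclic_rotation[OF cs(2), symmetric])
    also have "\<dots> = y" using i j by (simp add: nth_rotate)
    finally show ?thesis by blast
  qed
  ultimately show ?thesis by blast
qed

section \<open>Darts, edges and the existence of a rotation system\<close>

locale dart_graph =
  fixes D :: "('a \<times> 'a) set"
  assumes fin: "finite D" and symD: "(u, v) \<in> D \<Longrightarrow> (v, u) \<in> D" and irrD: "(u, u) \<notin> D"
begin

lemma symD_star: "(u, v) \<in> D\<^sup>* \<Longrightarrow> (v, u) \<in> D\<^sup>*"
  using symD by (meson symI sym_rtrancl symE)

lemma finite_dverts: "finite (dverts D)" by (simp add: dverts_def fin)

lemma class_eq: "(u, v) \<in> D\<^sup>* \<Longrightarrow> D\<^sup>* `` {u} = D\<^sup>* `` {v}"
  using symD_star by (auto intro: rtrancl_trans)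

lemma num_components_alt: "num_components D = card ((\<lambda>v. D\<^sup>* `` {v}) ` dverts D)"
  unfolding num_components_def quotient_def by (simp add: UNION_singleton_eq_range)

text \<open>The identity outside \<open>D\<close> is what \<open>permutes\<close> demands. Its
  cycles on \<open>D\<close> are the undirected edges.\<close>

definition rev_dart :: "'a \<times> 'a \<Rightarrow> 'a \<times> 'a" where
  "rev_dart d = (if d \<in> D then (snd d, fst d) else d)"

lemma rev_dart_permutes: "rev_dart permutes D"
proof (rule bij_imp_permutes)
  show "bij_betw rev_dart D D"
    by (rule bij_betw_byWitness[where f' = rev_dart]) (auto simp: rev_dart_def symD)
qed (auto simp: rev_dart_def)

lemma orb_rev_dart: "d \<in> D \<Longrightarrow> orb rev_dart d = {d, (snd d, fst d)}"
proof (rule antisym)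
  assume "d \<in> D"
  then show "orb rev_dart d \<subseteq> {d, (snd d, fst d)}"
    by (intro orb_subset) (auto simp: rev_dart_def symD)
  have "rev_dart d \<in> orb rev_dart d" by (rule orb_closed[OF orb_self])
  then show "{d, (snd d, fst d)} \<subseteq> orb rev_dart d" using \<open>d \<in> D\<close> by (auto simp: rev_dart_def)
qed

lemma card_orb_rev_dart: "2 * card (orb rev_dart ` D) = card D"
proof -
  have form: "\<exists>u v. (u, v) \<in> D \<and> c = {(u, v), (v, u)}" if c: "c \<in> orb rev_dart ` D" for c
  proof -
    obtain d where "d \<in> D" "c = orb rev_dart d" using c by blast
    then show ?thesis using orb_rev_dart[of d] by (intro exI[of _ "fst d"] exI[of _ "snd d"]) simp
  qed
  have "\<Union> (orb rev_dart ` D) = D" by (auto simp: orb_rev_dart symD)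
  moreover have "2 * card (orb rev_dart ` D) = card (\<Union> (orb rev_dart ` D))"
  proof (rule card_partition)
    show "finite (orb rev_dart ` D)" "finite (\<Union> (orb rev_dart ` D))"
      using fin by (auto simp: orb_rev_dart)
    fix c assume "c \<in> orb rev_dart ` D"
    then obtain u v where uv: "(u, v) \<in> D" "c = {(u, v), (v, u)}" using form by blast
    then have "u \<noteq> v" using irrD by auto
    then show "card c = 2" using uv(2) by simp
  next
    fix c1 c2 assume "c1 \<in> orb rev_dart ` D" "c2 \<in> orb rev_dart ` D" "c1 \<noteq> c2"
    then obtain u v u' v' where "c1 = {(u, v), (v, u)}" "c2 = {(u', v'), (v', u')}"
      using form by meson
    then show "c1 \<inter> c2 = {}" using \<open>c1 \<noteq> c2\<close> by blast
  qed
  ultimately show ?thesis by simp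
qed

lemma rotation_exists: "\<exists>\<sigma>. is_rotation D \<sigma>"
proof -
  define A where "A v = {d \<in> D. fst d = v}" for v
  have "\<forall>v. \<exists>f. bij_betw f (A v) (A v) \<and> (\<forall>x\<in>A v. \<forall>y\<in>A v. \<exists>k. (f ^^ k) x = y)"
  proof
    fix v
    have "finite (A v)" using fin by (auto simp: A_def)
    then show "\<exists>f. bij_betw f (A v) (A v) \<and> (\<forall>x\<in>A v. \<forall>y\<in>A v. \<exists>k. (f ^^ k) x = y)"
      by (rule cyclic_permutation_exists)
  qed
  then obtain f where f: "\<And>v. bij_betw (f v) (A v) (A v)"
     "\<And>v x y. x \<in> A v \<Longrightarrow> y \<in> A v \<Longrightarrow> \<exists>k. (f v ^^ k) x = y" by metis
  define \<sigma> where "\<sigma> d = f (fst d) d" for d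
  have fA: "f v x \<in> A v" if "x \<in> A v" for v x using f(1) that by (auto simp: bij_betw_def)
  have fst: "fst (\<sigma> d) = fst d \<and> \<sigma> d \<in> D" if "d \<in> D" for d
    using fA[of d "fst d"] that by (auto simp: \<sigma>_def A_def)
  have pow: "(\<sigma> ^^ k) x = (f v ^^ k) x \<and> (f v ^^ k) x \<in> A v" if "x \<in> A v" for k v x
  proof (induction k)
    case (Suc k)
    have "\<sigma> y = f v y" if "y \<in> A v" for y using that by (auto simp: \<sigma>_def A_def)
    then show ?case using Suc fA by simp
  qed (use that in simp)
  have "inj_on \<sigma> D"
  proof (rule inj_onI)
    fix x y assume xy: "x \<in> D" "y \<in> D" "\<sigma> x = \<sigma> y"
    then have e: "fst x = fst y" using fst by metis
    show "x = y"
    proof (rule inj_onD[OF bij_betw_imp_inj_on[OF f(1)[of "fst x"]]])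
      show "f (fst x) x = f (fst x) y" using xy(3) e by (simp add: \<sigma>_def)
    qed (use xy e in \<open>auto simp: A_def\<close>)
  qed
  moreover have "\<sigma> ` D \<subseteq> D" using fst by auto
  ultimately have "bij_betw \<sigma> D D" using fin by (simp add: bij_betw_def endo_inj_surj)
  moreover have "\<exists>k. (\<sigma> ^^ k) d = d'" if "d \<in> D" "d' \<in> D" "fst d = fst d'" for d d'
    using f(2)[of d "fst d" d'] pow[of d "fst d"] that by (auto simp: A_def)
  ultimately show ?thesis unfolding is_rotation_def using fst by blast
qed

end

section \<open>Vertices, edges and faces of an embedding as permutation cycles\<close>

locale embedded = dart_graph +
  fixes \<sigma> assumes rot: "is_rotation D \<sigma>"
begin

text \<open>\<open>is_rotation\<close> constrains its map on \<open>D\<close> only; the identity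
  elsewhere makes it a permutation of \<open>D\<close> in the sense of
  \<open>permutes\<close>.\<close>

definition rho where "rho d = (if d \<in> D then \<sigma> d else d)"
definition phi where "phi = rho \<circ> rev_dart"

lemma rho_permutes: "rho permutes D"
proof (rule bij_imp_permutes)
  have "bij_betw \<sigma> D D" using rot by (simp add: is_rotation_def)
  then show "bij_betw rho D D" by (subst bij_betw_cong[where g = \<sigma>]) (auto simp: rho_def)
qed (auto simp: rho_def)

lemma phi_permutes: "phi permutes D"
  unfolding phi_def by (rule permutes_compose[OF rev_dart_permutes rho_permutes])

lemma rho_in: "d \<in> D \<Longrightarrow> rho d \<in> D" using permutes_in_image[OF rho_permutes] by blast
lemma phi_in: "d \<in> D \<Longrightarrow> phi d \<in> D" using permutes_in_image[OF phi_permutes] by blast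

lemma fst_rho: "d \<in> D \<Longrightarrow> fst (rho d) = fst d" using rot by (simp add: is_rotation_def rho_def)
lemma fst_phi: "d \<in> D \<Longrightarrow> fst (phi d) = snd d"
  using fst_rho[of "rev_dart d"] symD[of "fst d" "snd d"] by (auto simp: phi_def rev_dart_def)

lemma orb_rho: "d \<in> D \<Longrightarrow> orb rho d = {d' \<in> D. fst d' = fst d}"
proof (rule antisym)
  assume d: "d \<in> D"
  show "orb rho d \<subseteq> {d' \<in> D. fst d' = fst d}"
    by (rule orb_subset) (use d rho_in fst_rho in auto)
  have bij: "bij_betw \<sigma> D D" using rot by (simp add: is_rotation_def)
  have "orb rho d = orb \<sigma> d"
    by (rule orb_cong[OF d]) (auto simp: rho_in rho_def intro: bij_betwE[OF bij, rule_format])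
  moreover have "{d' \<in> D. fst d' = fst d} \<subseteq> orb \<sigma> d"
    using rot d unfolding is_rotation_def orb_def by (auto) (metis fst_conv)
  ultimately show "{d' \<in> D. fst d' = fst d} \<subseteq> orb rho d" by simp
qed

lemma num_faces_orb: "num_faces D \<sigma> = card (orb phi ` D)"
proof -
  have "{(face_perm \<sigma> ^^ k) d | k. True} = orb phi d" if "d \<in> D" for d
  proof -
    have e: "face_perm \<sigma> y = phi y" if "y \<in> D" for y
      using that symD[of "fst y" "snd y"] by (auto simp: face_perm_def phi_def rho_def rev_dart_def)
    have "orb (face_perm \<sigma>) d = orb phi d"
      by (rule orb_cong[OF that]) (auto simp: e phi_in)
    then show ?thesis by (simp add: orb_def)
  qed
  then show ?thesis unfolding num_faces_def by (metis (no_types, lifting) image_cong)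
qed

lemma card_orb_rho: "card (orb rho ` D) = card (dverts D)"
proof -
  have "orb rho ` D = (\<lambda>v. {d \<in> D. fst d = v}) ` dverts D"
    by (auto simp: orb_rho dverts_def)
  moreover have "inj_on (\<lambda>v. {d \<in> D. fst d = v}) (dverts D)"
    by (rule inj_onI) (auto simp: dverts_def)
  ultimately show ?thesis by (simp add: card_image)
qed

text \<open>The cycles of \<open>phi\<close>, \<open>rho\<close> and \<open>rev_dart\<close> are the
  faces, vertices and edges, so multiplicativity of the sign relates the three counts modulo 2;
  \<open>card D\<close> is even and drops out.\<close>

lemma euler_parity: "even (card D div 2 + card (dverts D) + num_faces D \<sigma>)"
proof -
  define E where "E = card (orb rev_dart ` D)"
  have cD: "card D = 2 * E" using card_orb_rev_dart by (simp add: E_def)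
  have "permutation rho" "permutation rev_dart"
    using rho_permutes rev_dart_permutes fin by (auto simp: permutation_permutes)
  then have "evenperm phi = (evenperm rho = evenperm rev_dart)" unfolding phi_def by (rule evenperm_comp)
  then show ?thesis
    using evenperm_orbits[OF fin phi_permutes] evenperm_orbits[OF fin rho_permutes]
      evenperm_orbits[OF fin rev_dart_permutes]
    unfolding num_faces_orb card_orb_rho E_def[symmetric] cD by auto
qed

lemma orb_phi_D: "d \<in> D \<Longrightarrow> orb phi d \<subseteq> D" using orb_subset_permutes[OF phi_permutes] .

lemma orb_phi_class:
  assumes "d \<in> D" shows "orb phi d \<subseteq> {d' \<in> D. (fst d, fst d') \<in> D\<^sup>*}"
proof (rule orb_subset)
  fix y assume y: "y \<in> {d' \<in> D. (fst d, fst d') \<in> D\<^sup>*}"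
  then have "(fst y, fst (phi y)) \<in> D" using fst_phi by auto
  then show "phi y \<in> {d' \<in> D. (fst d, fst d') \<in> D\<^sup>*}" using y phi_in by (auto intro: rtrancl.intros(2))
qed (use assms in auto)

lemma image_fst_orb:
  assumes "d \<in> D" shows "D\<^sup>* `` (fst ` orb phi d) = D\<^sup>* `` {fst d}"
proof (rule antisym)
  show "D\<^sup>* `` (fst ` orb phi d) \<subseteq> D\<^sup>* `` {fst d}"
    using orb_phi_class[OF assms] by (clarsimp simp: subset_eq) (metis fst_conv rtrancl_trans)
  show "D\<^sup>* `` {fst d} \<subseteq> D\<^sup>* `` (fst ` orb phi d)"
    using orb_self[of d phi] by blast
qed

lemma num_components_le_faces: "num_components D \<le> num_faces D \<sigma>"
proof -
  have "(\<lambda>v. D\<^sup>* `` {v}) ` dverts D \<subseteq> (\<lambda>W. D\<^sup>* `` (fst ` W)) ` (orb phi ` D)"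
    by (auto simp: dverts_def image_image image_fst_orb cong: image_cong_simp)
  then show ?thesis unfolding num_components_alt num_faces_orb
    by (meson card_image_le card_mono fin finite_imageI le_trans)
qed

definition full_face where "full_face W \<longleftrightarrow> (\<forall>d\<in>W. (snd d, fst d) \<in> W)"

text \<open>A full face is closed under \<open>rho\<close>, because \<open>rho x\<close> is
  \<open>phi\<close> applied to the reverse of \<open>x\<close>. Hence it contains all darts at
  every vertex that it visits, and their reverses carry it on to the neighbours, until the component
  is exhausted.\<close>

lemma full_face_eq:
  assumes d: "d \<in> D" and full: "full_face (orb phi d)"
  shows "orb phi d = {d' \<in> D. (fst d, fst d') \<in> D\<^sup>*}"
proof (rule antisym)
  show "orb phi d \<subseteq> {d' \<in> D. (fst d, fst d') \<in> D\<^sup>*}" by (rule orb_phi_class[OF d])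
  have rho: "rho x \<in> orb phi d" if "x \<in> orb phi d" for x
  proof -
    have "x \<in> D" using that orb_phi_D[OF d] by auto
    then have "rho x = phi (snd x, fst x)"
      using symD[of "fst x" "snd x"] by (auto simp: phi_def rev_dart_def)
    then show ?thesis using full that by (auto simp: full_face_def intro: orb_closed)
  qed
  have tail: "y \<in> orb phi d" if "x \<in> orb phi d" "y \<in> D" "fst y = fst x" for x y
  proof -
    have x: "x \<in> D" using that orb_phi_D[OF d] by auto
    have "y \<in> orb rho x" using that by (simp add: orb_rho[OF x])
    moreover have "orb rho x \<subseteq> orb phi d" by (rule orb_subset) (use that rho in auto)
    ultimately show ?thesis by auto
  qed
  have "v \<in> fst ` orb phi d" if "(fst d, v) \<in> D\<^sup>*" for v
    using that
  proof (induction rule: rtrancl_induct)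
    case base then show ?case by auto
  next
    case (step y z)
    then obtain x where x: "x \<in> orb phi d" "fst x = y" by auto
    have "(y, z) \<in> orb phi d" using tail[OF x(1) step(2)] x by auto
    then have "(z, y) \<in> orb phi d" using full by (auto simp: full_face_def)
    then show ?case by force
  qed
  then show "{d' \<in> D. (fst d, fst d') \<in> D\<^sup>*} \<subseteq> orb phi d"
    using tail by (smt (verit) imageE mem_Collect_eq subsetI)
qed

text \<open>A full face consists of all darts of its component, so different full faces lie in
  different components.\<close>

lemma card_full_faces: "card {W \<in> orb phi ` D. full_face W} \<le> num_components D"
proof -
  have "inj_on (\<lambda>W. D\<^sup>* `` (fst ` W)) {W \<in> orb phi ` D. full_face W}"
  proof (rule inj_onI, clarify)
    fix d e assume *: "d \<in> D" "e \<in> D" "full_face (orb phi d)" "full_face (orb phi e)"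
      "D\<^sup>* `` (fst ` orb phi d) = D\<^sup>* `` (fst ` orb phi e)"
    then have "D\<^sup>* `` {fst d} = D\<^sup>* `` {fst e}" by (simp only: image_fst_orb)
    then show "orb phi d = orb phi e" 
      unfolding full_face_eq[OF *(1,3)] full_face_eq[OF *(2,4)] by blast
  qed
  moreover have "(\<lambda>W. D\<^sup>* `` (fst ` W)) ` {W \<in> orb phi ` D. full_face W} \<subseteq> (\<lambda>v. D\<^sup>* `` {v}) ` dverts D"
    by (clarsimp simp only: dverts_def image_fst_orb) blast
  ultimately show ?thesis unfolding num_components_alt
    by (meson card_inj_on_le finite_imageI finite_dverts)
qed

text \<open>The facial walk leads back from the head of $d$ to its tail, and it uses neither $d$ again (the darts
of an orbit are distinct) nor the reverse of $d$.\<close>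

lemma nonfull_face:
  assumes d: "d \<in> D" and W: "W = orb phi d" and nr: "(snd d, fst d) \<notin> W"
  shows "(snd d, fst d) \<in> (W - {d})\<^sup>*"
proof -
  have stepr: "(fst y, fst (phi y)) = y" if "y \<in> W" for y
    using that orb_phi_D[OF d] fst_phi W by (metis prod.collapse subsetD)
  have "{y \<in> W. (snd d, fst y) \<in> (W - {d})\<^sup>* } = W"
  proof -
    have pd: "phi d \<in> W" using W orb_closed orb_self by metis
    have cl: "orb phi (phi d) = W" unfolding W
      by (rule orb_eq[OF fin phi_permutes]) (use pd W in auto)
    define B where "B = {y \<in> W. (snd d, fst y) \<in> (W - {d})\<^sup>* }"
    have pdB: "phi d \<in> B" using pd fst_phi[OF d] by (auto simp: B_def)
    have "orb phi (phi d) \<subseteq> B"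
    proof (rule orb_subset)
      fix y assume y: "y \<in> B"
      show "phi y \<in> B"
      proof (cases "y = d")
        case False
        then have "(fst y, fst (phi y)) \<in> W - {d}" using y stepr by (auto simp: B_def)
        moreover have "phi y \<in> W" using y W orb_closed by (metis (no_types, lifting) B_def mem_Collect_eq)
        ultimately show ?thesis using y by (auto simp: B_def intro: rtrancl.intros(2))
      qed (use pdB in simp)
    qed (rule pdB)
    then show ?thesis using cl B_def by auto
  qed
  moreover have "d \<in> W" using W by simp
  ultimately show ?thesis by blast
qed

end

section \<open>Faces of bipartite graphs\<close>

definition deg :: "(nat \<times> nat) set \<Rightarrow> nat \<Rightarrow> nat" where
  "deg S j = card {i. (i, j) \<in> S}"

text \<open>A list $(i_1,j_1),\ldots,(i_k,j_k)$ encodes the closed walk $i_1 j_1 i_2 j_2 \ldots i_k j_k i_1$ through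
left vertices $i_t$ and right vertices $j_t$; its edges are the pairs $(i_t,j_t)$ and $(i_{t+1},j_t)$.\<close>

definition cells :: "(nat \<times> nat) list \<Rightarrow> (nat \<times> nat) set" where
  "cells ps = set ps \<union> (\<lambda>t. (fst (ps ! (Suc t mod length ps)), snd (ps ! t))) ` {..<length ps}"

definition is_cyc :: "(nat \<times> nat) list \<Rightarrow> bool" where
  "is_cyc ps \<longleftrightarrow> distinct (map fst ps) \<and> distinct (map snd ps) \<and> 2 \<le> length ps"

definition walk :: "(nat \<times> nat) set \<Rightarrow> nat \<Rightarrow> nat \<Rightarrow> (nat \<times> nat) list \<Rightarrow> bool" where
  "walk T a b ps \<longleftrightarrow> ps \<noteq> [] \<and> set ps \<subseteq> T \<and> successively (\<lambda>p q. (fst q, snd p) \<in> T) ps \<and>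
     fst (hd ps) = a \<and> snd (last ps) = b"

abbreviation conn :: "(nat \<times> nat) set \<Rightarrow> ((nat + nat) \<times> (nat + nat)) set" where
  "conn S \<equiv> (bip_darts S)\<^sup>*"

section \<open>Walks and cycles in bipartite graphs\<close>

lemma bip_darts_simps [simp]:
  "(Inl i, Inr j) \<in> bip_darts S \<longleftrightarrow> (i, j) \<in> S"
  "(Inr j, Inl i) \<in> bip_darts S \<longleftrightarrow> (i, j) \<in> S"
  "(Inl i, Inl i') \<notin> bip_darts S"
  "(Inr j, Inr j') \<notin> bip_darts S"
  by (auto simp: bip_darts_def)

lemma bip_dartsE:
  assumes "(x, y) \<in> bip_darts S"
  obtains i j where "(i, j) \<in> S" "x = Inl i" "y = Inr j"
    | i j where "(i, j) \<in> S" "x = Inr j" "y = Inl i"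
  using assms by (auto simp: bip_darts_def)

lemma bip_darts_Un: "bip_darts S = (\<lambda>(i, j). (Inl i, Inr j)) ` S \<union> (\<lambda>(i, j). (Inr j, Inl i)) ` S"
  by (auto simp: bip_darts_def image_iff)

lemma dart_graph_bip: "finite S \<Longrightarrow> dart_graph (bip_darts S)"
proof
  show "finite S \<Longrightarrow> finite (bip_darts S)" by (simp add: bip_darts_Un)
qed (auto simp: bip_darts_def)

lemma bip_star_sym: "(x, y) \<in> conn S \<Longrightarrow> (y, x) \<in> conn S"
proof -
  have "sym (bip_darts S)" by (rule symI) (auto simp: bip_darts_def)
  then show "(x, y) \<in> conn S \<Longrightarrow> (y, x) \<in> conn S" by (meson sym_rtrancl symE)
qed

text \<open>A \<open>walk\<close> always runs from a left to a right vertex. The induction along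
  \<open>conn\<close> therefore needs a second clause for left end points: such a point is the start
  itself or lies one edge beyond a walk.\<close>

lemma walk_exists:
  assumes "(Inl a, y) \<in> conn T"
  shows "(\<forall>b. y = Inr b \<longrightarrow> (\<exists>ps. walk T a b ps)) \<and>
    (\<forall>a'. y = Inl a' \<longrightarrow> a' = a \<or> (\<exists>b ps. walk T a b ps \<and> (a', b) \<in> T))"
  using assms
proof (induction rule: rtrancl_induct)
  case base then show ?case by simp
next
  case (step y z)
  from step(2) show ?case
  proof (cases rule: bip_dartsE)
    case (1 i j)
    consider "i = a" | b ps where "walk T a b ps" "(i, b) \<in> T" using step 1 by auto
    then have "\<exists>ps. walk T a j ps"
    proof cases
      case 1
      then show ?thesis using \<open>(i, j) \<in> T\<close> by (intro exI[of _ "[(i, j)]"]) (auto simp: walk_def)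
    next
      case 2
      then show ?thesis using \<open>(i, j) \<in> T\<close>
        by (intro exI[of _ "ps @ [(i, j)]"]) (auto simp: walk_def successively_append_iff)
    qed
    then show ?thesis using 1 by simp
  next
    case (2 i j)
    then show ?thesis using step by auto
  qed
qed

lemma walk_distinct:
  assumes "walk T a b ps"
  obtains qs where "walk T a b qs" "distinct (map fst qs)" "distinct (map snd qs)"
proof -
  define qs where "qs = arg_min length (walk T a b)"
  have qs: "walk T a b qs" unfolding qs_def using arg_min_natI[of "walk T a b" ps length] assms by simp
  have min: "length qs \<le> length rs" if "walk T a b rs" for rs
    unfolding qs_def using that by (rule arg_min_nat_le)
  have "distinct (map g qs)" if g: "g = fst \<or> g = snd" for g
  proof (rule ccontr)
    assume "\<not> distinct (map g qs)"
    then obtain xs ys zs y where "map g qs = xs @ [y] @ ys @ [y] @ zs"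
      using not_distinct_decomp by blast
    then obtain P1 P2 P3 p q where d: "qs = P1 @ [p] @ P2 @ [q] @ P3" "g p = g q"
      by (auto simp: map_eq_append_conv append_eq_map_conv map_eq_Cons_conv Cons_eq_map_conv)
    \<comment> \<open>Shortcuts in a shortest walk. If the repeated vertex is on the left,
      \<open>q\<close> is kept, since the walk enters it as it entered \<open>p\<close>; if it is on
      the right, \<open>p\<close> is kept, since the walk leaves it as it left
      \<open>q\<close>.\<close>
    have "walk T a b (P1 @ [q] @ P3)" if "fst p = fst q"
      using qs that unfolding walk_def d(1)
      by (cases "P1 = []"; cases "P2 = []"; cases "P3 = []")
        (auto simp: successively_append_iff successively_Cons hd_append)
    moreover have "walk T a b (P1 @ [p] @ P3)" if "snd p = snd q"
      using qs that unfolding walk_def d(1)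
      by (cases "P1 = []"; cases "P2 = []"; cases "P3 = []")
        (auto simp: successively_append_iff successively_Cons hd_append)
    ultimately have "walk T a b (P1 @ [q] @ P3) \<or> walk T a b (P1 @ [p] @ P3)" using g d(2) by blast
    then show False using min[of "P1 @ [q] @ P3"] min[of "P1 @ [p] @ P3"] unfolding d(1) by auto
  qed
  then have "distinct (map fst qs)" "distinct (map snd qs)" by blast+
  then show ?thesis using qs that by blast
qed

lemma cyc_neighbours:
  assumes "is_cyc ps" "t < length ps"
  shows "fst (ps ! t) \<noteq> fst (ps ! (Suc t mod length ps))"
proof -
  have n: "2 \<le> length ps" "distinct (map fst ps)" using assms by (auto simp: is_cyc_def)
  have "Suc t mod length ps < length ps" using n by (intro mod_less_divisor) linarith
  moreover have "t \<noteq> Suc t mod length ps"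
    using n assms(2) by (cases "Suc t = length ps") auto
  ultimately show ?thesis using n(2) assms(2) by (simp add: distinct_conv_nth)
qed

lemma cyc_deg:
  assumes "is_cyc ps" "cells ps \<subseteq> S" "finite S" "j \<in> snd ` set ps"
  shows "2 \<le> deg S j"
proof -
  obtain t where t: "t < length ps" "j = snd (ps ! t)" using assms(4) by (auto simp: in_set_conv_nth)
  define i where "i = fst (ps ! t)"
  define i' where "i' = fst (ps ! (Suc t mod length ps))"
  have "(i, j) \<in> S" using assms(2) t by (auto simp: cells_def i_def)
  moreover have "(i', j) \<in> S" using assms(2) t by (auto simp: cells_def i'_def)
  moreover have "i \<noteq> i'" using cyc_neighbours[OF assms(1) t(1)] by (simp add: i_def i'_def)
  moreover have "finite {i. (i, j) \<in> S}"
    by (rule finite_subset[of _ "fst ` S"]) (use assms(3) in force)+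
  ultimately have "card {i, i'} \<le> deg S j" unfolding deg_def by (intro card_mono) auto
  then show ?thesis using \<open>i \<noteq> i'\<close> by simp
qed

text \<open>The two families of edges are disjoint because equal right ends force the same position,
  and consecutive left vertices differ. The exact count matters: (n_1 n_2)^k lists of length k, each
  present with probability p^(2k), give a bounded expected number of cycles.\<close>

lemma card_cells:
  assumes "is_cyc ps" shows "card (cells ps) = 2 * length ps"
proof -
  let ?n = "length ps"
  have n: "2 \<le> ?n" "distinct (map fst ps)" "distinct (map snd ps)" using assms by (auto simp: is_cyc_def)
  let ?f = "\<lambda>t. (fst (ps ! (Suc t mod ?n)), snd (ps ! t))"
  have inj: "t = t'" if "t < ?n" "t' < ?n" "snd (ps ! t) = snd (ps ! t')" for t t'
    using n(3) that by (auto simp: distinct_conv_nth)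
  have "card (?f ` {..<?n}) = ?n"
    by (subst card_image) (auto intro!: inj_onI dest: inj)
  moreover have "card (set ps) = ?n" using n(2) by (meson distinct_card distinct_map)
  moreover have "set ps \<inter> ?f ` {..<?n} = {}"
  proof -
    { fix p assume p: "p \<in> set ps" "p \<in> ?f ` {..<?n}"
      then obtain s where s: "s < ?n" "p = ps ! s" by (auto simp: in_set_conv_nth)
      obtain t where t: "t < ?n" "p = ?f t" using p(2) by auto
      have "s = t" using inj[OF s(1) t(1)] s t by (metis snd_conv)
      then have "fst (ps ! t) = fst (ps ! (Suc t mod ?n))" using s t by (metis fst_conv)
      then have False using cyc_neighbours[OF assms t(1)] by simp }
    then show ?thesis by blast
  qed
  ultimately show ?thesis unfolding cells_def by (subst card_Un_disjoint) auto
qed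

section \<open>Faces that are not full, and short cycles\<close>

locale bip_embedded = embedded "bip_darts S" \<sigma> for S \<sigma> +
  assumes finS: "finite S"
begin

text \<open>Right vertices of degree 1 are left out, since there are far more of them than n_1. A
  cycle avoids them, so the visits counted here still bound its length.\<close>

definition visits :: "((nat + nat) \<times> (nat + nat)) set \<Rightarrow> nat" where
  "visits W = card {d \<in> W. \<exists>j. fst d = Inr j \<and> 2 \<le> deg S j}"

text \<open>A dart of \<open>W\<close> whose reverse is missing from \<open>W\<close> is closed up
  by the rest of the facial walk. The last conclusion records that a dart of the closing edge lies
  in \<open>W\<close>, so that the cycle together with a direction of this edge identifies the
  face.\<close>

lemma nonfull_face_cycle:
  assumes W: "W \<in> orb phi ` bip_darts S" and nf: "\<not> full_face W"
  obtains ps where "is_cyc ps" "cells ps \<subseteq> S" "length ps \<le> visits W"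
    "(Inl (fst (hd ps)), Inr (snd (last ps))) \<in> W \<or> (Inr (snd (last ps)), Inl (fst (hd ps))) \<in> W"
proof -
  let ?D = "bip_darts S"
  obtain d0 where d0: "d0 \<in> ?D" "W = orb phi d0" using W by auto
  obtain d where d: "d \<in> W" "(snd d, fst d) \<notin> W" using nf by (auto simp: full_face_def)
  have WD: "W \<subseteq> ?D" using d0 orb_phi_D by auto
  have dD: "d \<in> ?D" using d WD by auto
  have Wd: "W = orb phi d" using orb_eq[OF fin phi_permutes] d0 d by metis
  have con: "(snd d, fst d) \<in> (W - {d})\<^sup>*" using nonfull_face[OF dD Wd d(2)] .
  \<comment> \<open>The undirected edges traversed by \<open>W\<close>, the chosen dart being
    discarded.\<close>
  define T where "T = {(i, j). (Inl i, Inr j) \<in> W - {d} \<or> (Inr j, Inl i) \<in> W - {d}}"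
  have TS: "T \<subseteq> S" using WD by (auto simp: T_def)
  have "W - {d} \<subseteq> bip_darts T"
  proof
    fix e assume e: "e \<in> W - {d}"
    then have "e \<in> ?D" using WD by auto
    then obtain i j where ij: "e = (Inl i, Inr j) \<or> e = (Inr j, Inl i)" by (auto simp: bip_darts_def)
    then have "(i, j) \<in> T" using e by (auto simp: T_def)
    then show "e \<in> bip_darts T" using ij by auto
  qed
  then have con2: "(snd d, fst d) \<in> conn T" using con rtrancl_mono by blast
  obtain a b where ab: "d = (Inl a, Inr b) \<or> d = (Inr b, Inl a)" "(a, b) \<in> S"
    using dD by (auto simp: bip_darts_def)
  have "(Inl a, Inr b) \<in> conn T" using ab con2 bip_star_sym by auto
  then obtain ps0 where "walk T a b ps0" using walk_exists by blast
  then obtain ps where ps: "walk T a b ps" "distinct (map fst ps)" "distinct (map snd ps)"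
    by (rule walk_distinct)
  \<comment> \<open>\<open>d\<close> was removed and its reverse is not in \<open>W\<close>. So the
    path in \<open>T\<close> between the ends of \<open>d\<close> is not that single edge, and
    adding the edge closes it to a cycle.\<close>
  have nT: "(a, b) \<notin> T" using d ab by (auto simp: T_def)
  have ne: "ps \<noteq> []" using ps by (auto simp: walk_def)
  have "length ps \<noteq> 1"
  proof
    assume "length ps = 1"
    then obtain p where "ps = [p]" by (auto simp: length_Suc_conv)
    then have "p = (a, b)" "p \<in> T" using ps(1) by (auto simp: walk_def)
    then show False using nT by simp
  qed
  then have len: "2 \<le> length ps" using ne by (cases ps) (auto simp: Suc_le_eq)
  have cyc: "is_cyc ps" using ps len by (simp add: is_cyc_def)
  have hl: "fst (hd ps) = a" "snd (last ps) = b" using ps by (auto simp: walk_def)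
  have cS: "cells ps \<subseteq> S"
  proof -
    have "(fst (ps ! (Suc t mod length ps)), snd (ps ! t)) \<in> S" if t: "t < length ps" for t
    proof (cases "Suc t < length ps")
      case True
      then have "(fst (ps ! Suc t), snd (ps ! t)) \<in> T"
        using ps(1) by (auto simp: walk_def successively_conv_nth)
      then show ?thesis using True TS by auto
    next
      case False
      then have "Suc t = length ps" using t by simp
      then have "ps ! (Suc t mod length ps) = hd ps" "ps ! t = last ps"
        using ne by (auto simp: hd_conv_nth last_conv_nth dest: sym)
      then show ?thesis using hl ab by simp
    qed
    moreover have "set ps \<subseteq> S" using ps(1) TS by (auto simp: walk_def)
    ultimately show ?thesis by (auto simp: cells_def)
  qed
  have fW: "finite W" using finite_subset[OF WD fin] .
  have "length ps = card (snd ` set ps)" using ps(3) by (metis distinct_card length_map set_map)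
  also have "\<dots> \<le> card ((\<lambda>d. projr (fst d)) ` {d \<in> W. \<exists>j. fst d = Inr j \<and> 2 \<le> deg S j})"
  proof (rule card_mono)
    show "finite ((\<lambda>d. projr (fst d)) ` {d \<in> W. \<exists>j. fst d = Inr j \<and> 2 \<le> deg S j})" using fW by simp
    show "snd ` set ps \<subseteq> (\<lambda>d. projr (fst d)) ` {d \<in> W. \<exists>j. fst d = Inr j \<and> 2 \<le> deg S j}"
    proof
      fix j assume j: "j \<in> snd ` set ps"
      then obtain i where "(i, j) \<in> T" using ps(1) by (auto simp: walk_def)
      \<comment> \<open>The face uses the edge \<open>(i, j)\<close> in some direction. Either that
        dart leaves \<open>j\<close>, or it enters \<open>j\<close> and its successor under
        \<open>phi\<close> leaves \<open>j\<close>.\<close>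
      then have "\<exists>d\<in>W. fst d = Inr j"
      proof -
        consider "(Inr j, Inl i) \<in> W" | "(Inl i, Inr j) \<in> W" using \<open>(i, j) \<in> T\<close> by (auto simp: T_def)
        then show ?thesis
        proof cases
          case 2
          then have "fst (phi (Inl i, Inr j)) = Inr j" using fst_phi WD by auto
          moreover have "phi (Inl i, Inr j) \<in> W" using 2 unfolding Wd by (rule orb_closed)
          ultimately show ?thesis by blast
        qed force
      qed
      then obtain e where e: "e \<in> W" "fst e = Inr j" by auto
      have "2 \<le> deg S j" by (rule cyc_deg[OF cyc cS finS j])
      then show "j \<in> (\<lambda>d. projr (fst d)) ` {d \<in> W. \<exists>j. fst d = Inr j \<and> 2 \<le> deg S j}"
        using e by (intro image_eqI[of _ _ e]) auto
    qed
  qed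
  also have "\<dots> \<le> visits W" unfolding visits_def
    by (rule card_image_le) (use fW in simp)
  finally have "length ps \<le> visits W" .
  then show ?thesis using that cyc cS hl ab d by metis
qed

end

definition short_cycles :: "(nat \<times> nat) set \<Rightarrow> nat \<Rightarrow> (nat \<times> nat) list set" where
  "short_cycles S L = {ps. is_cyc ps \<and> cells ps \<subseteq> S \<and> length ps \<le> L}"

lemma finite_short_cycles: "finite S \<Longrightarrow> finite (short_cycles S L)"
  by (rule finite_subset[OF _ finite_lists_length_le[of S L]]) (auto simp: short_cycles_def cells_def)

definition heavy_edges :: "(nat \<times> nat) set \<Rightarrow> nat" where
  "heavy_edges S = card {e \<in> S. 2 \<le> deg S (snd e)}"

text \<open>Three classes of faces: full ones (\<open>A\<close>), at most one per component; those
  with at least \<open>L\<close> visits (\<open>B\<close>), which share no darts and together make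
  at most \<open>heavy_edges S\<close> visits; and the remaining ones (\<open>C\<close>), each
  identified by a short cycle and a direction of its closing edge. The factor \<open>L\<close>
  avoids a division.\<close>

lemma (in bip_embedded) num_faces_upper:
  "L * num_faces (bip_darts S) \<sigma> \<le> L * num_components (bip_darts S) + heavy_edges S + 2 * L * card (short_cycles S L)"
proof -
  let ?F = "orb phi ` bip_darts S"
  define A where "A = {W \<in> ?F. full_face W}"
  define B where "B = {W \<in> ?F. L \<le> visits W}"
  define C where "C = {W \<in> ?F. \<not> full_face W \<and> visits W < L}"
  have fF: "finite ?F" using fin by simp
  have "?F \<subseteq> A \<union> B \<union> C" by (auto simp: A_def B_def C_def)
  then have "card ?F \<le> card (A \<union> B \<union> C)" using fF by (intro card_mono) (auto simp: A_def B_def C_def)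
  also have "\<dots> \<le> card A + card B + card C" using card_Un_le[of A B] card_Un_le[of "A \<union> B" C] by linarith
  finally have F: "num_faces (bip_darts S) \<sigma> \<le> card A + card B + card C" unfolding num_faces_orb .
  have cA: "card A \<le> num_components (bip_darts S)" unfolding A_def by (rule card_full_faces)
  have cB: "L * card B \<le> heavy_edges S"
  proof -
    let ?h = "\<lambda>W. {d \<in> W. \<exists>j. fst d = Inr j \<and> 2 \<le> deg S j}"
    have fB: "finite B" using fF by (auto simp: B_def)
    have WD: "W \<subseteq> bip_darts S" if "W \<in> ?F" for W using that orb_phi_D by auto
    have "L * card B = (\<Sum>W\<in>B. L)" by simp
    also have "\<dots> \<le> (\<Sum>W\<in>B. visits W)" by (rule sum_mono) (auto simp: B_def)
    also have "\<dots> = card (\<Union>W\<in>B. ?h W)" unfolding visits_def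
    proof (rule card_UN_disjoint[symmetric, OF fB])
      show "\<forall>i\<in>B. finite (?h i)" using WD fin by (auto simp: B_def intro: finite_subset)
      show "\<forall>i\<in>B. \<forall>j\<in>B. i \<noteq> j \<longrightarrow> ?h i \<inter> ?h j = {}"
      proof (intro ballI impI)
        fix i j assume ij: "i \<in> B" "j \<in> B" "i \<noteq> j"
        then obtain x y where xy: "i = orb phi x" "j = orb phi y" by (auto simp: B_def)
        have "i \<inter> j = {}"
        proof (rule ccontr)
          assume "i \<inter> j \<noteq> {}"
          then obtain z where "z \<in> i" "z \<in> j" by auto
          then have "orb phi z = i" "orb phi z = j"
            using xy orb_eq[OF fin phi_permutes] by metis+
          then show False using ij by simp
        qed
        then show "?h i \<inter> ?h j = {}" by blast
      qed
    qed
    also have "\<dots> \<le> card ((\<lambda>(i, j). (Inr j :: nat + nat, Inl i :: nat + nat)) ` {e \<in> S. 2 \<le> deg S (snd e)})"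
    proof (rule card_mono)
      show "finite ((\<lambda>(i, j). (Inr j :: nat + nat, Inl i :: nat + nat)) ` {e \<in> S. 2 \<le> deg S (snd e)})"
        using finS by simp
      show "(\<Union>W\<in>B. ?h W) \<subseteq> (\<lambda>(i, j). (Inr j, Inl i)) ` {e \<in> S. 2 \<le> deg S (snd e)}"
      proof
        fix e assume "e \<in> (\<Union>W\<in>B. ?h W)"
        then obtain j where e: "e \<in> bip_darts S" "fst e = Inr j" "2 \<le> deg S j"
          using WD by (auto simp: B_def)
        then obtain i where "(i, j) \<in> S" "e = (Inr j, Inl i)" by (auto simp: bip_darts_def)
        then show "e \<in> (\<lambda>(i, j). (Inr j, Inl i)) ` {e \<in> S. 2 \<le> deg S (snd e)}"
          using e by (intro image_eqI[of _ _ "(i, j)"]) auto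
      qed
    qed
    also have "\<dots> \<le> heavy_edges S" unfolding heavy_edges_def by (rule card_image_le) (use finS in simp)
    finally show ?thesis .
  qed
  have cC: "card C \<le> 2 * card (short_cycles S L)"
  proof -
    \<comment> \<open>The face through the closing edge of a cycle, in each of its two
      directions.\<close>
    let ?o1 = "\<lambda>ps. orb phi (Inl (fst (hd ps)), Inr (snd (last ps)))"
    let ?o2 = "\<lambda>ps. orb phi (Inr (snd (last ps)), Inl (fst (hd ps)))"
    have "C \<subseteq> ?o1 ` short_cycles S L \<union> ?o2 ` short_cycles S L"
    proof
      fix W assume W: "W \<in> C"
      then have "W \<in> ?F" "\<not> full_face W" by (auto simp: C_def)
      then obtain ps where ps: "is_cyc ps" "cells ps \<subseteq> S" "length ps \<le> visits W"
        "(Inl (fst (hd ps)), Inr (snd (last ps))) \<in> W \<or> (Inr (snd (last ps)), Inl (fst (hd ps))) \<in> W"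
        by (rule nonfull_face_cycle)
      have "ps \<in> short_cycles S L" using ps W by (auto simp: short_cycles_def C_def)
      moreover have "W = orb phi d" if "d \<in> W" for d
        using \<open>W \<in> ?F\<close> that orb_eq[OF fin phi_permutes] by (metis imageE)
      ultimately show "W \<in> ?o1 ` short_cycles S L \<union> ?o2 ` short_cycles S L" using ps(4) by blast
    qed
    then have "card C \<le> card (?o1 ` short_cycles S L \<union> ?o2 ` short_cycles S L)"
      using finite_short_cycles[OF finS] by (intro card_mono) auto
    also have "\<dots> \<le> card (?o1 ` short_cycles S L) + card (?o2 ` short_cycles S L)" by (rule card_Un_le)
    also have "\<dots> \<le> 2 * card (short_cycles S L)"
      using card_image_le[OF finite_short_cycles[OF finS], of ?o1 L]
        card_image_le[OF finite_short_cycles[OF finS], of ?o2 L] by linarith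
    finally show ?thesis .
  qed
  have "L * num_faces (bip_darts S) \<sigma> \<le> L * (card A + card B + card C)" using F by (rule mult_le_mono2)
  also have "\<dots> = L * card A + L * card B + L * card C" by (simp add: algebra_simps)
  also have "\<dots> \<le> L * num_components (bip_darts S) + heavy_edges S + L * (2 * card (short_cycles S L))"
    using cA cB cC by (intro add_mono mult_le_mono2) auto
  finally show ?thesis by (simp add: algebra_simps)
qed

text \<open>For every rotation system the hypothesis \<open>le\<close> and the bound on faces give F
  - c \<le> \<open>X\<close>, and by parity \<open>X\<close> - (F - c) is twice a natural number. So
  the set in the \<open>LEAST\<close> is nonempty, and its minimum is attained by an actual rotation
  system, to which the bounds on F - c apply.\<close>

lemma genus_bounds:
  fixes S :: "(nat \<times> nat) set" and L :: nat
  assumes fS: "finite S"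
  defines "X \<equiv> int (num_components (bip_darts S)) + int (card (bip_darts S) div 2) - int (card (dverts (bip_darts S)))"
  defines "B \<equiv> int (heavy_edges S + 2 * L * card (short_cycles S L))"
  assumes L: "L > 0" and le: "B \<le> int L * X"
  shows "2 * int (bip_genus S) \<le> X" "int L * (X - 2 * int (bip_genus S)) \<le> B"
proof -
  let ?D = "bip_darts S"
  interpret dart_graph ?D by (rule dart_graph_bip[OF fS])
  have emb: "bip_embedded S \<sigma>" if "is_rotation ?D \<sigma>" for \<sigma>
    by (intro_locales) (use that fS in \<open>auto simp: embedded_axioms_def bip_embedded_axioms_def\<close>)
  have upper: "int L * (int (num_faces ?D \<sigma>) - int (num_components ?D)) \<le> B" if "is_rotation ?D \<sigma>" for \<sigma>
  proof -
    interpret bip_embedded S \<sigma> by (rule emb[OF that])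
    have "int (L * num_faces ?D \<sigma>) \<le> int (L * num_components ?D + heavy_edges S + 2 * L * card (short_cycles S L))"
      using num_faces_upper[of L] by (simp only: of_nat_le_iff)
    then show ?thesis unfolding B_def by (simp add: algebra_simps)
  qed
  have lower: "num_components ?D \<le> num_faces ?D \<sigma>" and
    par: "even (card ?D div 2 + card (dverts ?D) + num_faces ?D \<sigma>)" if "is_rotation ?D \<sigma>" for \<sigma>
  proof -
    interpret bip_embedded S \<sigma> by (rule emb[OF that])
    show "num_components ?D \<le> num_faces ?D \<sigma>" by (rule num_components_le_faces)
    show "even (card ?D div 2 + card (dverts ?D) + num_faces ?D \<sigma>)" by (rule euler_parity)
  qed
  let ?P = "\<lambda>g. \<exists>\<sigma>. is_rotation ?D \<sigma> \<and>
      2 * num_components ?D + card ?D div 2 = card (dverts ?D) + num_faces ?D \<sigma> + 2 * g"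
  have "\<exists>g. ?P g"
  proof -
    obtain \<sigma> where \<sigma>: "is_rotation ?D \<sigma>" using rotation_exists by blast
    have "int L * (int (num_faces ?D \<sigma>) - int (num_components ?D)) \<le> int L * X" using upper[OF \<sigma>] le by linarith
    then have "int (num_faces ?D \<sigma>) - int (num_components ?D) \<le> X" using L by simp
    then have le2: "card (dverts ?D) + num_faces ?D \<sigma> \<le> 2 * num_components ?D + card ?D div 2"
      unfolding X_def by linarith
    have "even (2 * num_components ?D + card ?D div 2 - (card (dverts ?D) + num_faces ?D \<sigma>))"
      using par[OF \<sigma>] le2 by auto
    then obtain g where "2 * num_components ?D + card ?D div 2 - (card (dverts ?D) + num_faces ?D \<sigma>) = 2 * g" by blast
    then have "?P g" using \<sigma> le2 by (intro exI[of _ \<sigma>]) simp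
    then show ?thesis by blast
  qed
  then have "?P (bip_genus S)" unfolding bip_genus_def graph_genus_def by (rule LeastI_ex)
  then obtain \<sigma> where \<sigma>: "is_rotation ?D \<sigma>"
    "2 * num_components ?D + card ?D div 2 = card (dverts ?D) + num_faces ?D \<sigma> + 2 * bip_genus S" by blast
  have e: "X - 2 * int (bip_genus S) = int (num_faces ?D \<sigma>) - int (num_components ?D)"
    using \<sigma>(2) unfolding X_def by linarith
  show "2 * int (bip_genus S) \<le> X" using e lower[OF \<sigma>(1)] by linarith
  show "int L * (X - 2 * int (bip_genus S)) \<le> B" unfolding e by (rule upper[OF \<sigma>(1)])
qed

section \<open>The cyclomatic number\<close>

abbreviation grid :: "nat \<Rightarrow> nat \<Rightarrow> (nat \<times> nat) set" where
  "grid n1 n2 \<equiv> {..<n1} \<times> {..<n2}"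

lemma finite_subset_grid: "S \<subseteq> grid n1 n2 \<Longrightarrow> finite S"
  by (rule finite_subset) auto

lemma finite_col: "finite S \<Longrightarrow> finite {i. (i, j) \<in> S}"
  by (rule finite_subset[of _ "fst ` S"]) force+

definition lcomp :: "nat \<Rightarrow> (nat \<times> nat) set \<Rightarrow> nat \<Rightarrow> nat set" where
  "lcomp n1 S i = {i'. i' < n1 \<and> (Inl i, Inl i' :: nat + nat) \<in> conn S}"

text \<open>Isolated left vertices form components here but not in \<open>num_components\<close>;
  this makes the count a sum over all \<open>n1\<close> left vertices.\<close>

definition lcomps :: "nat \<Rightarrow> (nat \<times> nat) set \<Rightarrow> nat" where
  "lcomps n1 S = card (lcomp n1 S ` {..<n1})"

text \<open>The subtraction is truncated, so isolated right vertices contribute 0.\<close>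

definition excess :: "nat \<Rightarrow> (nat \<times> nat) set \<Rightarrow> nat" where
  "excess n2 S = (\<Sum>j<n2. deg S j - 1)"

text \<open>An isolated left vertex adds one to \<open>lcomps\<close> and one to \<open>n1\<close>,
  and \<open>excess\<close> is the number of edges minus the number of non-isolated right vertices.
  The result is c + E - V for the graph without isolated vertices.\<close>

definition cyclo :: "nat \<Rightarrow> nat \<Rightarrow> (nat \<times> nat) set \<Rightarrow> real" where
  "cyclo n1 n2 S = real (lcomps n1 S) + real (excess n2 S) - real n1"

lemma lcomp_self: "i < n1 \<Longrightarrow> i \<in> lcomp n1 S i" by (simp add: lcomp_def)

lemma lcomp_eq: "(Inl i, Inl i') \<in> conn S \<Longrightarrow> lcomp n1 S i = lcomp n1 S i'"
  unfolding lcomp_def by (auto intro: rtrancl_trans bip_star_sym)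

lemma lcomp_eq_iff: "i' < n1 \<Longrightarrow> lcomp n1 S i = lcomp n1 S i' \<longleftrightarrow> (Inl i, Inl i') \<in> conn S"
proof
  assume "i' < n1" "lcomp n1 S i = lcomp n1 S i'"
  then have "i' \<in> lcomp n1 S i" using lcomp_self by blast
  then show "(Inl i, Inl i') \<in> conn S" by (simp add: lcomp_def)
qed (rule lcomp_eq)

lemma card_bip_darts:
  assumes "finite S" shows "card (bip_darts S) = 2 * card S"
proof -
  let ?f = "\<lambda>(i, j). (Inl i :: nat + nat, Inr j :: nat + nat)"
  let ?g = "\<lambda>(i, j). (Inr j :: nat + nat, Inl i :: nat + nat)"
  have "card (bip_darts S) = card (?f ` S) + card (?g ` S)"
    unfolding bip_darts_Un using assms by (subst card_Un_disjoint) auto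
  also have "\<dots> = card S + card S"
    by (subst (1 2) card_image) (auto simp: inj_on_def)
  finally show ?thesis by simp
qed

lemma dverts_bip: "dverts (bip_darts S) = Inl ` fst ` S \<union> Inr ` snd ` S"
  by (force simp: dverts_def bip_darts_Un)

lemma card_dverts_bip:
  assumes "finite S" shows "card (dverts (bip_darts S)) = card (fst ` S) + card (snd ` S)"
proof -
  have "card (dverts (bip_darts S)) = card (Inl ` fst ` S :: (nat + nat) set) + card (Inr ` snd ` S :: (nat + nat) set)"
    unfolding dverts_bip using assms by (subst card_Un_disjoint) auto
  then show ?thesis by (simp add: card_image)
qed

lemma sum_deg:
  assumes "S \<subseteq> grid n1 n2" shows "(\<Sum>j<n2. deg S j) = card S"
proof -
  have fS: "finite S" using assms by (rule finite_subset_grid)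
  have "card S = card (prod.swap ` S)" by (simp add: card_image)
  also have "prod.swap ` S = (SIGMA j:{..<n2}. {i. (i, j) \<in> S})" using assms by force
  also have "card \<dots> = (\<Sum>j<n2. deg S j)"
    using finite_col[OF fS] by (subst card_SigmaI) (auto simp: deg_def)
  finally show ?thesis by simp
qed

lemma excess_plus:
  assumes "S \<subseteq> grid n1 n2" shows "excess n2 S + card (snd ` S) = card S"
proof -
  have fS: "finite S" using assms by (rule finite_subset_grid)
  have "snd ` S = {j \<in> {..<n2}. deg S j > 0}"
    using assms finite_col[OF fS] by (force simp: deg_def card_gt_0_iff)
  then have "card (snd ` S) = (\<Sum>j<n2. if deg S j > 0 then 1 else 0)" by (simp add: sum.If_cases Int_def)
  then have "excess n2 S + card (snd ` S) = (\<Sum>j<n2. (deg S j - 1) + (if deg S j > 0 then 1 else 0))"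
    by (simp add: excess_def sum.distrib)
  also have "\<dots> = (\<Sum>j<n2. deg S j)" by (intro sum.cong) auto
  finally show ?thesis using sum_deg[OF assms] by simp
qed

lemma isolated_star:
  assumes "(x, y) \<in> conn S" "x \<notin> dverts (bip_darts S)"
  shows "y = x"
  using assms by (cases rule: converse_rtranclE) (auto simp: dverts_def image_iff)

lemma lcomps_eq:
  assumes "S \<subseteq> grid n1 n2"
  shows "lcomps n1 S = num_components (bip_darts S) + (n1 - card (fst ` S))"
proof -
  let ?D = "bip_darts S"
  let ?A = "fst ` S"
  have fS: "finite S" using assms finite_subset by blast
  interpret dart_graph ?D by (rule dart_graph_bip[OF fS])
  have A: "?A \<subseteq> {..<n1}" using assms by auto
  have iso: "lcomp n1 S i = {i}" if "i < n1" "i \<notin> ?A" for i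
  proof -
    have "Inl i \<notin> dverts ?D" using that by (auto simp: dverts_bip)
    then show ?thesis using isolated_star[of "Inl i"] that by (auto simp: lcomp_def)
  qed
  have "{..<n1} = ?A \<union> ({..<n1} - ?A)" using A by auto
  then have "lcomps n1 S = card (lcomp n1 S ` ?A \<union> lcomp n1 S ` ({..<n1} - ?A))"
    unfolding lcomps_def by (metis image_Un)
  also have "\<dots> = card (lcomp n1 S ` ?A) + card (lcomp n1 S ` ({..<n1} - ?A))"
  proof (rule card_Un_disjoint)
    show "lcomp n1 S ` ?A \<inter> lcomp n1 S ` ({..<n1} - ?A) = {}"
    proof (rule ccontr)
      assume "lcomp n1 S ` ?A \<inter> lcomp n1 S ` ({..<n1} - ?A) \<noteq> {}"
      then obtain a b where ab: "a \<in> ?A" "b < n1" "b \<notin> ?A" "lcomp n1 S a = lcomp n1 S b" by blast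
      then have "a \<in> {b}" using iso[of b] lcomp_self[of a n1 S] A by auto
      then show False using ab by simp
    qed
  qed (use fS in auto)
  also have "card (lcomp n1 S ` ({..<n1} - ?A)) = n1 - card ?A"
  proof -
    have "inj_on (lcomp n1 S) ({..<n1} - ?A)" by (rule inj_onI) (auto simp: iso)
    then show ?thesis using A fS by (simp add: card_image card_Diff_subset)
  qed
  also have "card (lcomp n1 S ` ?A) = num_components ?D"
  proof -
    have "(\<lambda>v. ?D\<^sup>* `` {v}) ` dverts ?D = (\<lambda>i. ?D\<^sup>* `` {Inl i}) ` ?A"
    proof -
      have "\<exists>i\<in>?A. ?D\<^sup>* `` {Inr j} = ?D\<^sup>* `` {Inl i}" if j: "j \<in> snd ` S" for j
      proof -
        obtain i where "(i, j) \<in> S" using j by auto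
        then have "(Inr j, Inl i) \<in> ?D\<^sup>*" by (intro r_into_rtrancl) simp
        then have "?D\<^sup>* `` {Inr j} = ?D\<^sup>* `` {Inl i}" by (rule class_eq)
        moreover have "i \<in> fst ` S" using \<open>(i, j) \<in> S\<close> by (rule image_eqI[rotated]) simp
        ultimately show ?thesis by blast
      qed
      then show ?thesis unfolding dverts_bip by blast
    qed
    then have nc: "num_components ?D = card ((\<lambda>i. ?D\<^sup>* `` {Inl i}) ` ?A)" by (simp add: num_components_alt)
    have "card (lcomp n1 S ` ?A) = card ((\<lambda>i. ?D\<^sup>* `` {Inl i}) ` ?A)"
    proof (rule bij_betw_same_card)
      let ?h = "\<lambda>C. {i. i < n1 \<and> Inl i \<in> C}"
      have h: "?h (?D\<^sup>* `` {Inl i}) = lcomp n1 S i" for i by (simp add: lcomp_def)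
      have "inj_on ?h ((\<lambda>i. ?D\<^sup>* `` {Inl i}) ` ?A)"
      proof (rule inj_onI)
        fix X Y assume XY: "X \<in> (\<lambda>i. ?D\<^sup>* `` {Inl i}) ` ?A" "Y \<in> (\<lambda>i. ?D\<^sup>* `` {Inl i}) ` ?A" "?h X = ?h Y"
        obtain a where a: "a \<in> ?A" "X = ?D\<^sup>* `` {Inl a}" using XY(1) by (rule imageE)
        obtain b where b: "b \<in> ?A" "Y = ?D\<^sup>* `` {Inl b}" using XY(2) by (rule imageE)
        have "lcomp n1 S a = lcomp n1 S b" using XY(3) unfolding a(2) b(2) h .
        moreover have "b < n1" using A b(1) by auto
        ultimately have "(Inl a, Inl b) \<in> ?D\<^sup>*" using lcomp_eq_iff by blast
        then show "X = Y" unfolding a(2) b(2) by (rule class_eq)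
      qed
      moreover have "?h ` (\<lambda>i. ?D\<^sup>* `` {Inl i}) ` ?A = lcomp n1 S ` ?A" by (simp only: image_image h)
      ultimately show "bij_betw (inv_into ((\<lambda>i. ?D\<^sup>* `` {Inl i}) ` ?A) ?h) (lcomp n1 S ` ?A) ((\<lambda>i. ?D\<^sup>* `` {Inl i}) ` ?A)"
        by (intro bij_betw_inv_into) (simp add: bij_betw_def)
    qed
    then show ?thesis using nc by simp
  qed
  finally show ?thesis .
qed

lemma cyclo_eq:
  assumes "S \<subseteq> grid n1 n2"
  shows "cyclo n1 n2 S = real_of_int (int (num_components (bip_darts S)) + int (card (bip_darts S) div 2)
           - int (card (dverts (bip_darts S))))"
proof -
  have fS: "finite S" using assms by (rule finite_subset_grid)
  have "fst ` S \<subseteq> {..<n1}" using assms by auto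
  then have "card (fst ` S) \<le> n1" using card_mono[of "{..<n1}"] by fastforce
  then have "real (lcomps n1 S) = num_components (bip_darts S) + (real n1 - card (fst ` S))"
    using lcomps_eq[OF assms] by simp
  moreover have "real (excess n2 S) + real (card (snd ` S)) = real (card S)"
    using excess_plus[OF assms] by (metis of_nat_add)
  ultimately show ?thesis unfolding cyclo_def card_bip_darts[OF fS] card_dverts_bip[OF fS] by simp
qed

lemma cyclo_genus:
  fixes L :: nat
  assumes S: "S \<subseteq> grid n1 n2" and L: "L > 0"
    and B: "real (heavy_edges S) / L + 2 * real (card (short_cycles S L)) \<le> cyclo n1 n2 S"
  shows "2 * real (bip_genus S) \<le> cyclo n1 n2 S"
    "cyclo n1 n2 S - 2 * real (bip_genus S) \<le> real (heavy_edges S) / L + 2 * real (card (short_cycles S L))"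
proof -
  have fS: "finite S" using S finite_subset by blast
  let ?X = "int (num_components (bip_darts S)) + int (card (bip_darts S) div 2) - int (card (dverts (bip_darts S)))"
  let ?B = "int (heavy_edges S + 2 * L * card (short_cycles S L))"
  have x: "cyclo n1 n2 S = real_of_int ?X" by (rule cyclo_eq[OF S])
  have b: "real (heavy_edges S) / L + 2 * real (card (short_cycles S L)) = real_of_int ?B / L"
    using L by (simp add: field_simps)
  have "real_of_int ?B \<le> real_of_int (int L * ?X)" using B L unfolding b x by (simp add: field_simps)
  then have le: "?B \<le> int L * ?X" by (simp only: of_int_le_iff)
  note g = genus_bounds[OF fS L le]
  have "real_of_int (2 * int (bip_genus S)) \<le> real_of_int ?X" using g(1) by (simp only: of_int_le_iff)
  then show "2 * real (bip_genus S) \<le> cyclo n1 n2 S" unfolding x by simp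
  have "real_of_int (int L * (?X - 2 * int (bip_genus S))) \<le> real_of_int ?B" using g(2) by (simp only: of_int_le_iff)
  then have "real L * (real_of_int ?X - 2 * real (bip_genus S)) \<le> real_of_int ?B" by simp
  then show "cyclo n1 n2 S - 2 * real (bip_genus S) \<le> real (heavy_edges S) / L + 2 * real (card (short_cycles S L))"
    unfolding b x using L by (simp add: field_simps)
qed

section \<open>The effect of adding one edge\<close>

lemma star_insert:
  assumes "(x, y) \<in> conn (insert (i, j) S)"
  shows "(x, y) \<in> conn S \<or>
    ((x, Inl i) \<in> conn S \<or> (x, Inr j) \<in> conn S) \<and>
    ((Inl i, y) \<in> conn S \<or> (Inr j, y) \<in> conn S)"
  using assms
proof (induction rule: rtrancl_induct)
  case (step y z)
  have "(y, z) \<in> bip_darts S \<or> y = Inl i \<and> z = Inr j \<or> y = Inr j \<and> z = Inl i"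
    using step(2) by (auto simp: bip_darts_def)
  then show ?case using step.IH
    by (elim disjE conjE) (auto intro: rtrancl.intros(2))
qed simp

lemma bip_darts_mono: "S \<subseteq> S' \<Longrightarrow> bip_darts S \<subseteq> bip_darts S'"
  by (auto simp: bip_darts_def)

lemma lcomps_insert_le: "lcomps n1 (insert e S) \<le> lcomps n1 S"
proof -
  have m: "conn S \<subseteq> conn (insert e S)" by (intro rtrancl_mono bip_darts_mono) auto
  define F where "F C = (\<Union>i\<in>C. lcomp n1 (insert e S) i)" for C
  have "F (lcomp n1 S i) = lcomp n1 (insert e S) i" if "i < n1" for i
  proof -
    have "lcomp n1 (insert e S) i' = lcomp n1 (insert e S) i" if "i' \<in> lcomp n1 S i" for i'
      using that m by (intro lcomp_eq[symmetric]) (auto simp: lcomp_def)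
    moreover have "i \<in> lcomp n1 S i" using lcomp_self that .
    ultimately show ?thesis unfolding F_def by blast
  qed
  then have "lcomp n1 (insert e S) ` {..<n1} = F ` lcomp n1 S ` {..<n1}" by (auto simp: image_iff)
  then show ?thesis unfolding lcomps_def by (simp add: card_image_le)
qed

text \<open>Only the old component of the right vertex \<open>j\<close> can be absorbed. If two left
  vertices outside it become connected through the new edge, then neither reaches \<open>j\<close>
  in \<open>S\<close>, so both reach \<open>i\<close> and were connected before.\<close>

lemma lcomps_le_insert: "lcomps n1 S \<le> Suc (lcomps n1 (insert (i, j) S))"
proof -
  let ?S' = "insert (i, j) S"
  have m: "conn S \<subseteq> conn ?S'" by (intro rtrancl_mono bip_darts_mono) auto
  \<comment> \<open>The left vertices in the component of \<open>j\<close>, possibly none.\<close>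
  define C0 where "C0 = {x. x < n1 \<and> (Inr j, Inl x) \<in> conn S}"
  define R where "R = {..<n1} - C0"
  have "lcomp n1 S ` {..<n1} \<subseteq> insert C0 (lcomp n1 S ` R)"
  proof
    fix C assume "C \<in> lcomp n1 S ` {..<n1}"
    then obtain x where x: "x < n1" "C = lcomp n1 S x" by auto
    show "C \<in> insert C0 (lcomp n1 S ` R)"
    proof (cases "x \<in> C0")
      case True
      then have jx: "(Inr j, Inl x) \<in> conn S" by (simp add: C0_def)
      have "(Inl x, Inl y) \<in> conn S \<longleftrightarrow> (Inr j, Inl y) \<in> conn S" for y
        using rtrancl_trans[OF jx] rtrancl_trans[OF bip_star_sym[OF jx]] by blast
      then have "C = C0" unfolding x(2) lcomp_def C0_def by simp
      then show ?thesis by simp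
    qed (use x in \<open>auto simp: R_def\<close>)
  qed
  then have "lcomps n1 S \<le> card (insert C0 (lcomp n1 S ` R))"
    unfolding lcomps_def by (intro card_mono) (auto simp: R_def)
  also have "\<dots> \<le> Suc (card (lcomp n1 S ` R))" by (rule card_insert_le_m1) auto
  also have "card (lcomp n1 S ` R) \<le> card (lcomp n1 ?S' ` R)"
  proof (rule surj_card_le)
    define G where "G C = lcomp n1 S (SOME x. x \<in> R \<and> lcomp n1 ?S' x = C)" for C
    show "finite (lcomp n1 ?S' ` R)" by (simp add: R_def)
    show "lcomp n1 S ` R \<subseteq> G ` lcomp n1 ?S' ` R"
    proof
      fix C assume "C \<in> lcomp n1 S ` R"
      then obtain x where x: "x \<in> R" "C = lcomp n1 S x" by auto
      define y where "y = (SOME y. y \<in> R \<and> lcomp n1 ?S' y = lcomp n1 ?S' x)"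
      have y: "y \<in> R \<and> lcomp n1 ?S' y = lcomp n1 ?S' x" unfolding y_def
        by (rule someI[of _ x]) (use x in simp)
      then have "(Inl y, Inl x) \<in> conn ?S'" using x by (simp add: lcomp_eq_iff R_def)
      from star_insert[OF this] have "(Inl y, Inl x) \<in> conn S"
      proof (elim disjE conjE)
        assume "(Inl y, Inr j) \<in> conn S"
        then have "(Inr j, Inl y) \<in> conn S" by (rule bip_star_sym)
        then show ?thesis using y by (simp add: R_def C0_def)
      next
        assume "(Inr j, Inl x) \<in> conn S"
        then show ?thesis using x(1) by (simp add: R_def C0_def)
      qed (auto intro: rtrancl_trans)
      then have "G (lcomp n1 ?S' x) = C" unfolding G_def y_def[symmetric] x(2) by (rule lcomp_eq)
      then show "C \<in> G ` lcomp n1 ?S' ` R" using x(1) by blast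
    qed
  qed
  also have "card (lcomp n1 ?S' ` R) \<le> lcomps n1 ?S'" unfolding lcomps_def by (intro card_mono) (auto simp: R_def)
  finally show ?thesis by simp
qed

lemma lcomps_insert_isolated:
  assumes "\<And>i. (i, j) \<notin> S"
  shows "lcomps n1 (insert (i, j) S) = lcomps n1 S"
proof -
  let ?S' = "insert (i, j) S"
  have m: "conn S \<subseteq> conn ?S'" by (intro rtrancl_mono bip_darts_mono) auto
  have "Inr j \<notin> dverts (bip_darts S)" using assms by (auto simp: dverts_bip)
  then have iso: "(Inr j, Inl x) \<notin> conn S" "(Inl x, Inr j) \<notin> conn S" for x
    using isolated_star bip_star_sym by blast+
  have "(Inl x, Inl y) \<in> conn ?S' \<longleftrightarrow> (Inl x, Inl y) \<in> conn S" for x y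
    using star_insert[of "Inl x" "Inl y" i j S] iso m by (auto intro: rtrancl_trans)
  then show ?thesis by (simp add: lcomps_def lcomp_def)
qed

lemma deg_insert:
  assumes "finite S" "(i, j) \<notin> S"
  shows "deg (insert (i, j) S) j' = (if j' = j then Suc (deg S j) else deg S j')"
proof -
  have "{i'. (i', j') \<in> insert (i, j) S} = (if j' = j then insert i {i'. (i', j) \<in> S} else {i'. (i', j') \<in> S})"
    by auto
  then show ?thesis using assms finite_col[OF assms(1)] by (simp add: deg_def)
qed

text \<open>If \<open>j\<close> already has an edge, \<open>excess\<close> grows by one and the
  number of components drops by zero or one. If \<open>j\<close> is isolated, the truncated
  subtraction makes its first edge free and no left vertices get joined.\<close>

lemma cyclo_insert:
  assumes "finite S" "(i, j) \<notin> S" "j < n2"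
  shows "cyclo n1 n2 S \<le> cyclo n1 n2 (insert (i, j) S) \<and>
    cyclo n1 n2 (insert (i, j) S) \<le> cyclo n1 n2 S + of_bool (\<exists>i'. (i', j) \<in> S)"
proof -
  have fc: "finite {i. (i, j) \<in> S}" by (rule finite_col[OF assms(1)])
  have "excess n2 (insert (i, j) S) = (deg (insert (i, j) S) j - 1) + (\<Sum>j'\<in>{..<n2} - {j}. deg (insert (i, j) S) j' - 1)"
    unfolding excess_def using assms(3) by (subst sum.remove[of _ j]) auto
  also have "\<dots> = deg S j + (\<Sum>j'\<in>{..<n2} - {j}. deg S j' - 1)" using assms by (simp add: deg_insert)
  finally have e: "excess n2 (insert (i, j) S) = deg S j + (\<Sum>j'\<in>{..<n2} - {j}. deg S j' - 1)" .
  have e2: "excess n2 S = (deg S j - 1) + (\<Sum>j'\<in>{..<n2} - {j}. deg S j' - 1)"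
    unfolding excess_def using assms(3) by (subst sum.remove[of _ j]) auto
  show ?thesis
  proof (cases "\<exists>i'. (i', j) \<in> S")
    case True
    then have "deg S j > 0" using fc by (auto simp: deg_def card_gt_0_iff)
    then have "excess n2 (insert (i, j) S) = Suc (excess n2 S)" using e e2 by simp
    then show ?thesis using True lcomps_insert_le[of n1 "(i, j)" S] lcomps_le_insert[of n1 S i j]
      by (simp add: cyclo_def)
  next
    case False
    then have "deg S j = 0" by (simp add: deg_def)
    then show ?thesis using False e e2 lcomps_insert_isolated[of j S n1 i] by (simp add: cyclo_def)
  qed
qed

text \<open>Built up edge by edge from the empty graph, where the value is 0. In the limit this
  yields nonnegativity of \<open>mu\<close>.\<close>

lemma cyclo_nonneg:
  assumes "S \<subseteq> grid n1 n2" shows "0 \<le> cyclo n1 n2 S"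
proof -
  have "finite S" using assms finite_subset by blast
  then show ?thesis using assms
  proof (induction rule: finite_induct)
    case empty
    have "dverts (bip_darts {}) = {}" by (simp add: dverts_bip)
    then have "lcomps n1 {} = n1" using lcomps_eq[of "{}" n1 n2] by (simp add: num_components_def)
    then show ?case by (simp add: cyclo_def)
  next
    case (insert e S)
    obtain i j where "e = (i, j)" by (cases e)
    then show ?case using cyclo_insert[of S i j n2 n1] insert by auto
  qed
qed

section \<open>Finite Bernoulli product measures\<close>

text \<open>Expectation over the random subset of \<open>U\<close> that contains each element
  independently with probability \<open>p\<close>, kept as the same finite weighted sum that occurs
  in \<open>Gbip_prob\<close>.\<close>

definition bexp :: "real \<Rightarrow> 'a set \<Rightarrow> ('a set \<Rightarrow> real) \<Rightarrow> real" where
  "bexp p U g = (\<Sum>S\<in>Pow U. p ^ card S * (1 - p) ^ (card U - card S) * g S)"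

definition bvar :: "real \<Rightarrow> 'a set \<Rightarrow> ('a set \<Rightarrow> real) \<Rightarrow> real" where
  "bvar p U g = bexp p U (\<lambda>S. (g S - bexp p U g)\<^sup>2)"

lemma bexp_empty [simp]: "bexp p {} g = g {}"
  by (simp add: bexp_def)

lemma bexp_insert:
  assumes "finite U" "e \<notin> U"
  shows "bexp p (insert e U) g = p * bexp p U (\<lambda>S. g (insert e S)) + (1 - p) * bexp p U g"
proof -
  have fin: "finite S" "e \<notin> S" "card S \<le> card U" if "S \<in> Pow U" for S
    using that assms finite_subset card_mono by auto
  let ?w = "\<lambda>S. p ^ card S * (1 - p) ^ (card (insert e U) - card S) * g S"
  have "bexp p (insert e U) g = sum ?w (Pow U \<union> insert e ` Pow U)"
    unfolding bexp_def by (simp add: Pow_insert)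
  also have "\<dots> = sum ?w (Pow U) + sum ?w (insert e ` Pow U)"
    using assms by (intro sum.union_disjoint) auto
  also have "sum ?w (Pow U) = (1 - p) * bexp p U g"
    unfolding bexp_def sum_distrib_left using assms fin
    by (intro sum.cong) (auto simp: Suc_diff_le card_insert_if)
  also have "sum ?w (insert e ` Pow U) = sum (?w \<circ> insert e) (Pow U)"
  proof (rule sum.reindex)
    show "inj_on (insert e) (Pow U)" using assms by (auto intro!: inj_onI)
  qed
  also have "\<dots> = p * bexp p U (\<lambda>S. g (insert e S))"
    unfolding bexp_def sum_distrib_left using assms fin
    by (intro sum.cong) (auto simp: card_insert_if)
  finally show ?thesis by simp
qed

lemma bexp_add: "bexp p U (\<lambda>S. g S + h S) = bexp p U g + bexp p U h"
  by (simp add: bexp_def sum.distrib algebra_simps)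

lemma bexp_diff: "bexp p U (\<lambda>S. g S - h S) = bexp p U g - bexp p U h"
  by (simp add: bexp_def sum_subtractf algebra_simps)

lemma bexp_cmult: "bexp p U (\<lambda>S. c * g S) = c * bexp p U g"
  by (simp add: bexp_def sum_distrib_left algebra_simps)

lemma bexp_sum: "bexp p U (\<lambda>S. \<Sum>i\<in>I. g i S) = (\<Sum>i\<in>I. bexp p U (g i))"
proof -
  have "bexp p U (\<lambda>S. \<Sum>i\<in>I. g i S) = (\<Sum>S\<in>Pow U. \<Sum>i\<in>I. p ^ card S * (1 - p) ^ (card U - card S) * g i S)"
    by (simp add: bexp_def sum_distrib_left)
  also have "\<dots> = (\<Sum>i\<in>I. bexp p U (g i))" unfolding bexp_def by (rule sum.swap)
  finally show ?thesis .
qed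

lemma bexp_cong: "(\<And>S. S \<subseteq> U \<Longrightarrow> g S = h S) \<Longrightarrow> bexp p U g = bexp p U h"
  by (simp add: bexp_def)

lemma bexp_const: "finite U \<Longrightarrow> bexp p U (\<lambda>S. c) = c"
  by (induction rule: finite_induct) (simp_all add: bexp_insert algebra_simps)

lemma bexp_mono:
  assumes "0 \<le> p" "p \<le> 1" "\<And>S. S \<subseteq> U \<Longrightarrow> g S \<le> h S"
  shows "bexp p U g \<le> bexp p U h"
  unfolding bexp_def using assms by (intro sum_mono mult_left_mono) auto

lemma bexp_nonneg:
  assumes "0 \<le> p" "p \<le> 1" "\<And>S. S \<subseteq> U \<Longrightarrow> 0 \<le> g S"
  shows "0 \<le> bexp p U g"
  unfolding bexp_def using assms by (intro sum_nonneg mult_nonneg_nonneg) auto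

lemma bexp_Un:
  assumes "finite A" "finite B" "A \<inter> B = {}"
  shows "bexp p (A \<union> B) g = bexp p A (\<lambda>S. bexp p B (\<lambda>T. g (S \<union> T)))"
  using assms(1,3)
proof (induction A arbitrary: g rule: finite_induct)
  case (insert e A)
  have "bexp p (insert e A \<union> B) g = bexp p (insert e (A \<union> B)) g" by simp
  also have "\<dots> = p * bexp p (A \<union> B) (\<lambda>S. g (insert e S)) + (1 - p) * bexp p (A \<union> B) g"
    using insert assms(2) by (intro bexp_insert) auto
  also have "\<dots> = bexp p (insert e A) (\<lambda>S. bexp p B (\<lambda>T. g (S \<union> T)))"
    using insert by (simp add: bexp_insert)
  finally show ?case .
qed simp

lemma bexp_image:
  assumes "finite A" "inj_on f A"
  shows "bexp p (f ` A) g = bexp p A (\<lambda>S. g (f ` S))"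
  using assms
proof (induction A arbitrary: g rule: finite_induct)
  case (insert e A)
  then have "f e \<notin> f ` A" by auto
  then show ?case using insert by (simp add: bexp_insert)
qed simp

text \<open>Independence of the neighbourhoods of the right vertices, the source of all product
  formulas for configurations of trees.\<close>

lemma bexp_columns:
  fixes h :: "nat \<Rightarrow> 'a set \<Rightarrow> real"
  assumes "finite A"
  shows "bexp p (A \<times> {..<n}) (\<lambda>S. \<Prod>j<n. h j {i. (i, j) \<in> S}) = (\<Prod>j<n. bexp p A (h j))"
proof (induction n)
  case (Suc n)
  let ?f = "\<lambda>i. (i, n)"
  have split: "A \<times> {..<Suc n} = A \<times> {..<n} \<union> ?f ` A" by (auto simp: less_Suc_eq)
  have "bexp p (A \<times> {..<Suc n}) (\<lambda>S. \<Prod>j<Suc n. h j {i. (i, j) \<in> S})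
     = bexp p (A \<times> {..<n}) (\<lambda>S. bexp p A (\<lambda>T. \<Prod>j<Suc n. h j {i. (i, j) \<in> S \<union> ?f ` T}))"
    unfolding split using assms by (subst bexp_Un) (auto simp: bexp_image inj_on_def)
  also have "\<dots> = bexp p (A \<times> {..<n}) (\<lambda>S. bexp p A (\<lambda>T. (\<Prod>j<n. h j {i. (i, j) \<in> S}) * h n T))"
  proof (intro bexp_cong)
    fix S T assume S: "S \<subseteq> A \<times> {..<n}" and T: "T \<subseteq> A"
    have "{i. (i, n) \<in> S \<union> ?f ` T} = T" using S by auto
    moreover have "{i. (i, j) \<in> S \<union> ?f ` T} = {i. (i, j) \<in> S}" if "j < n" for j using that by auto
    ultimately show "(\<Prod>j<Suc n. h j {i. (i, j) \<in> S \<union> ?f ` T}) = (\<Prod>j<n. h j {i. (i, j) \<in> S}) * h n T"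
      by simp
  qed
  also have "\<dots> = bexp p (A \<times> {..<n}) (\<lambda>S. bexp p A (h n) * (\<Prod>j<n. h j {i. (i, j) \<in> S}))"
  proof -
    have "bexp p A (\<lambda>T. c * h n T) = bexp p A (h n) * c" for c by (simp add: bexp_cmult)
    then show ?thesis by (simp only:)
  qed
  also have "\<dots> = (\<Prod>j<Suc n. bexp p A (h j))" by (simp add: bexp_cmult Suc.IH)
  finally show ?case .
qed simp

lemma bexp_column:
  fixes h :: "'a set \<Rightarrow> real" and j n :: nat
  assumes "finite A" "j < n"
  shows "bexp p (A \<times> {..<n}) (\<lambda>S. h {i. (i, j) \<in> S}) = bexp p A h"
proof -
  define H where "H k = (if k = j then h else (\<lambda>_. 1))" for k
  have "(\<Prod>k<n. H k (X k)) = h (X j)" for X :: "nat \<Rightarrow> 'a set"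
    using assms(2) by (subst prod.remove[of _ j]) (auto simp: H_def)
  moreover have "(\<Prod>k<n. bexp p A (H k)) = bexp p A h"
    using assms by (subst prod.remove[of _ j]) (auto simp: H_def bexp_const)
  ultimately show ?thesis using bexp_columns[OF assms(1), of p n H] by simp
qed

lemma bexp_cylinder:
  assumes "finite U" "X \<subseteq> U" "Y \<subseteq> U" "X \<inter> Y = {}"
  shows "bexp p U (\<lambda>S. of_bool (X \<subseteq> S \<and> Y \<inter> S = {})) = p ^ card X * (1 - p) ^ card Y"
  using assms
proof (induction U arbitrary: X Y rule: finite_induct)
  case (insert e U)
  have finXY: "finite X" "finite Y"
    using finite_subset[OF insert.prems(1)] finite_subset[OF insert.prems(2)] insert.hyps(1) by auto
  consider "e \<in> X" | "e \<in> Y" | "e \<notin> X" "e \<notin> Y" by blast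
  then show ?case
  proof cases
    case 1
    have "bexp p U (\<lambda>S. of_bool (X \<subseteq> insert e S \<and> Y \<inter> insert e S = {})) = bexp p U (\<lambda>S. of_bool (X - {e} \<subseteq> S \<and> Y \<inter> S = {}))"
      using 1 insert.prems by (intro bexp_cong) (auto intro!: arg_cong[of _ _ of_bool])
    also have "\<dots> = p ^ card (X - {e}) * (1 - p) ^ card Y" using insert.prems 1 by (intro insert.IH) auto
    finally have "bexp p U (\<lambda>S. of_bool (X \<subseteq> insert e S \<and> Y \<inter> insert e S = {})) = p ^ card (X - {e}) * (1 - p) ^ card Y" .
    moreover have "bexp p U (\<lambda>S. of_bool (X \<subseteq> S \<and> Y \<inter> S = {})) = bexp p U (\<lambda>S. 0)"
      using 1 insert.hyps by (intro bexp_cong) auto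
    moreover have "card X = Suc (card (X - {e}))" using finXY(1) 1 by (rule card.remove)
    ultimately show ?thesis using insert.hyps by (simp add: bexp_insert bexp_const)
  next
    case 2
    have "bexp p U (\<lambda>S. of_bool (X \<subseteq> S \<and> Y \<inter> S = {})) = bexp p U (\<lambda>S. of_bool (X \<subseteq> S \<and> (Y - {e}) \<inter> S = {}))"
      using 2 insert.hyps by (intro bexp_cong) (auto intro!: arg_cong[of _ _ of_bool])
    also have "\<dots> = p ^ card X * (1 - p) ^ card (Y - {e})" using insert.prems 2 by (intro insert.IH) auto
    finally have "bexp p U (\<lambda>S. of_bool (X \<subseteq> S \<and> Y \<inter> S = {})) = p ^ card X * (1 - p) ^ card (Y - {e})" .
    moreover have "bexp p U (\<lambda>S. of_bool (X \<subseteq> insert e S \<and> Y \<inter> insert e S = {})) = bexp p U (\<lambda>S. 0)"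
      using 2 insert.hyps by (intro bexp_cong) auto
    moreover have "card Y = Suc (card (Y - {e}))" using finXY(2) 2 by (rule card.remove)
    ultimately show ?thesis using insert.hyps by (simp add: bexp_insert bexp_const)
  next
    case 3
    have "bexp p U (\<lambda>S. of_bool (X \<subseteq> insert e S \<and> Y \<inter> insert e S = {})) = bexp p U (\<lambda>S. of_bool (X \<subseteq> S \<and> Y \<inter> S = {}))"
      using 3 by (intro bexp_cong) (auto intro!: arg_cong[of _ _ of_bool])
    moreover have "bexp p U (\<lambda>S. of_bool (X \<subseteq> S \<and> Y \<inter> S = {})) = p ^ card X * (1 - p) ^ card Y"
      using insert.prems 3 by (intro insert.IH) auto
    ultimately show ?thesis using insert.hyps by (simp add: bexp_insert algebra_simps)
  qed
qed simp

lemma bexp_superset: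
  assumes "finite U" "X \<subseteq> U"
  shows "bexp p U (\<lambda>S. of_bool (X \<subseteq> S)) = p ^ card X"
  using bexp_cylinder[OF assms, of "{}" p] by simp

lemma bexp_singleton:
  assumes "finite U" "X \<subseteq> U"
  shows "bexp p U (\<lambda>S. of_bool (S = X)) = p ^ card X * (1 - p) ^ (card U - card X)"
proof -
  have "bexp p U (\<lambda>S. of_bool (S = X)) = bexp p U (\<lambda>S. of_bool (X \<subseteq> S \<and> (U - X) \<inter> S = {}))"
    using assms by (intro bexp_cong arg_cong[of _ _ of_bool]) auto
  also have "\<dots> = p ^ card X * (1 - p) ^ card (U - X)" using assms by (intro bexp_cylinder) auto
  finally show ?thesis using assms by (simp add: card_Diff_subset finite_subset)
qed

lemma bexp_card: "finite A \<Longrightarrow> bexp p A (\<lambda>T. real (card T)) = real (card A) * p"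
proof -
  assume A: "finite A"
  have "bexp p A (\<lambda>T. real (card T)) = bexp p A (\<lambda>T. \<Sum>i\<in>A. of_bool ({i} \<subseteq> T))"
    using A by (intro bexp_cong) (simp add: Int_absorb1)
  also have "\<dots> = real (card A) * p" 
  proof -
    have "bexp p A (\<lambda>T. of_bool ({i} \<subseteq> T)) = p" if "i \<in> A" for i
      using bexp_superset[OF A, of "{i}" p] that by simp
    then show ?thesis unfolding bexp_sum by simp
  qed
  finally show ?thesis .
qed

section \<open>Markov, Chebyshev and Efron-Stein inequalities\<close>

lemma bexp_markov:
  assumes "0 \<le> p" "p \<le> 1" "a > 0" "\<And>S. S \<subseteq> U \<Longrightarrow> 0 \<le> g S"
  shows "bexp p U (\<lambda>S. of_bool (a \<le> g S)) \<le> bexp p U g / a"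
proof -
  have "a * bexp p U (\<lambda>S. of_bool (a \<le> g S)) = bexp p U (\<lambda>S. a * of_bool (a \<le> g S))" by (simp add: bexp_cmult)
  also have "\<dots> \<le> bexp p U g" using assms by (intro bexp_mono) auto
  finally show ?thesis using assms(3) by (simp add: field_simps)
qed

lemma bvar_alt:
  assumes "finite U" shows "bvar p U g = bexp p U (\<lambda>S. (g S)\<^sup>2) - (bexp p U g)\<^sup>2"
proof -
  define m where "m = bexp p U g"
  have "bvar p U g = bexp p U (\<lambda>S. (g S)\<^sup>2 - 2 * m * g S + m\<^sup>2)"
    unfolding bvar_def m_def[symmetric] by (intro bexp_cong) (simp add: power2_diff)
  also have "\<dots> = bexp p U (\<lambda>S. (g S)\<^sup>2) - 2 * m * m + m\<^sup>2"
    using assms by (simp only: bexp_add bexp_diff bexp_cmult bexp_const m_def)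
  finally show ?thesis by (simp add: m_def power2_eq_square)
qed

lemma bvar_nonneg: "0 \<le> p \<Longrightarrow> p \<le> 1 \<Longrightarrow> 0 \<le> bvar p U g"
  unfolding bvar_def by (rule bexp_nonneg) auto

lemma bexp_chebyshev:
  assumes "0 \<le> p" "p \<le> 1" "a > 0"
  shows "bexp p U (\<lambda>S. of_bool (a \<le> \<bar>g S - bexp p U g\<bar>)) \<le> bvar p U g / a\<^sup>2"
proof -
  have "a \<le> \<bar>x\<bar> \<longleftrightarrow> a\<^sup>2 \<le> x\<^sup>2" for x using assms(3) abs_le_square_iff[of a x] by simp
  then have "bexp p U (\<lambda>S. of_bool (a \<le> \<bar>g S - bexp p U g\<bar>)) = bexp p U (\<lambda>S. of_bool (a\<^sup>2 \<le> (g S - bexp p U g)\<^sup>2))"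
    by simp
  also have "\<dots> \<le> bvar p U g / a\<^sup>2" unfolding bvar_def using assms by (intro bexp_markov) auto
  finally show ?thesis .
qed

text \<open>Conditioning on one element \<open>e\<close> splits the variance into the mean of the
  two conditional variances and p(1-p) times the squared difference of the conditional means. The
  induction hypothesis covers the former, and the latter is the term of \<open>e\<close> after
  Jensen's inequality.\<close>

lemma efron_stein:
  assumes "finite U" "0 \<le> p" "p \<le> 1"
  shows "bvar p U g \<le> p * (1 - p) * (\<Sum>e\<in>U. bexp p U (\<lambda>S. (g (insert e S) - g (S - {e}))\<^sup>2))"
  using assms(1)
proof (induction U arbitrary: g rule: finite_induct)
  case empty
  then show ?case by (simp add: bvar_def)
next
  case (insert e U)
  define g1 where "g1 = (\<lambda>S. g (insert e S))"
  let ?D = "\<lambda>g e S. (g (insert e S) - g (S - {e}))\<^sup>2"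
  define m1 m0 where "m1 = bexp p U g1" and "m0 = bexp p U g"
  have m: "bexp p (insert e U) g = p * m1 + (1 - p) * m0"
    using insert.hyps by (simp add: bexp_insert m1_def m0_def g1_def)
  have "bvar p (insert e U) g = p * bexp p U (\<lambda>S. (g1 S)\<^sup>2) + (1 - p) * bexp p U (\<lambda>S. (g S)\<^sup>2) - (p * m1 + (1 - p) * m0)\<^sup>2"
    using insert.hyps by (simp add: bvar_alt m bexp_insert g1_def)
  also have "\<dots> = p * bvar p U g1 + (1 - p) * bvar p U g + p * (1 - p) * (m1 - m0)\<^sup>2"
    using insert.hyps by (simp add: bvar_alt m1_def[symmetric] m0_def[symmetric] power2_eq_square algebra_simps)
  finally have v: "bvar p (insert e U) g = p * bvar p U g1 + (1 - p) * bvar p U g + p * (1 - p) * (m1 - m0)\<^sup>2" .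
  have c1: "(m1 - m0)\<^sup>2 \<le> bexp p (insert e U) (?D g e)"
  proof -
    have "(m1 - m0)\<^sup>2 = (bexp p U (\<lambda>S. g1 S - g S))\<^sup>2" by (simp add: bexp_diff m1_def m0_def)
    \<comment> \<open>Jensen for the square, in the form that the variance of \<open>g1 - g\<close>
      is nonnegative.\<close>
    also have "\<dots> \<le> bexp p U (\<lambda>S. (g1 S - g S)\<^sup>2)"
      using bvar_nonneg[OF assms(2,3), of U "\<lambda>S. g1 S - g S"] insert.hyps by (simp add: bvar_alt)
    also have "\<dots> = bexp p U (\<lambda>S. (g (insert e S) - g (S - {e}))\<^sup>2)"
    proof (rule bexp_cong)
      fix S assume "S \<subseteq> U"
      then have "S - {e} = S" using insert.hyps by auto
      then show "(g1 S - g S)\<^sup>2 = (g (insert e S) - g (S - {e}))\<^sup>2" by (simp add: g1_def)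
    qed
    also have "\<dots> = bexp p (insert e U) (?D g e)"
    proof -
      have "bexp p U (\<lambda>S. ?D g e (insert e S)) = bexp p U (?D g e)"
        by (rule bexp_cong) auto
      then show ?thesis using insert.hyps by (subst bexp_insert) (auto simp: algebra_simps)
    qed
    finally show ?thesis .
  qed
  have c2: "bexp p (insert e U) (?D g e') = p * bexp p U (?D g1 e') + (1 - p) * bexp p U (?D g e')" if "e' \<in> U" for e'
  proof -
    have "e \<noteq> e'" using that insert.hyps by auto
    then have "insert e S - {e'} = insert e (S - {e'})" for S by auto
    then have "?D g e' (insert e S) = ?D g1 e' S" for S by (simp add: g1_def insert_commute)
    then show ?thesis using insert.hyps by (simp add: bexp_insert)
  qed
  have "bvar p (insert e U) g \<le> p * (p * (1 - p) * (\<Sum>e'\<in>U. bexp p U (?D g1 e')))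
      + (1 - p) * (p * (1 - p) * (\<Sum>e'\<in>U. bexp p U (?D g e'))) + p * (1 - p) * bexp p (insert e U) (?D g e)"
    unfolding v using assms by (intro add_mono mult_left_mono insert.IH c1) auto
  also have "\<dots> = p * (1 - p) * (bexp p (insert e U) (?D g e) + (\<Sum>e'\<in>U. p * bexp p U (?D g1 e') + (1 - p) * bexp p U (?D g e')))"
  proof -
    have *: "(\<Sum>e'\<in>U. p * bexp p U (?D g1 e') + (1 - p) * bexp p U (?D g e'))
        = p * (\<Sum>e'\<in>U. bexp p U (?D g1 e')) + (1 - p) * (\<Sum>e'\<in>U. bexp p U (?D g e'))"
      by (simp only: sum.distrib sum_distrib_left)
    have "p * (p * (1 - p) * A) + (1 - p) * (p * (1 - p) * B) + p * (1 - p) * C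
        = p * (1 - p) * (C + (p * A + (1 - p) * B))" for A B C :: real
      by (simp add: algebra_simps)
    then show ?thesis unfolding * .
  qed
  also have "\<dots> = p * (1 - p) * (\<Sum>e'\<in>insert e U. bexp p (insert e U) (?D g e'))"
    using insert.hyps c2 by simp
  finally show ?case .
qed

lemma Gbip_prob_bexp:
  "Gbip_prob n1 n2 p Q = bexp p (grid n1 n2) (\<lambda>S. of_bool (Q S))"
proof -
  let ?P = "Pow (grid n1 n2)"
  let ?w = "\<lambda>S. p ^ card S * (1 - p) ^ (n1 * n2 - card S)"
  have "bexp p (grid n1 n2) (\<lambda>S. of_bool (Q S)) = (\<Sum>S\<in>?P. if Q S then ?w S else 0)"
    unfolding bexp_def by (intro sum.cong) auto
  also have "\<dots> = sum ?w {S \<in> ?P. Q S}" by (subst sum.inter_filter) auto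
  finally show ?thesis by (simp add: Gbip_prob_def lessThan_atLeast0 Pow_def)
qed

section \<open>Counting rooted forests\<close>

text \<open>Parent functions on $A$ whose iteration always ends in the root set $R$: acyclicity is expressed by the
absence of a nonempty closed subset of $A$.\<close>

definition forests :: "'a set \<Rightarrow> 'a set \<Rightarrow> ('a \<Rightarrow> 'a) set" where
  "forests R A = {\<pi> \<in> A \<rightarrow>\<^sub>E (A \<union> R). \<forall>B. B \<subseteq> A \<and> B \<noteq> {} \<longrightarrow> \<not> \<pi> ` B \<subseteq> B}"

lemma finite_forests: "finite R \<Longrightarrow> finite A \<Longrightarrow> finite (forests R A)"
  unfolding forests_def by (rule finite_subset[OF _ finite_PiE[of A "\<lambda>_. A \<union> R"]]) auto

lemma forests_closed: "\<pi> \<in> forests R A \<Longrightarrow> B \<subseteq> A \<Longrightarrow> B \<noteq> {} \<Longrightarrow> \<not> \<pi> ` B \<subseteq> B"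
  by (simp add: forests_def)

lemma forests_into: "\<pi> \<in> forests R A \<Longrightarrow> a \<in> A \<Longrightarrow> \<pi> a \<in> A \<union> R"
  by (auto simp: forests_def)

lemma forestsI:
  "\<pi> \<in> A \<rightarrow>\<^sub>E (A \<union> R) \<Longrightarrow> (\<And>B. B \<subseteq> A \<Longrightarrow> B \<noteq> {} \<Longrightarrow> \<not> \<pi> ` B \<subseteq> B) \<Longrightarrow> \<pi> \<in> forests R A"
  by (simp add: forests_def)

lemma forests_no_loop: "\<pi> \<in> forests R A \<Longrightarrow> a \<in> A \<Longrightarrow> \<pi> a \<noteq> a"
  unfolding forests_def by (auto dest: spec[of _ "{a}"])

lemma forests_no_2cycle: "\<pi> \<in> forests R A \<Longrightarrow> a \<in> A \<Longrightarrow> b \<in> A \<Longrightarrow> \<pi> a = b \<Longrightarrow> \<pi> b \<noteq> a"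
  unfolding forests_def by (auto dest: spec[of _ "{a, b}"])

text \<open>With \<open>I\<close> the set of children of the roots, the parents of \<open>I\<close>
  are an arbitrary map into \<open>R\<close>, and what remains is a forest on \<open>A - I\<close>
  whose roots are \<open>I\<close>. This is the recursion behind Cayley's formula.\<close>

lemma forests_first_layer:
  assumes "finite A" "finite R" "A \<inter> R = {}" "I \<subseteq> A"
  shows "card {\<pi> \<in> forests R A. {a \<in> A. \<pi> a \<in> R} = I} = card R ^ card I * card (forests I (A - I))"
proof -
  let ?X = "{\<pi> \<in> forests R A. {a \<in> A. \<pi> a \<in> R} = I}"
  let ?Y = "(I \<rightarrow>\<^sub>E R) \<times> forests I (A - I)"
  define cut where "cut \<pi> = (restrict \<pi> I, restrict \<pi> (A - I))" for \<pi> :: "'a \<Rightarrow> 'a"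
  define glue where "glue = (\<lambda>(g, h) a. if a \<in> I then g a else h a :: 'a)"
  have "bij_betw cut ?X ?Y"
  proof (rule bij_betw_byWitness[where f' = glue])
    show "\<forall>\<pi>\<in>?X. glue (cut \<pi>) = \<pi>"
      using assms(4) by (auto simp: glue_def cut_def fun_eq_iff forests_def PiE_def extensional_def)
    show "\<forall>y\<in>?Y. cut (glue y) = y"
      using assms(4) by (auto simp: glue_def cut_def fun_eq_iff forests_def PiE_def extensional_def restrict_def)
    show "cut ` ?X \<subseteq> ?Y"
    proof (rule image_subsetI)
      fix \<pi> assume "\<pi> \<in> ?X"
      then have \<pi>: "\<pi> \<in> forests R A" and I: "I = {a \<in> A. \<pi> a \<in> R}" by auto
      let ?I = "{a \<in> A. \<pi> a \<in> R}"
      have "restrict \<pi> ?I \<in> ?I \<rightarrow>\<^sub>E R" by auto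
      moreover have "restrict \<pi> (A - ?I) \<in> forests ?I (A - ?I)"
      proof -
        have "\<pi> a \<in> A" if "a \<in> A - ?I" for a using forests_into[OF \<pi>] that by auto
        moreover have "\<not> restrict \<pi> (A - ?I) ` B \<subseteq> B" if B: "B \<subseteq> A - ?I" "B \<noteq> {}" for B
        proof -
          have "restrict \<pi> (A - ?I) ` B = \<pi> ` B" using B(1) by (intro image_cong) auto
          then show ?thesis using forests_closed[OF \<pi>, of B] B by (metis Diff_subset subset_trans)
        qed
        ultimately show ?thesis by (intro forestsI) auto
      qed
      ultimately show "cut \<pi> \<in> ?Y" by (simp add: cut_def I)
    qed
    show "glue ` ?Y \<subseteq> ?X"
    proof (rule image_subsetI)
      fix y assume "y \<in> ?Y"
      then obtain g h where y: "y = (g, h)" and g: "g \<in> I \<rightarrow>\<^sub>E R" and h: "h \<in> forests I (A - I)"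
        by auto
      let ?\<pi> = "glue (g, h)"
      have hA: "h a \<in> A" if "a \<in> A" "a \<notin> I" for a
        using forests_into[OF h, of a] that assms(4) by auto
      have \<pi>g: "?\<pi> a = g a" "g a \<in> R" if "a \<in> I" for a using that g by (auto simp: glue_def)
      have \<pi>h: "?\<pi> a = h a" if "a \<notin> I" for a using that by (auto simp: glue_def)
      have set: "{a \<in> A. ?\<pi> a \<in> R} = I"
      proof (rule set_eqI)
        fix a
        show "a \<in> {a \<in> A. ?\<pi> a \<in> R} \<longleftrightarrow> a \<in> I"
          using \<pi>g[of a] \<pi>h[of a] hA[of a] assms(3,4) by (cases "a \<in> I") auto
      qed
      have "?\<pi> \<in> A \<rightarrow>\<^sub>E (A \<union> R)"
      proof (rule PiE_I)
        fix a assume "a \<in> A"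
        then show "?\<pi> a \<in> A \<union> R" using \<pi>g[of a] \<pi>h[of a] hA[of a] by (cases "a \<in> I") auto
      next
        fix a assume "a \<notin> A"
        then show "?\<pi> a = undefined" using \<pi>h[of a] h assms(4)
          by (auto simp: forests_def PiE_def extensional_def)
      qed
      moreover have "\<not> ?\<pi> ` B \<subseteq> B" if B: "B \<subseteq> A" "B \<noteq> {}" for B
      proof
        assume cl: "?\<pi> ` B \<subseteq> B"
        \<comment> \<open>A closed subset of \<open>A\<close> cannot meet \<open>I\<close>, since
          \<open>g\<close> would lead it into \<open>R\<close>, which is disjoint from
          \<open>A\<close>.\<close>
        have "B \<inter> I = {}"
        proof (rule ccontr)
          assume "B \<inter> I \<noteq> {}"
          then obtain b where "b \<in> B" "b \<in> I" by auto
          then show False using cl \<pi>g B(1) assms(3) by (metis disjoint_iff image_subset_iff subsetD)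
        qed
        then have "B \<subseteq> A - I" using B by auto
        moreover have "h ` B \<subseteq> B" using cl \<pi>h \<open>B \<inter> I = {}\<close> by (metis disjoint_iff image_subset_iff)
        ultimately show False using forests_closed[OF h _ B(2)] by blast
      qed
      ultimately have "?\<pi> \<in> forests R A" by (rule forestsI)
      then show "glue y \<in> ?X" using set by (simp only: y mem_Collect_eq)
    qed
  qed
  then have "card ?X = card ?Y" by (rule bij_betw_same_card)
  also have "\<dots> = card R ^ card I * card (forests I (A - I))"
    using finite_subset[OF assms(4,1)] by (simp add: card_cartesian_product card_funcsetE)
  finally show ?thesis .
qed

lemma sum_Pow_card:
  assumes "finite A"
  shows "(\<Sum>I\<in>Pow A. f (card I)) = (\<Sum>i\<le>card A. (card A choose i) * f i)"
proof -
  have "(\<Sum>I\<in>Pow A. f (card I)) = (\<Sum>i\<le>card A. \<Sum>I\<in>{I \<in> Pow A. card I = i}. f (card I))"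
    using assms by (intro sum.group[symmetric]) (auto intro: card_mono)
  also have "\<dots> = (\<Sum>i\<le>card A. (card A choose i) * f i)"
  proof (intro sum.cong refl)
    fix i
    have "(\<Sum>I\<in>{I \<in> Pow A. card I = i}. f (card I)) = card {I. I \<subseteq> A \<and> card I = i} * f i"
      by simp
    then show "(\<Sum>I\<in>{I \<in> Pow A. card I = i}. f (card I)) = (card A choose i) * f i"
      using n_subsets[OF assms] by simp
  qed
  finally show ?thesis .
qed

text \<open>Write f(r, a) for the number of forests. The recursion is f(r, a) = sum over i of
  binom(a, i) r^i f(i, a - i), where inductively f(i, a - i) = i a^(a-i-1). The identity i binom(a,
  i) = a binom(a-1, i-1) turns the sum into a binomial expansion of (r + a)^(a-1).\<close>

lemma card_forests_aux:
  assumes "finite A" "finite R" "A \<inter> R = {}" "A \<noteq> {}"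
  shows "card (forests R A) = card R * (card R + card A) ^ (card A - 1)"
  using assms
proof (induction "card A" arbitrary: A R rule: less_induct)
  case less
  let ?a = "card A" and ?r = "card R"
  have a: "?a > 0" using less.prems by (simp add: card_gt_0_iff)
  let ?X = "\<lambda>I. {\<pi> \<in> forests R A. {a \<in> A. \<pi> a \<in> R} = I}"
  have "forests R A = (\<Union>I\<in>Pow A. ?X I)"
  proof (intro equalityI subsetI)
    fix \<pi> assume "\<pi> \<in> forests R A"
    then show "\<pi> \<in> (\<Union>I\<in>Pow A. ?X I)" by (intro UN_I[of "{a \<in> A. \<pi> a \<in> R}"]) simp_all
  qed simp
  then have "card (forests R A) = card (\<Union>I\<in>Pow A. ?X I)" by simp
  also have "\<dots> = (\<Sum>I\<in>Pow A. card (?X I))"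
  proof (rule card_UN_disjoint)
    show "\<forall>I\<in>Pow A. finite (?X I)" using less.prems finite_forests[of R A] by simp
    show "\<forall>I\<in>Pow A. \<forall>J\<in>Pow A. I \<noteq> J \<longrightarrow> ?X I \<inter> ?X J = {}"
      by (intro ballI impI equals0I) (elim IntE CollectE conjE, simp)
  qed (use less.prems in simp)
  finally have c: "card (forests R A) = (\<Sum>I\<in>Pow A. card (?X I))" .
  \<comment> \<open>The factor \<open>?a\<close> removes the exponent -1 that would occur for
    \<open>I = A\<close>, so one formula also covers the two extreme cases \<open>I = A\<close> (one
    empty forest) and \<open>I = {}\<close> (no forest without roots).\<close>
  have t: "?a * card (?X I) = ?r ^ card I * (card I * ?a ^ (?a - card I))" if I: "I \<in> Pow A" for I
  proof -
    have IA: "I \<subseteq> A" "finite I" using I less.prems finite_subset by auto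
    have x: "card (?X I) = ?r ^ card I * card (forests I (A - I))"
      using forests_first_layer[OF less.prems(1-3) IA(1)] .
    have "?a * card (forests I (A - I)) = card I * ?a ^ (?a - card I)"
    proof -
      consider "I = A" | "I = {}" | "I \<noteq> A" "I \<noteq> {}" by blast
      then show ?thesis
      proof cases
        case 1
        have "forests A {} = {\<lambda>_. undefined}" by (auto simp: forests_def)
        then show ?thesis using 1 by simp
      next
        case 2
        have "forests {} A = {}" using less.prems(4) by (auto simp: forests_def PiE_def Pi_def image_subset_iff)
        then show ?thesis using 2 by simp
      next
        case 3
        have ci: "0 < card I" "card I < ?a" using 3 IA less.prems(1) by (auto simp: card_gt_0_iff psubset_card_mono)
        have ca: "card (A - I) = ?a - card I" using IA by (simp add: card_Diff_subset)
        have "card (forests I (A - I)) = card I * (card I + card (A - I)) ^ (card (A - I) - 1)"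
          using 3 IA less.prems ci ca by (intro less.hyps) auto
        then have "card (forests I (A - I)) = card I * ?a ^ (?a - card I - 1)" using ci by (simp add: ca)
        moreover have "?a * ?a ^ (?a - card I - 1) = ?a ^ (?a - card I)"
          using ci by (metis Suc_diff_1 power_Suc zero_less_diff)
        ultimately show ?thesis by (metis mult.left_commute)
      qed
    qed
    then show ?thesis unfolding x by (metis mult.left_commute)
  qed
  have "?a * card (forests R A) = (\<Sum>I\<in>Pow A. ?a * card (?X I))" unfolding c by (simp add: sum_distrib_left)
  also have "\<dots> = (\<Sum>I\<in>Pow A. ?r ^ card I * (card I * ?a ^ (?a - card I)))" by (intro sum.cong refl t)
  also have "\<dots> = (\<Sum>i\<le>?a. (?a choose i) * (?r ^ i * (i * ?a ^ (?a - i))))"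
    by (rule sum_Pow_card[OF less.prems(1)])
  also have "\<dots> = (\<Sum>i\<le>Suc (?a - 1). (?a choose i) * (?r ^ i * (i * ?a ^ (?a - i))))" using a by simp
  also have "\<dots> = (\<Sum>l\<le>?a - 1. (?a choose Suc l) * (?r ^ Suc l * (Suc l * ?a ^ (?a - Suc l))))"
    by (subst sum.atMost_Suc_shift) simp
  also have "\<dots> = (\<Sum>l\<le>?a - 1. ?a * ?r * ((?a - 1 choose l) * ?r ^ l * ?a ^ (?a - 1 - l)))"
  proof (intro sum.cong refl)
    fix l
    have "Suc l * (?a choose Suc l) = ?a * (?a - 1 choose l)" using a by (metis Suc_diff_1 Suc_times_binomial_eq mult.commute)
    then have "?r ^ Suc l * ?a ^ (?a - Suc l) * (Suc l * (?a choose Suc l)) = ?r ^ Suc l * ?a ^ (?a - Suc l) * (?a * (?a - 1 choose l))"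
      by simp
    then show "(?a choose Suc l) * (?r ^ Suc l * (Suc l * ?a ^ (?a - Suc l))) = ?a * ?r * ((?a - 1 choose l) * ?r ^ l * ?a ^ (?a - 1 - l))"
      by (simp add: algebra_simps)
  qed
  also have "\<dots> = ?a * (?r * (?r + ?a) ^ (?a - 1))"
    by (subst binomial) (simp add: sum_distrib_left algebra_simps)
  finally show ?case using a by simp
qed

text \<open>Cayley's formula $(a+1)^{a-1}$, multiplied by $a+1$ to cover $a = 0$.\<close>

lemma card_forests:
  assumes "finite A" "v \<notin> A"
  shows "(card A + 1) * card (forests {v} A) = (card A + 1) ^ card A"
proof (cases "A = {}")
  case True
  have "forests {v} {} = {\<lambda>_. undefined}" by (auto simp: forests_def)
  then show ?thesis using True by simp
next
  case False
  then have "card (forests {v} A) = (1 + card A) ^ (card A - 1)"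
    using card_forests_aux[of A "{v}"] assms by simp
  moreover have "card A > 0" using False assms by (simp add: card_gt_0_iff)
  ultimately show ?thesis by (metis Suc_diff_1 add.commute power_Suc)
qed

section \<open>Tree components\<close>

definition col :: "(nat \<times> nat) set \<Rightarrow> nat \<Rightarrow> nat set" where
  "col S j = {i. (i, j) \<in> S}"

abbreviation lsets :: "nat \<Rightarrow> nat \<Rightarrow> nat \<Rightarrow> nat set set" where
  "lsets n1 v k \<equiv> {A. A \<subseteq> {..<n1} - {v} \<and> card A = k}"

abbreviation structs :: "nat \<Rightarrow> nat \<Rightarrow> nat set \<Rightarrow> ((nat \<Rightarrow> nat) \<times> (nat \<Rightarrow> nat)) set" where
  "structs n2 v A \<equiv> forests {v} A \<times> {\<iota> \<in> A \<rightarrow>\<^sub>E {..<n2}. inj_on \<iota> A}"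

text \<open>A potential tree component at $v$: the other left vertices $A$, the parent function of a tree rooted at
$v$, and for each $a$ in $A$ the right vertex subdividing the edge from $a$ to its parent.\<close>

definition confs :: "nat \<Rightarrow> nat \<Rightarrow> nat \<Rightarrow> nat \<Rightarrow> (nat set \<times> (nat \<Rightarrow> nat) \<times> (nat \<Rightarrow> nat)) set" where
  "confs n1 n2 v k = (SIGMA A:lsets n1 v k. structs n2 v A)"

text \<open>Column conditions describing the component of $v$: \<open>upcol\<close> is implied (for some configuration) by having
a component of the right size without right vertices of degree at least 3, while the events given by
\<open>lowcol\<close> are disjoint for different configurations and imply that the component is as prescribed.\<close>

definition upcol :: "nat \<Rightarrow> (nat set \<times> (nat \<Rightarrow> nat) \<times> (nat \<Rightarrow> nat)) \<Rightarrow> nat \<Rightarrow> nat set \<Rightarrow> bool" where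
  "upcol v = (\<lambda>(A, \<pi>, \<iota>) j T. if j \<in> \<iota> ` A then \<exists>a\<in>A. \<iota> a = j \<and> {a, \<pi> a} \<subseteq> T
     else T \<inter> insert v A = {} \<or> T \<subseteq> insert v A)"

definition lowcol :: "nat \<Rightarrow> (nat set \<times> (nat \<Rightarrow> nat) \<times> (nat \<Rightarrow> nat)) \<Rightarrow> nat \<Rightarrow> nat set \<Rightarrow> bool" where
  "lowcol v = (\<lambda>(A, \<pi>, \<iota>) j T. if j \<in> \<iota> ` A then \<exists>a\<in>A. \<iota> a = j \<and> T = {a, \<pi> a}
     else T \<inter> insert v A = {} \<or> (\<exists>x\<in>insert v A. T = {x}))"

lemma confsD:
  assumes "(A, \<pi>, \<iota>) \<in> confs n1 n2 v k"
  shows "A \<subseteq> {..<n1}" "v \<notin> A" "finite A" "card A = k" "\<pi> \<in> forests {v} A"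
    "\<And>a. a \<in> A \<Longrightarrow> \<iota> a < n2" "inj_on \<iota> A" "\<iota> \<in> A \<rightarrow>\<^sub>E {..<n2}" "\<And>a. a \<in> A \<Longrightarrow> \<pi> a \<in> insert v A"
    "\<And>a. a \<in> A \<Longrightarrow> \<pi> a \<noteq> a"
proof -
  show A: "A \<subseteq> {..<n1}" and "v \<notin> A" "card A = k" and \<pi>: "\<pi> \<in> forests {v} A"
    and "\<And>a. a \<in> A \<Longrightarrow> \<iota> a < n2" "inj_on \<iota> A" "\<iota> \<in> A \<rightarrow>\<^sub>E {..<n2}"
    using assms by (auto simp: confs_def)
  show "finite A" using A finite_subset by blast
  show "\<pi> a \<in> insert v A" if "a \<in> A" for a using forests_into[OF \<pi> that] by simp
  show "\<pi> a \<noteq> a" if "a \<in> A" for a using forests_no_loop[OF \<pi> that] .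
qed

lemma same_column_conn: "(i, j) \<in> S \<Longrightarrow> (i', j) \<in> S \<Longrightarrow> (Inl i, Inl i') \<in> conn S"
  by (rule converse_rtrancl_into_rtrancl[of _ "Inr j"], simp, rule r_into_rtrancl, simp)

text \<open>Vertices of \<open>A\<close> not connected to \<open>v\<close> would form a set closed
  under the parent function, which acyclicity excludes. Conversely, every column meeting
  \<open>insert v A\<close> lies inside it, so no path leaves this set.\<close>

lemma lowcol_component:
  assumes c: "(A, \<pi>, \<iota>) \<in> confs n1 n2 v k" and S: "S \<subseteq> grid n1 n2" and v: "v < n1"
    and low: "\<And>j. j < n2 \<Longrightarrow> lowcol v (A, \<pi>, \<iota>) j (col S j)"
  shows "lcomp n1 S v = insert v A"
proof -
  note C = confsD[OF c]
  let ?A = "insert v A"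
  have edge: "(a, \<iota> a) \<in> S" "(\<pi> a, \<iota> a) \<in> S" if a: "a \<in> A" for a
  proof -
    have "\<exists>b\<in>A. \<iota> b = \<iota> a \<and> col S (\<iota> a) = {b, \<pi> b}"
      using low[OF C(6)[OF a]] a by (auto simp: lowcol_def)
    then have "col S (\<iota> a) = {a, \<pi> a}" using C(7) a by (auto dest: inj_onD)
    then show "(a, \<iota> a) \<in> S" "(\<pi> a, \<iota> a) \<in> S" by (auto simp: col_def)
  qed
  have "?A \<subseteq> lcomp n1 S v"
  proof -
    define B where "B = {a \<in> A. (Inl v, Inl a) \<notin> conn S}"
    have "\<pi> ` B \<subseteq> B"
    proof (rule image_subsetI)
      fix b assume b: "b \<in> B"
      then have bA: "b \<in> A" by (simp add: B_def)
      have "(Inl (\<pi> b), Inl b) \<in> conn S" using edge[OF bA] same_column_conn by blast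
      then have "(Inl v, Inl (\<pi> b)) \<notin> conn S" using b by (auto simp: B_def dest: rtrancl_trans)
      moreover from this have "\<pi> b \<noteq> v" by auto
      ultimately show "\<pi> b \<in> B" using C(9)[OF bA] by (auto simp: B_def)
    qed
    then have "B = {}" using forests_closed[OF C(5), of B] by (auto simp: B_def)
    then show ?thesis using C(1) v by (auto simp: B_def lcomp_def)
  qed
  moreover have "lcomp n1 S v \<subseteq> ?A"
  proof -
    have inside: "col S j \<subseteq> ?A" if jn: "col S j \<inter> ?A \<noteq> {}" "j < n2" for j
    proof (cases "j \<in> \<iota> ` A")
      case True
      then obtain a where "a \<in> A" "col S j = {a, \<pi> a}" using low[OF jn(2)] by (auto simp: lowcol_def)
      then show ?thesis using C(9) by simp
    next
      case False
      then show ?thesis using low[OF jn(2)] jn(1) by (auto simp: lowcol_def)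
    qed
    have "y \<in> Inl ` ?A \<union> Inr ` {j. j < n2 \<and> col S j \<inter> ?A \<noteq> {}}" if "(Inl v, y) \<in> conn S" for y
      using that
    proof (induction rule: rtrancl_induct)
      case (step y z)
      from step(2) show ?case
      proof (cases rule: bip_dartsE)
        case (1 i j)
        then show ?thesis using step.IH S by (auto simp: col_def)
      next
        case (2 i j)
        then have "col S j \<inter> ?A \<noteq> {}" "j < n2" using step.IH S by auto
        then show ?thesis using inside 2 by (auto simp: col_def)
      qed
    qed simp
    then show ?thesis by (auto simp: lcomp_def)
  qed
  ultimately show ?thesis by auto
qed

text \<open>Where the two parent functions differ, an edge is oriented in opposite ways; following the first parent
function then stays inside the set of disagreement.\<close>

lemma forests_edges_determine:
  assumes \<pi>: "\<pi> \<in> forests {v} A" and \<pi>': "\<pi>' \<in> forests {v} A"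
    and eq: "\<And>a. a \<in> A \<Longrightarrow> \<exists>b\<in>A. {a, \<pi> a} = {b, \<pi>' b}"
  shows "\<pi> = \<pi>'"
proof -
  define B where "B = {a \<in> A. \<pi> a \<noteq> \<pi>' a}"
  have "\<pi> ` B \<subseteq> B"
  proof (rule image_subsetI)
    fix a assume a: "a \<in> B"
    then obtain b where b: "b \<in> A" "{a, \<pi> a} = {b, \<pi>' b}" using eq by (auto simp: B_def)
    have "b \<noteq> a" using a b by (auto simp: B_def doubleton_eq_iff)
    then have pa: "\<pi> a = b" "\<pi>' b = a" using b(2) by (auto simp: doubleton_eq_iff)
    have "\<pi> b \<noteq> a" using forests_no_2cycle[OF \<pi> _ b(1) pa(1)] a by (simp add: B_def)
    then show "\<pi> a \<in> B" using pa b(1) by (simp add: B_def)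
  qed
  then have "B = {}" using forests_closed[OF \<pi>, of B] by (auto simp: B_def)
  have "\<pi> \<in> A \<rightarrow>\<^sub>E A \<union> {v}" "\<pi>' \<in> A \<rightarrow>\<^sub>E A \<union> {v}"
    using \<pi> \<pi>' by (simp_all add: forests_def)
  then show ?thesis by (rule PiE_ext) (use \<open>B = {}\<close> in \<open>auto simp: B_def\<close>)
qed

text \<open>The component determines \<open>A\<close>. Its columns with two entries determine the
  tree edges, hence the parent function, and acyclicity forbids assigning the same edge to two
  vertices, which fixes \<open>\<iota>\<close>. Disjointness of the events lets their probabilities
  be added in a lower bound.\<close>

lemma lowcol_unique:
  assumes c: "(A, \<pi>, \<iota>) \<in> confs n1 n2 v k" "(A', \<pi>', \<iota>') \<in> confs n1 n2 v k"
    and S: "S \<subseteq> grid n1 n2" and v: "v < n1"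
    and low: "\<And>j. j < n2 \<Longrightarrow> lowcol v (A, \<pi>, \<iota>) j (col S j)"
      "\<And>j. j < n2 \<Longrightarrow> lowcol v (A', \<pi>', \<iota>') j (col S j)"
  shows "(A, \<pi>, \<iota>) = (A', \<pi>', \<iota>')"
proof -
  note C = confsD[OF c(1)] and C' = confsD[OF c(2)]
  have "insert v A = insert v A'"
    using lowcol_component[OF c(1) S v low(1)] lowcol_component[OF c(2) S v low(2)] by simp
  then have AA: "A' = A" using C(2) C'(2) by auto
  have col1: "col S (\<iota> a) = {a, \<pi> a}" if "a \<in> A" for a
  proof -
    have "\<exists>b\<in>A. \<iota> b = \<iota> a \<and> col S (\<iota> a) = {b, \<pi> b}"
      using low(1)[OF C(6)[OF that]] that by (auto simp: lowcol_def)
    then show ?thesis using C(7) that by (auto dest: inj_onD)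
  qed
  have ex: "\<exists>b\<in>A. \<iota>' b = \<iota> a \<and> {a, \<pi> a} = {b, \<pi>' b}" if a: "a \<in> A" for a
  proof (rule ccontr)
    assume "\<not> ?thesis"
    then have "\<iota> a \<notin> \<iota>' ` A"
      using low(2)[OF C(6)[OF a]] col1[OF a] by (auto simp: lowcol_def AA split: if_splits)
    then have "{a, \<pi> a} \<inter> insert v A = {} \<or> (\<exists>x\<in>insert v A. {a, \<pi> a} = {x})"
      using low(2)[OF C(6)[OF a]] unfolding col1[OF a] by (auto simp: lowcol_def AA)
    then show False using a C(10)[OF a] by auto
  qed
  have pp: "\<pi> = \<pi>'"
    by (rule forests_edges_determine[OF C(5) C'(5)[unfolded AA]]) (use ex in blast)
  have "\<iota> a = \<iota>' a" if a: "a \<in> A" for a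
  proof -
    obtain b where b: "b \<in> A" "\<iota>' b = \<iota> a" "{a, \<pi> a} = {b, \<pi> b}" using ex[OF a] pp by auto
    have "b = a"
    proof (rule ccontr)
      assume "b \<noteq> a"
      then have "\<pi> a = b" "\<pi> b = a" using b(3) by (auto simp: doubleton_eq_iff)
      then show False using forests_no_2cycle[OF C(5) a b(1)] by simp
    qed
    then show ?thesis using b by simp
  qed
  then have "\<iota> = \<iota>'" using C(8) C'(8) unfolding AA by (metis PiE_ext)
  then show ?thesis using AA pp by simp
qed

text \<open>A breadth-first tree from \<open>v\<close>: each other vertex of the component chooses a
  parent on a smaller level and a right vertex adjacent to both. The degree bound makes these right
  vertices distinct.\<close>

lemma upcol_exists:
  assumes S: "S \<subseteq> grid n1 n2" and v: "v < n1"
    and card: "card (lcomp n1 S v) = Suc k"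
    and deg2: "\<And>j. (Inl v, Inr j) \<in> conn S \<Longrightarrow> deg S j \<le> 2"
  shows "\<exists>c\<in>confs n1 n2 v k. \<forall>j<n2. upcol v c j (col S j)"
proof -
  have fS: "finite S" using S finite_subset by blast
  let ?C = "lcomp n1 S v"
  define A where "A = ?C - {v}"
  have vC: "v \<in> ?C" using lcomp_self[OF v] .
  have fC: "finite ?C" by (simp add: lcomp_def)
  have A: "A \<subseteq> {..<n1} - {v}" "card A = k" "insert v A = ?C" "finite A"
    using vC card fC by (auto simp: A_def lcomp_def)
  define H where "H = {(a, b). \<exists>j. (a, j) \<in> S \<and> (b, j) \<in> S}"
  have reach: "(y = Inl a \<longrightarrow> (v, a) \<in> H\<^sup>*) \<and> (y = Inr j \<longrightarrow> (\<exists>a. (v, a) \<in> H\<^sup>* \<and> (a, j) \<in> S))"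
    if "(Inl v, y) \<in> conn S" for y a j
    using that
  proof (induction arbitrary: a j rule: rtrancl_induct)
    case (step y z)
    from step(2) show ?case
    proof (cases rule: bip_dartsE)
      case (1 i' j')
      then show ?thesis using step.IH by auto
    next
      case (2 i' j')
      then obtain b where "(v, b) \<in> H\<^sup>*" "(b, j') \<in> S" using step.IH by blast
      moreover have "(b, i') \<in> H" using 2 calculation by (auto simp: H_def)
      ultimately show ?thesis using 2 by (auto intro: rtrancl.intros(2))
    qed
  qed simp
  \<comment> \<open>Distance from \<open>v\<close> in the graph on left vertices with a common right
    neighbour. A parent has a smaller level, so a lowest vertex of a set has its parent outside the
    set.\<close>
  define lev where "lev a = (LEAST n. (v, a) \<in> H ^^ n)" for a
  have par: "\<exists>b j. b \<in> ?C \<and> lev b < lev a \<and> (a, j) \<in> S \<and> (b, j) \<in> S" if a: "a \<in> A" for a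
  proof -
    have "(Inl v, Inl a) \<in> conn S" using a by (simp add: A_def lcomp_def)
    then have "(v, a) \<in> H\<^sup>*" using reach by blast
    then obtain n where "(v, a) \<in> H ^^ n" by (auto simp: rtrancl_power)
    then have l: "(v, a) \<in> H ^^ lev a" unfolding lev_def by (rule LeastI)
    have "a \<noteq> v" using a by (simp add: A_def)
    then have "lev a \<noteq> 0" using l by (metis relpow_0_E)
    then obtain m where m: "lev a = Suc m" by (cases "lev a") auto
    then obtain b where b: "(v, b) \<in> H ^^ m" "(b, a) \<in> H" using l by auto
    have "lev b \<le> m" unfolding lev_def using b(1) by (rule Least_le)
    obtain j where j: "(b, j) \<in> S" "(a, j) \<in> S" using b(2) by (auto simp: H_def)
    have "(Inl v, Inl b) \<in> conn S"
      using \<open>(Inl v, Inl a) \<in> conn S\<close> same_column_conn[OF j(2,1)] by (rule rtrancl_trans)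
    then have "b \<in> ?C" using j S by (auto simp: lcomp_def)
    then show ?thesis using j m \<open>lev b \<le> m\<close> by (intro exI[of _ b] exI[of _ j]) simp
  qed
  obtain \<pi>0 \<iota>0 where P: "\<And>a. a \<in> A \<Longrightarrow> \<pi>0 a \<in> ?C \<and> lev (\<pi>0 a) < lev a \<and> (a, \<iota>0 a) \<in> S \<and> (\<pi>0 a, \<iota>0 a) \<in> S"
    using par by metis
  define \<pi> where "\<pi> = restrict \<pi>0 A"
  define \<iota> where "\<iota> = restrict \<iota>0 A"
  have Q: "\<pi> a \<in> ?C" "lev (\<pi> a) < lev a" "(a, \<iota> a) \<in> S" "(\<pi> a, \<iota> a) \<in> S" if "a \<in> A" for a
    using P[OF that] that by (auto simp: \<pi>_def \<iota>_def)
  have "\<pi> \<in> forests {v} A"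
  proof (rule forestsI)
    show "\<pi> \<in> A \<rightarrow>\<^sub>E A \<union> {v}" using P A(3) by (auto simp: \<pi>_def)
    fix B assume B: "B \<subseteq> A" "B \<noteq> {}"
    define b where "b = arg_min_on lev B"
    have fB: "finite B" using B A(4) finite_subset by blast
    have b: "b \<in> B" "\<And>x. x \<in> B \<Longrightarrow> lev b \<le> lev x"
      unfolding b_def using arg_min_if_finite[OF fB B(2), of lev] by (auto simp: not_less)
    then show "\<not> \<pi> ` B \<subseteq> B" using Q(2)[of b] B(1) by (metis image_subset_iff leD subsetD)
  qed
  note \<pi> = this
  have conn: "deg S (\<iota> a) \<le> 2" if a: "a \<in> A" for a
  proof (rule deg2)
    have "(Inl v, Inl a) \<in> conn S" using a by (simp add: A_def lcomp_def)
    then show "(Inl v, Inr (\<iota> a)) \<in> conn S" by (rule rtrancl.intros(2)) (use Q(3)[OF a] in simp)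
  qed
  \<comment> \<open>If \<open>a\<close> and \<open>b\<close> shared a right vertex, its
    neighbourhood would be exactly \<open>{a, b}\<close>, so each would be the parent of the
    other.\<close>
  have "inj_on \<iota> A"
  proof (rule inj_onI, rule ccontr)
    fix a b assume ab: "a \<in> A" "b \<in> A" "\<iota> a = \<iota> b" "a \<noteq> b"
    let ?U = "{i. (i, \<iota> a) \<in> S}"
    have fU: "finite ?U" by (rule finite_col[OF fS])
    have na: "\<pi> a \<noteq> a" "\<pi> b \<noteq> b" using forests_no_loop[OF \<pi>] ab by auto
    have sub: "{a, b} \<subseteq> ?U" "\<pi> a \<in> ?U" "\<pi> b \<in> ?U" 
      using Q(3,4)[OF ab(1)] Q(3,4)[OF ab(2)] ab(3) by auto
    have cU: "card ?U \<le> 2" using conn[OF ab(1)] by (simp add: deg_def)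
    have "?U = {a, b}" using card_seteq[OF fU sub(1)] cU ab(4) by simp
    then have "\<pi> a = b" "\<pi> b = a" using sub na by auto
    then show False using forests_no_2cycle[OF \<pi> ab(1,2)] by simp
  qed
  moreover have "\<iota> \<in> A \<rightarrow>\<^sub>E {..<n2}" using P S by (auto simp: \<iota>_def)
  ultimately have c: "(A, \<pi>, \<iota>) \<in> confs n1 n2 v k" using A \<pi> by (simp add: confs_def)
  have "upcol v (A, \<pi>, \<iota>) j (col S j)" for j
  proof (cases "j \<in> \<iota> ` A")
    case True
    then obtain a where "a \<in> A" "\<iota> a = j" by auto
    then have "{a, \<pi> a} \<subseteq> col S j" using Q(3,4) by (auto simp: col_def)
    then show ?thesis using True \<open>a \<in> A\<close> \<open>\<iota> a = j\<close> by (auto simp: upcol_def)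
  next
    case False
    have "col S j \<subseteq> ?C" if x: "x \<in> col S j" "x \<in> ?C" for x
    proof
      fix y assume y: "y \<in> col S j"
      have "(Inl x, Inl y) \<in> conn S" using x(1) y by (auto simp: col_def intro: same_column_conn)
      then show "y \<in> ?C" using x(2) y S by (auto simp: lcomp_def col_def intro: rtrancl_trans)
    qed
    then have "col S j \<inter> ?C = {} \<or> col S j \<subseteq> ?C" by blast
    then show ?thesis using False by (simp add: upcol_def A(3))
  qed
  then show ?thesis using c by blast
qed

section \<open>Moment bounds\<close>

text \<open>A change at \<open>(i, j)\<close> matters only if column \<open>j\<close> holds another
  edge, of probability at most n_1 p. This factor reduces the Efron-Stein sum from n_1 n_2 p, the
  order of the number of edges, to n_1 n_2 p * n_1 p.\<close>

lemma bvar_cyclo_le: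
  assumes p: "0 \<le> p" "p \<le> 1"
  shows "bvar p (grid n1 n2) (cyclo n1 n2) \<le> (real n1 * real n2 * p\<^sup>2) * real n1"
proof -
  let ?G = "grid n1 n2"
  have D: "bexp p ?G (\<lambda>S. (cyclo n1 n2 (insert e S) - cyclo n1 n2 (S - {e}))\<^sup>2) \<le> real n1 * p" if e: "e \<in> ?G" for e
  proof -
    obtain i j where ij: "e = (i, j)" "i < n1" "j < n2" using e by auto
    have "(cyclo n1 n2 (insert e S) - cyclo n1 n2 (S - {e}))\<^sup>2 \<le> (\<Sum>i'<n1. of_bool ({(i', j)} \<subseteq> S))" if S: "S \<subseteq> ?G" for S
    proof -
      have "\<bar>cyclo n1 n2 (insert (i, j) (S - {e})) - cyclo n1 n2 (S - {e})\<bar> \<le> of_bool (\<exists>i'. (i', j) \<in> S - {e})"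
        using ij finite_subset_grid[OF S] cyclo_insert[of "S - {e}" i j n2 n1] by auto
      then have x: "\<bar>cyclo n1 n2 (insert e S) - cyclo n1 n2 (S - {e})\<bar> \<le> of_bool (\<exists>i'. (i', j) \<in> S - {e})"
        by (simp add: ij(1))
      show ?thesis
      proof (cases "\<exists>i'. (i', j) \<in> S - {e}")
        case True
        then obtain i' where i': "(i', j) \<in> S" "i' < n1" using S by auto
        have "(cyclo n1 n2 (insert e S) - cyclo n1 n2 (S - {e}))\<^sup>2 \<le> 1"
          using x True by (simp add: abs_square_le_1)
        also have "1 \<le> (\<Sum>i'<n1. of_bool ({(i', j)} \<subseteq> S) :: real)"
          using i' member_le_sum[of i' "{..<n1}" "\<lambda>i'. of_bool ({(i', j)} \<subseteq> S) :: real"] by simp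
        finally show ?thesis .
      next
        case False
        then have "cyclo n1 n2 (insert e S) - cyclo n1 n2 (S - {e}) = 0"
          using x by (simp only: False of_bool_eq abs_le_zero_iff)
        then show ?thesis by (simp add: sum_nonneg)
      qed
    qed
    then have "bexp p ?G (\<lambda>S. (cyclo n1 n2 (insert e S) - cyclo n1 n2 (S - {e}))\<^sup>2) \<le> bexp p ?G (\<lambda>S. \<Sum>i'<n1. of_bool ({(i', j)} \<subseteq> S))"
      using p by (intro bexp_mono)
    also have "\<dots> = (\<Sum>i'<n1. p)"
      unfolding bexp_sum
    proof (intro sum.cong refl)
      fix i' assume "i' \<in> {..<n1}"
      then show "bexp p ?G (\<lambda>S. of_bool ({(i', j)} \<subseteq> S)) = p" using bexp_superset[of ?G "{(i', j)}" p] ij(3) by simp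
    qed
    finally show ?thesis by simp
  qed
  have "bvar p ?G (cyclo n1 n2) \<le> p * (1 - p) * (\<Sum>e\<in>?G. bexp p ?G (\<lambda>S. (cyclo n1 n2 (insert e S) - cyclo n1 n2 (S - {e}))\<^sup>2))"
    using p by (intro efron_stein) auto
  also have "\<dots> \<le> p * (1 - p) * (\<Sum>e\<in>?G. real n1 * p)"
    using p by (intro mult_left_mono sum_mono D) auto
  also have "\<dots> \<le> p * 1 * (\<Sum>e\<in>?G. real n1 * p)"
    using p by (intro mult_right_mono mult_left_mono sum_nonneg) auto
  also have "\<dots> = (real n1 * real n2 * p\<^sup>2) * real n1" by (simp add: power2_eq_square algebra_simps)
  finally show ?thesis .
qed

text \<open>First moment over pairs consisting of an edge and a second edge in its column.\<close>

lemma bexp_heavy_le: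
  assumes p: "0 \<le> p" "p \<le> 1"
  shows "bexp p (grid n1 n2) (\<lambda>S. real (heavy_edges S)) \<le> (real n1 * real n2 * p\<^sup>2) * real n1"
proof -
  let ?G = "grid n1 n2"
  have "real (heavy_edges S) \<le> (\<Sum>e\<in>?G. \<Sum>i'\<in>{..<n1} - {fst e}. of_bool ({e, (i', snd e)} \<subseteq> S))" if S: "S \<subseteq> ?G" for S
  proof -
    have "real (heavy_edges S) = (\<Sum>e\<in>?G. of_bool (e \<in> S \<and> 2 \<le> deg S (snd e)))"
    proof -
      have "{e \<in> S. 2 \<le> deg S (snd e)} = {e \<in> ?G. e \<in> S \<and> 2 \<le> deg S (snd e)}" using S by auto
      then show ?thesis unfolding heavy_edges_def by (simp add: Int_def)
    qed
    also have "\<dots> \<le> (\<Sum>e\<in>?G. \<Sum>i'\<in>{..<n1} - {fst e}. of_bool ({e, (i', snd e)} \<subseteq> S))"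
    proof (rule sum_mono)
      fix e assume "e \<in> ?G"
      show "of_bool (e \<in> S \<and> 2 \<le> deg S (snd e)) \<le> (\<Sum>i'\<in>{..<n1} - {fst e}. of_bool ({e, (i', snd e)} \<subseteq> S) :: real)"
      proof (cases "e \<in> S \<and> 2 \<le> deg S (snd e)")
        case True
        have "\<not> {i. (i, snd e) \<in> S} \<subseteq> {fst e}"
        proof
          assume "{i. (i, snd e) \<in> S} \<subseteq> {fst e}"
          then have "card {i. (i, snd e) \<in> S} \<le> card {fst e}" by (intro card_mono) auto
          then show False using True by (simp add: deg_def)
        qed
        then obtain i' where i': "(i', snd e) \<in> S" "i' \<noteq> fst e" by auto
        then have "i' < n1" using S by auto
        then show ?thesis using True i'
            member_le_sum[of i' "{..<n1} - {fst e}" "\<lambda>i'. of_bool ({e, (i', snd e)} \<subseteq> S) :: real"] by simp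
      qed auto
    qed
    finally show ?thesis .
  qed
  then have "bexp p ?G (\<lambda>S. real (heavy_edges S)) \<le> bexp p ?G (\<lambda>S. \<Sum>e\<in>?G. \<Sum>i'\<in>{..<n1} - {fst e}. of_bool ({e, (i', snd e)} \<subseteq> S))"
    using p by (intro bexp_mono)
  also have "\<dots> = (\<Sum>e\<in>?G. \<Sum>i'\<in>{..<n1} - {fst e}. p\<^sup>2)"
    unfolding bexp_sum
  proof (intro sum.cong refl)
    fix e i' assume e: "e \<in> ?G" "i' \<in> {..<n1} - {fst e}"
    then have "e \<noteq> (i', snd e)" by (cases e) auto
    then have "card {e, (i', snd e)} = 2" by simp
    then show "bexp p ?G (\<lambda>S. of_bool ({e, (i', snd e)} \<subseteq> S)) = p\<^sup>2"
      using bexp_superset[of ?G "{e, (i', snd e)}" p] e by auto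
  qed
  also have "\<dots> \<le> (\<Sum>e\<in>?G. real n1 * p\<^sup>2)"
    by (intro sum_mono) (auto intro!: mult_right_mono)
  also have "\<dots> = (real n1 * real n2 * p\<^sup>2) * real n1" by simp
  finally show ?thesis .
qed

lemma cells_subset_grid: "set ps \<subseteq> grid n1 n2 \<Longrightarrow> cells ps \<subseteq> grid n1 n2"
proof
  fix x assume ps: "set ps \<subseteq> grid n1 n2" and x: "x \<in> cells ps"
  show "x \<in> grid n1 n2"
  proof (cases "x \<in> set ps")
    case False
    then obtain t where t: "t < length ps" "x = (fst (ps ! (Suc t mod length ps)), snd (ps ! t))"
      using x by (auto simp: cells_def)
    then have "ps ! (Suc t mod length ps) \<in> set ps" "ps ! t \<in> set ps" by (auto intro!: nth_mem mod_less_divisor)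
    then have "ps ! (Suc t mod length ps) \<in> grid n1 n2" "ps ! t \<in> grid n1 n2" using ps by auto
    then show ?thesis using t(2) by auto
  qed (use ps in blast)
qed

lemma bexp_cycles_le:
  assumes p: "0 \<le> p" "p \<le> 1"
  shows "bexp p (grid n1 n2) (\<lambda>S. real (card (short_cycles S L))) \<le> (\<Sum>k\<le>L. (real n1 * real n2 * p\<^sup>2) ^ k)"
proof -
  let ?G = "grid n1 n2"
  let ?Y = "{ps. set ps \<subseteq> ?G \<and> length ps \<le> L}"
  let ?C = "{ps \<in> ?Y. is_cyc ps}"
  have fY: "finite ?Y" by (rule finite_lists_length_le) simp
  have "bexp p ?G (\<lambda>S. real (card (short_cycles S L))) = bexp p ?G (\<lambda>S. \<Sum>ps\<in>?C. of_bool (cells ps \<subseteq> S))"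
  proof (rule bexp_cong)
    fix S assume S: "S \<subseteq> ?G"
    have "short_cycles S L = {ps \<in> ?C. cells ps \<subseteq> S}"
      using S by (auto simp: short_cycles_def cells_def)
    moreover have "finite ?C" by (rule finite_subset[OF _ fY]) blast
    ultimately show "real (card (short_cycles S L)) = (\<Sum>ps\<in>?C. of_bool (cells ps \<subseteq> S))"
      by (simp add: Int_def)
  qed
  also have "\<dots> = (\<Sum>ps\<in>?C. (p\<^sup>2) ^ length ps)"
    unfolding bexp_sum
  proof (intro sum.cong refl)
    fix ps assume ps: "ps \<in> ?C"
    then have "bexp p ?G (\<lambda>S. of_bool (cells ps \<subseteq> S)) = p ^ card (cells ps)"
      by (intro bexp_superset cells_subset_grid) auto
    also have "card (cells ps) = 2 * length ps" using ps card_cells by auto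
    finally show "bexp p ?G (\<lambda>S. of_bool (cells ps \<subseteq> S)) = (p\<^sup>2) ^ length ps" by (simp add: power_mult)
  qed
  also have "\<dots> \<le> (\<Sum>ps\<in>?Y. (p\<^sup>2) ^ length ps)" using fY by (intro sum_mono2) auto
  also have "\<dots> = (\<Sum>k\<le>L. \<Sum>ps\<in>{ps \<in> ?Y. length ps = k}. (p\<^sup>2) ^ length ps)"
    using fY by (intro sum.group[symmetric]) auto
  also have "\<dots> = (\<Sum>k\<le>L. (real n1 * real n2 * p\<^sup>2) ^ k)"
  proof (intro sum.cong refl)
    fix k assume "k \<in> {..L}"
    then have "{ps \<in> ?Y. length ps = k} = {ps. set ps \<subseteq> ?G \<and> length ps = k}" by auto
    moreover have "card {ps. set ps \<subseteq> ?G \<and> length ps = k} = (n1 * n2) ^ k"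
      by (subst card_lists_length_eq) auto
    ultimately have "card {ps \<in> ?Y. length ps = k} = (n1 * n2) ^ k" by simp
    then show "(\<Sum>ps\<in>{ps \<in> ?Y. length ps = k}. (p\<^sup>2) ^ length ps) = (real n1 * real n2 * p\<^sup>2) ^ k"
      by (simp add: power_mult_distrib)
  qed
  finally show ?thesis .
qed

lemma bexp_exc:
  shows "bexp p (grid n1 n2) (\<lambda>S. real (excess n2 S)) = real n2 * (real n1 * p - 1 + (1 - p) ^ n1)"
proof -
  have col: "bexp p {..<n1} (\<lambda>T. real (card T - 1)) = real n1 * p - 1 + (1 - p) ^ n1"
  proof -
    \<comment> \<open>The truncated difference is 0 on an empty column, where the real one is
      -1.\<close>
    have "bexp p {..<n1} (\<lambda>T. real (card T - 1)) = bexp p {..<n1} (\<lambda>T. real (card T) - 1 + of_bool (T = {}))"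
    proof (rule bexp_cong)
      fix T :: "nat set" assume "T \<subseteq> {..<n1}"
      then have "finite T" using finite_subset by blast
      then show "real (card T - 1) = real (card T) - 1 + of_bool (T = {})"
        by (cases "T = {}") (auto simp: of_nat_diff Suc_leI card_gt_0_iff)
    qed
    also have "\<dots> = real n1 * p - 1 + (1 - p) ^ n1"
      by (simp add: bexp_add bexp_diff bexp_card bexp_const bexp_singleton)
    finally show ?thesis .
  qed
  have "bexp p (grid n1 n2) (\<lambda>S. real (excess n2 S)) = bexp p (grid n1 n2) (\<lambda>S. \<Sum>j<n2. real (card {i. (i, j) \<in> S} - 1))"
    by (simp add: excess_def deg_def)
  also have "\<dots> = (\<Sum>j<n2. bexp p {..<n1} (\<lambda>T. real (card T - 1)))"
    unfolding bexp_sum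
    by (intro sum.cong refl bexp_column[where h = "\<lambda>T. real (card T - 1)"]) auto
  finally show ?thesis unfolding col by simp
qed

section \<open>Counting components by their sizes\<close>

lemma lcomps_sum: "real (lcomps n1 S) = (\<Sum>v<n1. 1 / real (card (lcomp n1 S v)))"
proof -
  have "(\<Sum>v<n1. 1 / real (card (lcomp n1 S v))) = (\<Sum>C\<in>lcomp n1 S ` {..<n1}. \<Sum>v\<in>{v \<in> {..<n1}. lcomp n1 S v = C}. 1 / real (card (lcomp n1 S v)))"
    by (rule sum.image_gen) simp
  also have "\<dots> = (\<Sum>C\<in>lcomp n1 S ` {..<n1}. 1)"
  proof (rule sum.cong[OF refl])
    fix C assume "C \<in> lcomp n1 S ` {..<n1}"
    then obtain v where v: "v < n1" "C = lcomp n1 S v" by auto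
    have "{u \<in> {..<n1}. lcomp n1 S u = C} = C"
    proof (rule set_eqI)
      fix u
      have "u \<in> C \<longleftrightarrow> u < n1 \<and> (Inl v, Inl u) \<in> conn S" by (simp add: v(2) lcomp_def)
      then show "u \<in> {u \<in> {..<n1}. lcomp n1 S u = C} \<longleftrightarrow> u \<in> C"
        unfolding v(2) using lcomp_eq_iff[of u n1 S v] by auto
    qed
    moreover have "card C \<noteq> 0" using v lcomp_self[OF v(1), of S] by (auto simp: lcomp_def)
    moreover have "(\<Sum>u\<in>{u \<in> {..<n1}. lcomp n1 S u = C}. 1 / real (card (lcomp n1 S u)))
        = (\<Sum>u\<in>{u \<in> {..<n1}. lcomp n1 S u = C}. 1 / real (card C))"
      by (intro sum.cong) auto
    ultimately show "(\<Sum>u\<in>{u \<in> {..<n1}. lcomp n1 S u = C}. 1 / real (card (lcomp n1 S u))) = 1"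
      by simp
  qed
  finally show ?thesis by (simp add: lcomps_def)
qed

text \<open>An expected number of left vertices, which becomes a probability after division by
  \<open>n1\<close>. The index \<open>k\<close> counts the left vertices other than
  \<open>v\<close>, as in \<open>confs\<close>.\<close>

definition comp_prob :: "real \<Rightarrow> nat \<Rightarrow> nat \<Rightarrow> nat \<Rightarrow> real" where
  "comp_prob p n1 n2 k = (\<Sum>v<n1. bexp p (grid n1 n2) (\<lambda>S. of_bool (card (lcomp n1 S v) = Suc k)))"

text \<open>A left vertex in a component with more than \<open>K\<close> left vertices contributes
  less than 1/\<open>K\<close> to the number of components, so truncation costs at most
  \<open>n1\<close> / \<open>K\<close>.\<close>

lemma bexp_kap_bounds:
  assumes p: "0 \<le> p" "p \<le> 1" and K: "K > 0"
  shows "(\<Sum>k<K. comp_prob p n1 n2 k / Suc k) \<le> bexp p (grid n1 n2) (\<lambda>S. real (lcomps n1 S))"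
    "bexp p (grid n1 n2) (\<lambda>S. real (lcomps n1 S)) \<le> (\<Sum>k<K. comp_prob p n1 n2 k / Suc k) + real n1 / K"
proof -
  let ?G = "grid n1 n2"
  let ?t = "\<lambda>S v. \<Sum>k<K. 1 / Suc k * of_bool (card (lcomp n1 S v) = Suc k) :: real"
  have t: "?t S v = (if c \<le> K then 1 / real c else 0)" if c: "c = card (lcomp n1 S v)" "c > 0" for S v c
  proof -
    have "?t S v = (\<Sum>k<K. if k = c - 1 then 1 / Suc k else 0)" using c by (intro sum.cong) auto
    also have "\<dots> = (if c - 1 < K then 1 / Suc (c - 1) else 0)" by (subst sum.delta) auto
    also have "\<dots> = (if c \<le> K then 1 / real c else 0)" using c(2) by auto
    finally show ?thesis .
  qed
  have pos: "card (lcomp n1 S v) > 0" if "v < n1" for S v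
    using lcomp_self[OF that, of S] by (auto simp: lcomp_def card_gt_0_iff)
  have e: "(\<Sum>k<K. comp_prob p n1 n2 k / Suc k) = bexp p ?G (\<lambda>S. \<Sum>v<n1. ?t S v)"
  proof -
    have "bexp p ?G (\<lambda>S. \<Sum>v<n1. ?t S v) = (\<Sum>v<n1. \<Sum>k<K. 1 / Suc k * bexp p ?G (\<lambda>S. of_bool (card (lcomp n1 S v) = Suc k)))"
      by (simp only: bexp_sum bexp_cmult)
    also have "\<dots> = (\<Sum>k<K. \<Sum>v<n1. 1 / Suc k * bexp p ?G (\<lambda>S. of_bool (card (lcomp n1 S v) = Suc k)))"
      by (rule sum.swap)
    finally show ?thesis by (simp add: comp_prob_def sum_divide_distrib)
  qed
  show "(\<Sum>k<K. comp_prob p n1 n2 k / Suc k) \<le> bexp p ?G (\<lambda>S. real (lcomps n1 S))"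
    unfolding e using p
  proof (intro bexp_mono)
    fix S
    show "(\<Sum>v<n1. ?t S v) \<le> real (lcomps n1 S)" unfolding lcomps_sum
      by (intro sum_mono) (use t[OF refl pos] in auto)
  qed
  have "bexp p ?G (\<lambda>S. real (lcomps n1 S)) \<le> bexp p ?G (\<lambda>S. (\<Sum>v<n1. ?t S v) + real n1 / K)"
    using p
  proof (intro bexp_mono)
    fix S
    have "real (lcomps n1 S) \<le> (\<Sum>v<n1. ?t S v + 1 / K)" unfolding lcomps_sum
    proof (intro sum_mono)
      fix v assume v: "v \<in> {..<n1}"
      have "card (lcomp n1 S v) > 0" using v pos by simp
      then show "1 / real (card (lcomp n1 S v)) \<le> ?t S v + 1 / K"
        using t[OF refl, of S v] K by (auto simp: frac_le)
    qed
    also have "\<dots> = (\<Sum>v<n1. ?t S v) + real n1 / K" by (simp add: sum.distrib)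
    finally show "real (lcomps n1 S) \<le> (\<Sum>v<n1. ?t S v) + real n1 / K" .
  qed
  also have "\<dots> = (\<Sum>k<K. comp_prob p n1 n2 k / Suc k) + real n1 / K"
    unfolding e by (simp add: bexp_add bexp_const)
  finally show "bexp p ?G (\<lambda>S. real (lcomps n1 S)) \<le> (\<Sum>k<K. comp_prob p n1 n2 k / Suc k) + real n1 / K" .
qed

lemma prod_of_bool: "(\<Prod>j<(n::nat). of_bool (P j) :: real) = of_bool (\<forall>j<n. P j)"
  by (induction n) (auto simp: less_Suc_eq)

section \<open>Probabilities of tree configurations\<close>

lemma bexp_all_columns:
  "bexp p (grid n1 n2) (\<lambda>S. of_bool (\<forall>j<n2. P j (col S j))) = (\<Prod>j<n2. bexp p {..<n1} (\<lambda>T. of_bool (P j T)))"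
  using bexp_columns[of "{..<n1}" p n2 "\<lambda>j T. of_bool (P j T)"] by (simp add: prod_of_bool col_def)

lemma finite_confs_fibre:
  fixes v n1 n2 :: nat
  assumes "A \<subseteq> {..<n1} - {v}"
  shows "finite (structs n2 v A)"
proof -
  have fA: "finite A" using assms finite_subset by blast
  then have "finite (A \<rightarrow>\<^sub>E {..<n2})" by (intro finite_PiE) auto
  then have "finite {\<iota> \<in> A \<rightarrow>\<^sub>E {..<n2}. inj_on \<iota> A}" by simp
  then show ?thesis by (intro finite_cartesian_product finite_forests fA) simp_all
qed

lemma finite_confs: "finite (confs n1 n2 v k)"
  unfolding confs_def
proof (rule finite_SigmaI)
  fix A assume "A \<in> lsets n1 v k"
  then have "A \<subseteq> {..<n1} - {v}" by blast
  then show "finite (structs n2 v A)" by (rule finite_confs_fibre)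
qed simp

text \<open>Choice of the other vertices, Cayley's (k+1)^(k-1) as a quotient that is also correct
  for k = 0, and the falling factorial of \<open>n2\<close> for the injective choice of right
  vertices.\<close>

definition conf_count :: "nat \<Rightarrow> nat \<Rightarrow> nat \<Rightarrow> real" where
  "conf_count n1 n2 k = real ((n1 - 1) choose k) * (real (k + 1) ^ k / real (k + 1)) * real (prod ((-) n2) {0..<k})"

lemma card_confs:
  assumes v: "v < n1"
  shows "real (card (confs n1 n2 v k)) = conf_count n1 n2 k"
proof -
  have e: "real (card (structs n2 v A)) = real (k + 1) ^ k / real (k + 1) * real (prod ((-) n2) {0..<k})"
    if A: "A \<in> lsets n1 v k" for A
  proof -
    have fA: "finite A" "v \<notin> A" "card A = k" using A finite_subset by auto
    have "card {\<iota> \<in> A \<rightarrow>\<^sub>E {..<n2}. inj_on \<iota> A} = prod ((-) n2) {0..<k}"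
      using card_inj_on_subset_funcset[of A "{..<n2}" A] fA by simp
    moreover have "real (card (forests {v} A)) = real (k + 1) ^ k / real (k + 1)"
    proof -
      have "real ((k + 1) * card (forests {v} A)) = real ((k + 1) ^ k)"
        using card_forests[OF fA(1,2)] fA(3) by simp
      then have "real (k + 1) * real (card (forests {v} A)) = real (k + 1) ^ k"
        by (simp only: of_nat_mult of_nat_power)
      then show ?thesis by (simp add: field_simps)
    qed
    ultimately show ?thesis by (simp only: card_cartesian_product of_nat_mult)
  qed
  have fin: "\<forall>A\<in>lsets n1 v k. finite (structs n2 v A)"
    using finite_confs_fibre by blast
  have "real (card (confs n1 n2 v k)) = (\<Sum>A\<in>lsets n1 v k. real (card (structs n2 v A)))"
    unfolding confs_def by (subst card_SigmaI[OF _ fin]) simp_all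
  also have "\<dots> = (\<Sum>A\<in>lsets n1 v k. real (k + 1) ^ k / real (k + 1) * real (prod ((-) n2) {0..<k}))"
    by (intro sum.cong refl e)
  also have "\<dots> = real (card (lsets n1 v k)) * (real (k + 1) ^ k / real (k + 1) * real (prod ((-) n2) {0..<k}))"
    by simp
  also have "card (lsets n1 v k) = (n1 - 1) choose k"
    using n_subsets[of "{..<n1} - {v}" k] v by simp
  finally show ?thesis by (simp add: conf_count_def mult.assoc)
qed

lemma prod_two_values:
  assumes "(A, \<pi>, \<iota>) \<in> confs n1 n2 v k"
  shows "(\<Prod>j<n2. if j \<in> \<iota> ` A then x else y) = x ^ k * y ^ (n2 - k)"
proof -
  note C = confsD[OF assms]
  have sub: "\<iota> ` A \<subseteq> {..<n2}" using C(6) by auto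
  have ci: "card (\<iota> ` A) = k" using C(4,7) by (simp add: card_image)
  have "(\<Prod>j<n2. if j \<in> \<iota> ` A then x else y) = x ^ card ({..<n2} \<inter> \<iota> ` A) * y ^ card ({..<n2} \<inter> - \<iota> ` A)"
    by (simp add: prod.If_cases Int_def)
  also have "{..<n2} \<inter> \<iota> ` A = \<iota> ` A" using sub by blast
  also have "{..<n2} \<inter> - \<iota> ` A = {..<n2} - \<iota> ` A" by blast
  finally show ?thesis using sub ci C(3) by (simp add: card_Diff_subset)
qed

text \<open>Probability that a column misses a given set of k+1 left vertices or lies inside it, by
  inclusion-exclusion: the empty column satisfies both.\<close>

definition q_up :: "real \<Rightarrow> nat \<Rightarrow> nat \<Rightarrow> real" where
  "q_up p n1 k = (1 - p) ^ Suc k + (1 - p) ^ (n1 - Suc k) - (1 - p) ^ n1"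

text \<open>Probability that a column misses the k+1 vertices or consists of exactly one of them. It
  agrees with \<open>q_up\<close> up to columns with at least two entries, all inside the
  set.\<close>

definition q_low :: "real \<Rightarrow> nat \<Rightarrow> nat \<Rightarrow> real" where
  "q_low p n1 k = (1 - p) ^ Suc k + real (Suc k) * (p * (1 - p) ^ (n1 - 1))"

lemma bexp_disjoint:
  "Y \<subseteq> {..<(n::nat)} \<Longrightarrow> bexp p {..<n} (\<lambda>T. of_bool (T \<inter> Y = {})) = (1 - p) ^ card Y"
  using bexp_cylinder[of "{..<n}" "{}" Y p] by (simp add: Int_commute)

lemma bexp_upcol:
  assumes c: "(A, \<pi>, \<iota>) \<in> confs n1 n2 v k" and v: "v < n1" and j: "j < n2"
  shows "bexp p {..<n1} (\<lambda>T. of_bool (upcol v (A, \<pi>, \<iota>) j T)) = (if j \<in> \<iota> ` A then p\<^sup>2 else q_up p n1 k)"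
proof -
  note C = confsD[OF c]
  let ?A = "insert v A"
  have sA: "?A \<subseteq> {..<n1}" "card ?A = Suc k" using C v by auto
  show ?thesis
  proof (cases "j \<in> \<iota> ` A")
    case True
    then obtain a where a: "a \<in> A" "j = \<iota> a" by auto
    have "upcol v (A, \<pi>, \<iota>) j T \<longleftrightarrow> {a, \<pi> a} \<subseteq> T" for T
      using True a C(7) by (auto simp: upcol_def dest: inj_onD)
    moreover have "{a, \<pi> a} \<subseteq> {..<n1}" using a C(1) C(9)[OF a(1)] v by auto
    moreover have "card {a, \<pi> a} = 2" using C(10)[OF a(1)] by simp
    ultimately show ?thesis using True bexp_superset[of "{..<n1}" "{a, \<pi> a}" p] by simp
  next
    case False
    have "bexp p {..<n1} (\<lambda>T. of_bool (upcol v (A, \<pi>, \<iota>) j T))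
        = bexp p {..<n1} (\<lambda>T. of_bool (T \<inter> ?A = {}) + of_bool (T \<inter> ({..<n1} - ?A) = {}) - of_bool (T \<inter> {..<n1} = {}))"
    proof (rule bexp_cong)
      fix T assume T: "T \<subseteq> {..<n1}"
      have "T \<subseteq> ?A \<longleftrightarrow> T \<inter> ({..<n1} - ?A) = {}" using T by auto
      moreover have "T \<inter> {..<n1} = {} \<longleftrightarrow> T \<inter> ?A = {} \<and> T \<inter> ({..<n1} - ?A) = {}" using T by auto
      moreover have "upcol v (A, \<pi>, \<iota>) j T \<longleftrightarrow> T \<inter> ?A = {} \<or> T \<subseteq> ?A" using False by (simp add: upcol_def)
      ultimately show "of_bool (upcol v (A, \<pi>, \<iota>) j T)
        = of_bool (T \<inter> ?A = {}) + of_bool (T \<inter> ({..<n1} - ?A) = {}) - (of_bool (T \<inter> {..<n1} = {}) :: real)"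
        by (simp only:) (auto simp: of_bool_def)
    qed
    also have "\<dots> = (1 - p) ^ card ?A + (1 - p) ^ card ({..<n1} - ?A) - (1 - p) ^ card {..<n1}"
      unfolding bexp_add bexp_diff using sA(1) by (simp only: bexp_disjoint Diff_subset subset_refl)
    also have "card ({..<n1} - ?A) = n1 - Suc k" using sA C(3) by (simp add: card_Diff_subset)
    finally show ?thesis using False sA(2) by (simp add: q_up_def)
  qed
qed

lemma bexp_lowcol:
  assumes c: "(A, \<pi>, \<iota>) \<in> confs n1 n2 v k" and v: "v < n1" and j: "j < n2"
  shows "bexp p {..<n1} (\<lambda>T. of_bool (lowcol v (A, \<pi>, \<iota>) j T))
     = (if j \<in> \<iota> ` A then p\<^sup>2 * (1 - p) ^ (n1 - 2) else q_low p n1 k)"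
proof -
  note C = confsD[OF c]
  let ?A = "insert v A"
  have sA: "?A \<subseteq> {..<n1}" "card ?A = Suc k" "finite ?A" using C v by auto
  show ?thesis
  proof (cases "j \<in> \<iota> ` A")
    case True
    then obtain a where a: "a \<in> A" "j = \<iota> a" by auto
    have "lowcol v (A, \<pi>, \<iota>) j T \<longleftrightarrow> T = {a, \<pi> a}" for T
      using True a C(7) by (auto simp: lowcol_def dest: inj_onD)
    moreover have "{a, \<pi> a} \<subseteq> {..<n1}" using a C(1) C(9)[OF a(1)] v by auto
    moreover have "card {a, \<pi> a} = 2" using C(10)[OF a(1)] by simp
    ultimately show ?thesis using True bexp_singleton[of "{..<n1}" "{a, \<pi> a}" p] by simp
  next
    case False
    have "bexp p {..<n1} (\<lambda>T. of_bool (lowcol v (A, \<pi>, \<iota>) j T))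
        = bexp p {..<n1} (\<lambda>T. of_bool (T \<inter> ?A = {}) + (\<Sum>x\<in>?A. of_bool (T = {x})))"
    proof (rule bexp_cong)
      fix T assume T: "T \<subseteq> {..<n1}"
      have l: "lowcol v (A, \<pi>, \<iota>) j T \<longleftrightarrow> T \<inter> ?A = {} \<or> (\<exists>x\<in>?A. T = {x})" using False by (simp add: lowcol_def)
      show "of_bool (lowcol v (A, \<pi>, \<iota>) j T) = of_bool (T \<inter> ?A = {}) + (\<Sum>x\<in>?A. of_bool (T = {x}) :: real)"
      proof (cases "\<exists>x\<in>?A. T = {x}")
        case True
        then obtain x where x: "x \<in> ?A" "T = {x}" by blast
        have "(\<Sum>x\<in>?A. of_bool (T = {x}) :: real) = (\<Sum>y\<in>?A. if y = x then 1 else 0)"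
          using x(2) by (intro sum.cong) auto
        also have "\<dots> = 1" using x(1) sA(3) by (subst sum.delta) auto
        finally show ?thesis unfolding l using x by auto
      next
        case False
        then have "(\<Sum>x\<in>?A. of_bool (T = {x}) :: real) = 0" by (intro sum.neutral) auto
        then show ?thesis unfolding l using False by simp
      qed
    qed
    also have "\<dots> = (1 - p) ^ card ?A + (\<Sum>x\<in>?A. p * (1 - p) ^ (n1 - 1))"
      unfolding bexp_add bexp_sum
    proof (intro arg_cong2[of _ _ _ _ "(+)"] sum.cong refl bexp_disjoint sA(1))
      fix x assume "x \<in> ?A"
      then show "bexp p {..<n1} (\<lambda>T. of_bool (T = {x})) = p * (1 - p) ^ (n1 - 1)"
        using sA(1) bexp_singleton[of "{..<n1}" "{x}" p] by auto
    qed
    also have "\<dots> = q_low p n1 k" by (simp only: sA(2) sum_constant q_low_def)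
    finally show ?thesis using False by simp
  qed
qed

text \<open>The events of different configurations are disjoint, so their probabilities, products
  over independent columns, add up.\<close>

lemma comp_prob_lower:
  assumes p: "0 \<le> p" "p \<le> 1"
  shows "real n1 * (conf_count n1 n2 k * ((p\<^sup>2 * (1 - p) ^ (n1 - 2)) ^ k * q_low p n1 k ^ (n2 - k))) \<le> comp_prob p n1 n2 k"
proof -
  let ?G = "grid n1 n2"
  have "conf_count n1 n2 k * ((p\<^sup>2 * (1 - p) ^ (n1 - 2)) ^ k * q_low p n1 k ^ (n2 - k))
      \<le> bexp p ?G (\<lambda>S. of_bool (card (lcomp n1 S v) = Suc k))" if v: "v < n1" for v
  proof -
    let ?F = "confs n1 n2 v k"
    have "(\<Sum>c\<in>?F. bexp p ?G (\<lambda>S. of_bool (\<forall>j<n2. lowcol v c j (col S j))))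
        = (\<Sum>c\<in>?F. (p\<^sup>2 * (1 - p) ^ (n1 - 2)) ^ k * q_low p n1 k ^ (n2 - k))"
    proof (intro sum.cong refl)
      fix c assume c: "c \<in> ?F"
      obtain A \<pi> \<iota> where ceq: "c = (A, \<pi>, \<iota>)" by (cases c) auto
      have cF: "(A, \<pi>, \<iota>) \<in> ?F" using c ceq by simp
      have "bexp p ?G (\<lambda>S. of_bool (\<forall>j<n2. lowcol v c j (col S j))) = (\<Prod>j<n2. if j \<in> \<iota> ` A then p\<^sup>2 * (1 - p) ^ (n1 - 2) else q_low p n1 k)"
        unfolding ceq bexp_all_columns by (intro prod.cong refl bexp_lowcol[OF cF v]) simp
      then show "bexp p ?G (\<lambda>S. of_bool (\<forall>j<n2. lowcol v c j (col S j))) = (p\<^sup>2 * (1 - p) ^ (n1 - 2)) ^ k * q_low p n1 k ^ (n2 - k)"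
        unfolding prod_two_values[OF cF] .
    qed
    then have "conf_count n1 n2 k * ((p\<^sup>2 * (1 - p) ^ (n1 - 2)) ^ k * q_low p n1 k ^ (n2 - k))
        = bexp p ?G (\<lambda>S. \<Sum>c\<in>?F. of_bool (\<forall>j<n2. lowcol v c j (col S j)))"
      by (simp add: bexp_sum card_confs[OF v, symmetric])
    also have "\<dots> \<le> bexp p ?G (\<lambda>S. of_bool (card (lcomp n1 S v) = Suc k))"
      using p
    proof (intro bexp_mono)
      fix S assume S: "S \<subseteq> ?G"
      let ?L = "{c \<in> ?F. \<forall>j<n2. lowcol v c j (col S j)}"
      have s: "(\<Sum>c\<in>?F. of_bool (\<forall>j<n2. lowcol v c j (col S j)) :: real) = real (card ?L)"
        using finite_confs by (simp add: Int_def)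
      show "(\<Sum>c\<in>?F. of_bool (\<forall>j<n2. lowcol v c j (col S j))) \<le> (of_bool (card (lcomp n1 S v) = Suc k) :: real)"
      proof (cases "?L = {}")
        case False
        then obtain c where c: "c \<in> ?L" by blast
        obtain A \<pi> \<iota> where ceq: "c = (A, \<pi>, \<iota>)" by (cases c) auto
        have cF: "(A, \<pi>, \<iota>) \<in> ?F" and lo: "\<And>j. j < n2 \<Longrightarrow> lowcol v (A, \<pi>, \<iota>) j (col S j)"
          using c ceq by auto
        have "?L = {c}"
        proof (intro equalityI subsetI)
          fix c' assume c': "c' \<in> ?L"
          obtain A' \<pi>' \<iota>' where ceq': "c' = (A', \<pi>', \<iota>')" by (cases c') auto
          have "(A', \<pi>', \<iota>') = (A, \<pi>, \<iota>)"
            by (rule lowcol_unique[OF _ cF S v _ lo]) (use c' ceq' in auto)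
          then show "c' \<in> {c}" by (simp add: ceq ceq')
        qed (use c in simp)
        then have "card ?L = 1" by simp
        moreover have "card (lcomp n1 S v) = Suc k"
        proof -
          have "lcomp n1 S v = insert v A" by (rule lowcol_component[OF cF S v lo])
          then show ?thesis using confsD(2-4)[OF cF] by simp
        qed
        ultimately show ?thesis unfolding s by simp
      qed (simp only: s card.empty, simp)
    qed
    finally show ?thesis .
  qed
  then have "(\<Sum>v<n1. conf_count n1 n2 k * ((p\<^sup>2 * (1 - p) ^ (n1 - 2)) ^ k * q_low p n1 k ^ (n2 - k))) \<le> comp_prob p n1 n2 k"
    unfolding comp_prob_def by (intro sum_mono) auto
  then show ?thesis by simp
qed

text \<open>Union bound over triples in a column. With n_1 n_2 p^2 = c the bound is c n_1 * (n_1 p),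
  which is o(n_1).\<close>

lemma bexp_deg3_le:
  assumes p: "0 \<le> p" "p \<le> 1"
  shows "bexp p (grid n1 n2) (\<lambda>S. real (card {j. j < n2 \<and> 3 \<le> deg S j})) \<le> real n2 * (real n1 * p) ^ 3"
proof -
  let ?G = "grid n1 n2"
  have c3: "bexp p {..<n1} (\<lambda>T. of_bool (3 \<le> card T)) \<le> (real n1 * p) ^ 3"
  proof -
    let ?X = "{X. X \<subseteq> {..<n1} \<and> card X = 3}"
    have "bexp p {..<n1} (\<lambda>T. of_bool (3 \<le> card T)) \<le> bexp p {..<n1} (\<lambda>T. \<Sum>X\<in>?X. of_bool (X \<subseteq> T))"
      using p
    proof (intro bexp_mono)
      fix T assume T: "T \<subseteq> {..<n1}"
      show "of_bool (3 \<le> card T) \<le> (\<Sum>X\<in>?X. of_bool (X \<subseteq> T) :: real)"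
      proof (cases "3 \<le> card T")
        case True
        then obtain X where X: "X \<subseteq> T" "card X = 3" using obtain_subset_with_card_n by metis
        then have "X \<in> ?X" using T by auto
        then have "(of_bool (X \<subseteq> T) :: real) \<le> (\<Sum>X\<in>?X. of_bool (X \<subseteq> T))"
          by (rule member_le_sum) auto
        then show ?thesis using True X by simp
      next
        case False
        then show ?thesis by (simp only: of_bool_eq) (rule sum_nonneg, simp)
      qed
    qed
    also have "\<dots> = (\<Sum>X\<in>?X. p ^ 3)"
      unfolding bexp_sum by (intro sum.cong refl) (use bexp_superset[of "{..<n1}"] in auto)
    also have "\<dots> = real (n1 choose 3) * p ^ 3" using n_subsets[of "{..<n1}" 3] by simp
    also have "\<dots> \<le> real n1 ^ 3 * p ^ 3"
    proof (rule mult_right_mono)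
      have "n1 choose 3 \<le> n1 ^ 3"
        by (cases "3 \<le> n1") (auto simp: binomial_le_pow binomial_eq_0)
      then show "real (n1 choose 3) \<le> real n1 ^ 3" by (metis of_nat_le_iff of_nat_power)
    qed (use p in simp)
    finally show ?thesis by (simp add: power_mult_distrib)
  qed
  have "bexp p ?G (\<lambda>S. real (card {j. j < n2 \<and> 3 \<le> deg S j})) = bexp p ?G (\<lambda>S. \<Sum>j<n2. of_bool (3 \<le> card {i. (i, j) \<in> S}))"
    by (rule bexp_cong) (auto simp: deg_def Int_def)
  also have "\<dots> = (\<Sum>j<n2. bexp p {..<n1} (\<lambda>T. of_bool (3 \<le> card T)))"
    unfolding bexp_sum by (intro sum.cong refl bexp_column[where h = "\<lambda>T. of_bool (3 \<le> card T)"]) auto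
  also have "\<dots> \<le> (\<Sum>j<n2. (real n1 * p) ^ 3)" by (intro sum_mono c3)
  finally show ?thesis by simp
qed

text \<open>A right vertex lies in only one component, so it spoils at most k+1 left vertices in
  components of the size considered.\<close>

lemma sum_bad_vertices:
  "(\<Sum>v<n1. of_bool (card (lcomp n1 S v) = Suc k \<and> (\<exists>j<n2. 3 \<le> deg S j \<and> (Inl v, Inr j) \<in> conn S)) :: real)
    \<le> real (Suc k) * real (card {j. j < n2 \<and> 3 \<le> deg S j})"
proof -
  let ?J = "{j. j < n2 \<and> 3 \<le> deg S j}"
  define V where "V j = {v. v < n1 \<and> card (lcomp n1 S v) = Suc k \<and> (Inl v, Inr j) \<in> conn S}" for j
  have V: "card (V j) \<le> Suc k" for j
  proof (cases "V j = {}")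
    case False
    then obtain v where v: "v \<in> V j" by blast
    have "V j \<subseteq> lcomp n1 S v"
    proof
      fix u assume u: "u \<in> V j"
      have "(Inl v, Inr j) \<in> conn S" "(Inr j, Inl u) \<in> conn S"
        using u v bip_star_sym by (auto simp: V_def)
      then show "u \<in> lcomp n1 S v" using u by (auto simp: lcomp_def V_def intro: rtrancl_trans)
    qed
    then have "card (V j) \<le> card (lcomp n1 S v)" by (rule card_mono[rotated]) (simp add: lcomp_def)
    then show ?thesis using v by (simp add: V_def)
  qed simp
  have "(\<Sum>v<n1. of_bool (card (lcomp n1 S v) = Suc k \<and> (\<exists>j<n2. 3 \<le> deg S j \<and> (Inl v, Inr j) \<in> conn S)) :: real)
      = real (card (\<Union>j\<in>?J. V j))"
  proof -
    have "{v \<in> {..<n1}. card (lcomp n1 S v) = Suc k \<and> (\<exists>j<n2. 3 \<le> deg S j \<and> (Inl v, Inr j) \<in> conn S)} = (\<Union>j\<in>?J. V j)"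
      by (auto simp: V_def)
    then show ?thesis by (simp add: Int_def)
  qed
  also have "\<dots> \<le> real (\<Sum>j\<in>?J. card (V j))" by (simp only: of_nat_le_iff) (rule card_UN_le, simp)
  also have "\<dots> \<le> real (\<Sum>j\<in>?J. Suc k)" by (simp only: of_nat_le_iff) (intro sum_mono V)
  also have "\<dots> = real (Suc k) * real (card ?J)" by (simp add: algebra_simps)
  finally show ?thesis .
qed

text \<open>If no right vertex of degree at least 3 lies in the component,
  \<open>upcol_exists\<close> supplies a configuration and the union bound applies; the other left
  vertices are charged to right vertices of degree at least 3.\<close>

lemma comp_prob_upper:
  assumes p: "0 \<le> p" "p \<le> 1"
  shows "comp_prob p n1 n2 k \<le> real n1 * (conf_count n1 n2 k * ((p\<^sup>2) ^ k * q_up p n1 k ^ (n2 - k)))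
     + real (Suc k) * (real n2 * (real n1 * p) ^ 3)"
proof -
  let ?G = "grid n1 n2"
  let ?bad = "\<lambda>S v. of_bool (card (lcomp n1 S v) = Suc k \<and> (\<exists>j<n2. 3 \<le> deg S j \<and> (Inl v, Inr j) \<in> conn S)) :: real"
  have one: "bexp p ?G (\<lambda>S. of_bool (card (lcomp n1 S v) = Suc k))
      \<le> conf_count n1 n2 k * ((p\<^sup>2) ^ k * q_up p n1 k ^ (n2 - k)) + bexp p ?G (\<lambda>S. ?bad S v)" if v: "v < n1" for v
  proof -
    let ?F = "confs n1 n2 v k"
    have "bexp p ?G (\<lambda>S. of_bool (card (lcomp n1 S v) = Suc k))
        \<le> bexp p ?G (\<lambda>S. (\<Sum>c\<in>?F. of_bool (\<forall>j<n2. upcol v c j (col S j))) + ?bad S v)"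
      using p
    proof (intro bexp_mono)
      fix S assume S: "S \<subseteq> ?G"
      have nn: "0 \<le> (\<Sum>c\<in>?F. of_bool (\<forall>j<n2. upcol v c j (col S j)) :: real)" by (rule sum_nonneg) simp
      show "of_bool (card (lcomp n1 S v) = Suc k) \<le> (\<Sum>c\<in>?F. of_bool (\<forall>j<n2. upcol v c j (col S j))) + ?bad S v"
      proof (cases "card (lcomp n1 S v) = Suc k \<and> \<not> (\<exists>j<n2. 3 \<le> deg S j \<and> (Inl v, Inr j) \<in> conn S)")
        case True
        have "deg S j \<le> 2" if conn: "(Inl v, Inr j) \<in> conn S" for j
        proof (cases "j < n2")
          case False
          then have "{i. (i, j) \<in> S} = {}" using S by auto
          then show ?thesis by (simp add: deg_def)
        next
          case j: True
          then have "\<not> 3 \<le> deg S j" using True conn by blast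
          then show ?thesis by simp
        qed
        then obtain c where c: "c \<in> ?F" "\<forall>j<n2. upcol v c j (col S j)"
          using upcol_exists[OF S v, of k] True by blast
        have "(of_bool (\<forall>j<n2. upcol v c j (col S j)) :: real) \<le> (\<Sum>c\<in>?F. of_bool (\<forall>j<n2. upcol v c j (col S j)))"
          by (rule member_le_sum[OF c(1)]) (auto simp: finite_confs)
        moreover have "(of_bool (\<forall>j<n2. upcol v c j (col S j)) :: real) = 1" using c(2) by simp
        moreover have "0 \<le> ?bad S v" by simp
        moreover have "(of_bool (card (lcomp n1 S v) = Suc k) :: real) \<le> 1" by simp
        ultimately show ?thesis by linarith
      next
        case False
        then have "(of_bool (card (lcomp n1 S v) = Suc k) :: real) \<le> ?bad S v" by auto
        then show ?thesis using nn by linarith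
      qed
    qed
    also have "\<dots> = (\<Sum>c\<in>?F. bexp p ?G (\<lambda>S. of_bool (\<forall>j<n2. upcol v c j (col S j)))) + bexp p ?G (\<lambda>S. ?bad S v)"
      by (simp only: bexp_add bexp_sum)
    also have "(\<Sum>c\<in>?F. bexp p ?G (\<lambda>S. of_bool (\<forall>j<n2. upcol v c j (col S j)))) = (\<Sum>c\<in>?F. (p\<^sup>2) ^ k * q_up p n1 k ^ (n2 - k))"
    proof (intro sum.cong refl)
      fix c assume c: "c \<in> ?F"
      obtain A \<pi> \<iota> where ceq: "c = (A, \<pi>, \<iota>)" by (cases c) auto
      have cF: "(A, \<pi>, \<iota>) \<in> ?F" using c ceq by simp
      have "bexp p ?G (\<lambda>S. of_bool (\<forall>j<n2. upcol v c j (col S j))) = (\<Prod>j<n2. if j \<in> \<iota> ` A then p\<^sup>2 else q_up p n1 k)"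
        unfolding ceq bexp_all_columns by (intro prod.cong refl bexp_upcol[OF cF v]) simp
      then show "bexp p ?G (\<lambda>S. of_bool (\<forall>j<n2. upcol v c j (col S j))) = (p\<^sup>2) ^ k * q_up p n1 k ^ (n2 - k)"
        unfolding prod_two_values[OF cF] .
    qed
    finally show ?thesis by (simp add: card_confs[OF v, symmetric])
  qed
  have "comp_prob p n1 n2 k \<le> (\<Sum>v<n1. conf_count n1 n2 k * ((p\<^sup>2) ^ k * q_up p n1 k ^ (n2 - k)) + bexp p ?G (\<lambda>S. ?bad S v))"
    unfolding comp_prob_def by (intro sum_mono one) simp
  also have "\<dots> = real n1 * (conf_count n1 n2 k * ((p\<^sup>2) ^ k * q_up p n1 k ^ (n2 - k))) + bexp p ?G (\<lambda>S. \<Sum>v<n1. ?bad S v)"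
    unfolding bexp_sum sum.distrib by simp
  also have "bexp p ?G (\<lambda>S. \<Sum>v<n1. ?bad S v) \<le> bexp p ?G (\<lambda>S. real (Suc k) * real (card {j. j < n2 \<and> 3 \<le> deg S j}))"
    using p sum_bad_vertices by (intro bexp_mono)
  also have "\<dots> \<le> real (Suc k) * (real n2 * (real n1 * p) ^ 3)"
    unfolding bexp_cmult by (intro mult_left_mono bexp_deg3_le p) simp
  finally show ?thesis by simp
qed

section \<open>Asymptotics\<close>

text \<open>For 0 \<le> y \<le> 1/2, ln (1 - y) lies between -y - 2 y^2 and -y. Multiplied by the
  exponent, the quadratic term vanishes, since e y converges and y tends to 0.\<close>

lemma one_minus_power_tendsto_exp:
  fixes y :: "nat \<Rightarrow> real" and e :: "nat \<Rightarrow> nat"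
  assumes y: "y \<longlonglongrightarrow> 0" and nn: "eventually (\<lambda>m. 0 \<le> y m) sequentially"
    and L: "(\<lambda>m. real (e m) * y m) \<longlonglongrightarrow> L"
  shows "(\<lambda>m. (1 - y m) ^ e m) \<longlonglongrightarrow> exp (- L)"
proof -
  have small: "eventually (\<lambda>m. y m < 1 / 2) sequentially"
    using order_tendstoD(2)[OF y, of "1/2"] by simp
  have "(\<lambda>m. real (e m) * ln (1 - y m)) \<longlonglongrightarrow> - L"
  proof (rule tendsto_sandwich[where f = "\<lambda>m. - (real (e m) * y m) - 2 * (real (e m) * y m) * y m"
        and h = "\<lambda>m. - (real (e m) * y m)"])
    show "(\<lambda>m. - (real (e m) * y m)) \<longlonglongrightarrow> - L" by (intro tendsto_intros L)
    have "(\<lambda>m. - (real (e m) * y m) - 2 * (real (e m) * y m) * y m) \<longlonglongrightarrow> - L - 2 * L * 0"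
      by (intro tendsto_intros L y)
    then show "(\<lambda>m. - (real (e m) * y m) - 2 * (real (e m) * y m) * y m) \<longlonglongrightarrow> - L" by simp
    show "eventually (\<lambda>m. - (real (e m) * y m) - 2 * (real (e m) * y m) * y m \<le> real (e m) * ln (1 - y m)) sequentially"
      using small nn
    proof eventually_elim
      case (elim m)
      have "real (e m) * (- y m - 2 * (y m)\<^sup>2) \<le> real (e m) * ln (1 - y m)"
        using elim by (intro mult_left_mono ln_one_minus_pos_lower_bound) auto
      then show ?case by (simp add: power2_eq_square algebra_simps)
    qed
    show "eventually (\<lambda>m. real (e m) * ln (1 - y m) \<le> - (real (e m) * y m)) sequentially"
      using small nn
    proof eventually_elim
      case (elim m)
      have "real (e m) * ln (1 - y m) \<le> real (e m) * (- y m)"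
        using elim by (intro mult_left_mono ln_one_minus_pos_upper_bound) auto
      then show ?case by simp
    qed
  qed
  then have "(\<lambda>m. exp (real (e m) * ln (1 - y m))) \<longlonglongrightarrow> exp (- L)" by (rule tendsto_exp)
  moreover have "eventually (\<lambda>m. exp (real (e m) * ln (1 - y m)) = (1 - y m) ^ e m) sequentially"
    using small by eventually_elim (simp add: exp_of_nat_mult)
  ultimately show ?thesis by (rule Lim_transform_eventually)
qed

text \<open>A Bonferroni inequality, continued by \<open>one_minus_power_lower\<close>. Second order
  is essential for the mean of \<open>excess\<close>, where the constant and linear terms of (1 -
  p)^n cancel.\<close>

lemma one_minus_power_upper:
  assumes p: "0 \<le> p" "p \<le> (1 :: real)"
  shows "(1 - p) ^ n \<le> 1 - real n * p + real n * (real n - 1) / 2 * p\<^sup>2"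
proof (induction n)
  case (Suc n)
  have "(1 - p) ^ Suc n \<le> (1 - p) * (1 - real n * p + real n * (real n - 1) / 2 * p\<^sup>2)"
    using Suc p by (simp add: mult_left_mono)
  also have "\<dots> = 1 - real (Suc n) * p + real (Suc n) * (real (Suc n) - 1) / 2 * p\<^sup>2 - real n * (real n - 1) / 2 * p ^ 3"
    by (simp add: field_simps power2_eq_square power3_eq_cube)
  also have "\<dots> \<le> 1 - real (Suc n) * p + real (Suc n) * (real (Suc n) - 1) / 2 * p\<^sup>2"
  proof -
    have "0 \<le> real n * (real n - 1)" by (cases n) auto
    then show ?thesis using p by simp
  qed
  finally show ?case .
qed simp

lemma one_minus_power_lower:
  assumes p: "0 \<le> p" "p \<le> (1 :: real)"
  shows "1 - real n * p + real n * (real n - 1) / 2 * p\<^sup>2 - real n * (real n - 1) * (real n - 2) / 6 * p ^ 3 \<le> (1 - p) ^ n"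
proof (induction n)
  case (Suc n)
  have nn: "0 \<le> real n * (real n - 1) * (real n - 2)"
  proof (cases "n \<le> 1")
    case True
    then have "n = 0 \<or> n = 1" by linarith
    then show ?thesis by auto
  next
    case False
    then show ?thesis by (intro mult_nonneg_nonneg) auto
  qed
  let ?r = "1 - real n * p + real n * (real n - 1) / 2 * p\<^sup>2 - real n * (real n - 1) * (real n - 2) / 6 * p ^ 3"
  have "1 - real (Suc n) * p + real (Suc n) * (real (Suc n) - 1) / 2 * p\<^sup>2 - real (Suc n) * (real (Suc n) - 1) * (real (Suc n) - 2) / 6 * p ^ 3
     = (1 - p) * ?r - real n * (real n - 1) * (real n - 2) / 6 * p ^ 4"
    by (simp add: field_simps power2_eq_square power3_eq_cube power4_eq_xxxx)
  also have "\<dots> \<le> (1 - p) * ?r" using nn p by simp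
  also have "\<dots> \<le> (1 - p) * (1 - p) ^ n" using Suc p by (intro mult_left_mono) auto
  finally show ?case by simp
qed simp

text \<open>The bound 1 - (1 - p)^n \<ge> np(1 - np) in product form, for estimating
  \<open>1 - q_up\<close> factor by factor.\<close>

lemma one_minus_power_upper':
  assumes p: "0 \<le> p" "p \<le> (1 :: real)"
  shows "(1 - p) ^ n \<le> 1 - real n * p * (1 - real n * p)"
proof -
  have "real n * (real n - 1) / 2 * p\<^sup>2 \<le> real n * real n * p\<^sup>2"
    by (intro mult_right_mono) (auto simp: field_simps)
  moreover have "1 - real n * p * (1 - real n * p) = 1 - real n * p + real n * real n * p\<^sup>2"
    by (simp add: power2_eq_square algebra_simps)
  ultimately show ?thesis using one_minus_power_upper[OF p, of n] by linarith
qed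

text \<open>The shift is 1 for the binomial coefficient of \<open>n1 - 1\<close> and 0 for the
  falling factorial of \<open>n2\<close>.\<close>

lemma prod_shift_tendsto:
  fixes n :: "nat \<Rightarrow> nat"
  assumes "filterlim n at_top sequentially"
  shows "(\<lambda>m. (\<Prod>i=0..<k. (real (n m) - real i - r) / real (n m))) \<longlonglongrightarrow> 1"
proof -
  have lim: "filterlim (\<lambda>m. real (n m)) at_top sequentially"
    using filterlim_compose[OF filterlim_real_sequentially assms] .
  have "(\<lambda>m. \<Prod>i=0..<k. (1 - (real i + r) * inverse (real (n m)))) \<longlonglongrightarrow> (\<Prod>i=0..<k. (1 - (real i + r) * 0))"
    by (intro tendsto_prod tendsto_intros tendsto_inverse_0_at_top lim)
  then have "(\<lambda>m. \<Prod>i=0..<k. (1 - (real i + r) * inverse (real (n m)))) \<longlonglongrightarrow> 1" by simp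
  moreover have "eventually (\<lambda>m. (\<Prod>i=0..<k. (1 - (real i + r) * inverse (real (n m)))) = (\<Prod>i=0..<k. (real (n m) - real i - r) / real (n m))) sequentially"
  proof -
    have "eventually (\<lambda>m. n m \<ge> 1) sequentially" using assms by (simp add: filterlim_at_top)
    then show ?thesis by eventually_elim (intro prod.cong refl, simp add: field_simps)
  qed
  ultimately show ?thesis by (rule Lim_transform_eventually)
qed

definition borel_coeff :: "nat \<Rightarrow> real" where
  "borel_coeff k = real (k + 1) ^ k / real (k + 1) / fact k"

text \<open>The Borel probability (cs)^(s-1) exp(-cs) / s! of the size s = k+1, that is, the law of
  the total progeny of a Poisson(c) branching process.\<close>

definition comp_limit :: "real \<Rightarrow> nat \<Rightarrow> real" where
  "comp_limit c k = borel_coeff k * c ^ k * exp (- (c * real (Suc k)))"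

lemma conf_count_nonneg: "0 \<le> conf_count n1 n2 k"
  unfolding conf_count_def by (intro mult_nonneg_nonneg divide_nonneg_nonneg of_nat_0_le_iff zero_le_power)

lemma borel_coeff_nonneg: "0 \<le> borel_coeff k" by (simp add: borel_coeff_def)
lemma comp_limit_nonneg: "0 \<le> c \<Longrightarrow> 0 \<le> comp_limit c k" by (simp add: comp_limit_def borel_coeff_nonneg)

section \<open>Sequences of random graphs and the limiting component sizes\<close>

locale unbalanced =
  fixes n1 n2 :: "nat \<Rightarrow> nat"
  assumes n1: "filterlim n1 at_top sequentially"
    and n2: "filterlim n2 at_top sequentially"
    and ratio: "(\<lambda>m. real (n1 m) / real (n2 m)) \<longlonglongrightarrow> 0"
begin

lemma real_n1: "filterlim (\<lambda>m. real (n1 m)) at_top sequentially"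
  using filterlim_compose[OF filterlim_real_sequentially n1] .

lemma ev_n1: "eventually (\<lambda>m. N \<le> n1 m) sequentially" using n1 by (simp add: filterlim_at_top)
lemma ev_n2: "eventually (\<lambda>m. N \<le> n2 m) sequentially" using n2 by (simp add: filterlim_at_top)

lemma inverse_n1: "(\<lambda>m. inverse (real (n1 m))) \<longlonglongrightarrow> 0"
  by (rule tendsto_inverse_0_at_top[OF real_n1])

end

text \<open>The parameter \<open>c\<close> is separate from the sequences because the positivity
  proof for \<open>mu\<close> compares several parameters along the same sequences. In the theorem c
  = d^2.\<close>

locale sparse_bip = unbalanced +
  fixes c :: real assumes c: "c > 0"
begin

definition eprob :: "nat \<Rightarrow> real" where
  "eprob m = sqrt c / sqrt (real (n1 m) * real (n2 m))"

text \<open>Expected degree of a right vertex, of order sqrt(n_1 / n_2): the small quantity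
  governing the error terms.\<close>

definition rmean :: "nat \<Rightarrow> real" where
  "rmean m = real (n1 m) * eprob m"

abbreviation "mean m \<equiv> bexp (eprob m) (grid (n1 m) (n2 m))"
abbreviation "cprob m \<equiv> comp_prob (eprob m) (n1 m) (n2 m)"
abbreviation "cnum k m \<equiv> conf_count (n1 m) (n2 m) k * ((eprob m)\<^sup>2) ^ k"

lemma eprob_nonneg: "0 \<le> eprob m" using c by (simp add: eprob_def)
lemma rmean_nonneg: "0 \<le> rmean m" using eprob_nonneg by (simp add: rmean_def)

lemma ev_pp: "eventually (\<lambda>m. real (n1 m) * real (n2 m) * (eprob m)\<^sup>2 = c) sequentially"
  using ev_n1[of 1] ev_n2[of 1]
  by eventually_elim (use c in \<open>simp add: eprob_def power_divide\<close>)

lemma ev_px: "eventually (\<lambda>m. real (n2 m) * (eprob m * rmean m) = c) sequentially"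
  using ev_pp by eventually_elim (simp add: rmean_def power2_eq_square algebra_simps)

lemma rmean_lim: "rmean \<longlonglongrightarrow> 0"
proof -
  have "(\<lambda>m. sqrt c * sqrt (real (n1 m) / real (n2 m))) \<longlonglongrightarrow> sqrt c * sqrt 0"
    by (intro tendsto_intros tendsto_real_sqrt ratio)
  then have "(\<lambda>m. sqrt c * sqrt (real (n1 m) / real (n2 m))) \<longlonglongrightarrow> 0" by simp
  moreover have "eventually (\<lambda>m. sqrt c * sqrt (real (n1 m) / real (n2 m)) = rmean m) sequentially"
    using ev_n1[of 1] ev_n2[of 1]
  proof eventually_elim
    case (elim m)
    have "sqrt (real (n1 m)) * sqrt (real (n1 m)) = real (n1 m)" by simp
    then show ?case using elim
      by (simp add: rmean_def eprob_def real_sqrt_divide real_sqrt_mult field_simps)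
  qed
  ultimately show ?thesis by (rule Lim_transform_eventually)
qed

lemma ev_eprob_le_rmean: "eventually (\<lambda>m. eprob m \<le> rmean m) sequentially"
  using ev_n1[of 1]
proof eventually_elim
  case (elim m)
  then have "1 * eprob m \<le> real (n1 m) * eprob m" by (intro mult_right_mono eprob_nonneg) simp
  then show ?case by (simp add: rmean_def)
qed

lemma eprob_lim: "eprob \<longlonglongrightarrow> 0"
proof (rule tendsto_sandwich[OF _ ev_eprob_le_rmean _ rmean_lim])
  show "eventually (\<lambda>m. 0 \<le> eprob m) sequentially" by (simp add: eprob_nonneg)
qed simp

lemma ev_eprob_le_1: "eventually (\<lambda>m. eprob m \<le> 1) sequentially"
  using order_tendstoD(2)[OF eprob_lim, of 1] by (auto elim: eventually_mono)

lemma ev_rmean_le: "a > 0 \<Longrightarrow> eventually (\<lambda>m. rmean m \<le> a) sequentially"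
  using order_tendstoD(2)[OF rmean_lim, of a] by (auto elim: eventually_mono)

lemma conf_count_lim:
  "(\<lambda>m. cnum k m) \<longlonglongrightarrow> borel_coeff k * c ^ k"
proof -
  have lim1: "(\<lambda>m. (\<Prod>i=0..<k. (real (n1 m) - real i - 1) / real (n1 m)) / fact k * (real (k + 1) ^ k / real (k + 1))
      * (\<Prod>i=0..<k. (real (n2 m) - real i - 0) / real (n2 m)) * c ^ k)
    \<longlonglongrightarrow> 1 / fact k * (real (k + 1) ^ k / real (k + 1)) * 1 * c ^ k"
    by (intro tendsto_intros prod_shift_tendsto n1 n2) simp
  then have "(\<lambda>m. (\<Prod>i=0..<k. (real (n1 m) - real i - 1) / real (n1 m)) / fact k * (real (k + 1) ^ k / real (k + 1))
      * (\<Prod>i=0..<k. (real (n2 m) - real i - 0) / real (n2 m)) * c ^ k) \<longlonglongrightarrow> borel_coeff k * c ^ k"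
  proof -
    have "1 / fact k * (real (k + 1) ^ k / real (k + 1)) * 1 * c ^ k = borel_coeff k * c ^ k"
      by (simp add: borel_coeff_def field_simps)
    then show ?thesis using lim1 by (simp only:)
  qed
  moreover have "eventually (\<lambda>m. (\<Prod>i=0..<k. (real (n1 m) - real i - 1) / real (n1 m)) / fact k * (real (k + 1) ^ k / real (k + 1))
      * (\<Prod>i=0..<k. (real (n2 m) - real i - 0) / real (n2 m)) * c ^ k
      = cnum k m) sequentially"
    using ev_pp ev_n1[of 1] ev_n2[of "Suc k"]
  proof eventually_elim
    case (elim m)
    have a: "real ((n1 m - 1) choose k) = (\<Prod>i=0..<k. real (n1 m) - real i - 1) / fact k"
    proof -
      have "real ((n1 m - 1) choose k) = real (n1 m - 1) gchoose k" by (simp add: binomial_gbinomial)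
      also have "\<dots> = (\<Prod>i=0..<k. real (n1 m - 1) - real i) / fact k" by (simp add: gbinomial_prod_rev)
      also have "(\<Prod>i=0..<k. real (n1 m - 1) - real i) = (\<Prod>i=0..<k. real (n1 m) - real i - 1)"
        using elim(2) by (intro prod.cong) auto
      finally show ?thesis .
    qed
    have b: "real (prod ((-) (n2 m)) {0..<k}) = (\<Prod>i=0..<k. real (n2 m) - real i - 0)"
      unfolding of_nat_prod using elim(3) by (intro prod.cong) (auto simp: of_nat_diff)
    have cc: "c ^ k = real (n1 m) ^ k * real (n2 m) ^ k * ((eprob m)\<^sup>2) ^ k"
      by (subst elim(1)[symmetric]) (simp add: power_mult_distrib)
    show ?case unfolding conf_count_def a b cc prod_dividef using elim(2,3) by simp
  qed
  ultimately show ?thesis by (rule Lim_transform_eventually)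
qed

text \<open>A column outside the tree violates its condition when it joins one of the k+1 vertices
  to another vertex, with probability about (k+1) p * n_1 p. Over n_2 columns this adds up to c
  (k+1), the exponent in \<open>comp_limit\<close>.\<close>

lemma comp_lower_lim:
  "(\<lambda>m. cnum k m * ((1 - rmean m) ^ k * (1 - real (Suc k) * (eprob m * rmean m)) ^ (n2 m - k)))
     \<longlonglongrightarrow> comp_limit c k"
proof -
  have y: "(\<lambda>m. real (Suc k) * (eprob m * rmean m)) \<longlonglongrightarrow> 0"
    using tendsto_mult[OF tendsto_const[of "real (Suc k)"] tendsto_mult[OF eprob_lim rmean_lim]] by simp
  have "(\<lambda>m. c * real (Suc k) - real k * (real (Suc k) * (eprob m * rmean m))) \<longlonglongrightarrow> c * real (Suc k) - real k * 0"
    by (intro tendsto_diff tendsto_mult tendsto_const y)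
  then have "(\<lambda>m. c * real (Suc k) - real k * (real (Suc k) * (eprob m * rmean m))) \<longlonglongrightarrow> c * real (Suc k)" by simp
  moreover have "eventually (\<lambda>m. c * real (Suc k) - real k * (real (Suc k) * (eprob m * rmean m)) = real (n2 m - k) * (real (Suc k) * (eprob m * rmean m))) sequentially"
    using ev_px ev_n2[of k]
  proof eventually_elim
    case (elim m)
    then have "real (n2 m - k) = real (n2 m) - real k" by (simp add: of_nat_diff)
    then show ?case by (subst elim(1)[symmetric]) (simp add: algebra_simps)
  qed
  ultimately have "(\<lambda>m. real (n2 m - k) * (real (Suc k) * (eprob m * rmean m))) \<longlonglongrightarrow> c * real (Suc k)"
    by (rule Lim_transform_eventually)
  then have e: "(\<lambda>m. (1 - real (Suc k) * (eprob m * rmean m)) ^ (n2 m - k)) \<longlonglongrightarrow> exp (- (c * real (Suc k)))"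
    by (intro one_minus_power_tendsto_exp y) (auto intro!: always_eventually mult_nonneg_nonneg eprob_nonneg rmean_nonneg)
  have "(\<lambda>m. cnum k m * ((1 - rmean m) ^ k * (1 - real (Suc k) * (eprob m * rmean m)) ^ (n2 m - k)))
     \<longlonglongrightarrow> borel_coeff k * c ^ k * ((1 - 0) ^ k * exp (- (c * real (Suc k))))"
    by (intro tendsto_mult[OF conf_count_lim] tendsto_mult[OF _ e] tendsto_intros rmean_lim)
  then show ?thesis by (simp add: comp_limit_def)
qed

lemma ev_comp_lower:
  "eventually (\<lambda>m. cnum k m * ((1 - rmean m) ^ k * (1 - real (Suc k) * (eprob m * rmean m)) ^ (n2 m - k))
     \<le> cprob m k / real (n1 m)) sequentially"
proof -
  have K: "eventually (\<lambda>m. real (Suc k) * (eprob m * rmean m) \<le> 1) sequentially"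
  proof -
    have "(\<lambda>m. real (Suc k) * (eprob m * rmean m)) \<longlonglongrightarrow> real (Suc k) * (0 * 0)"
      by (intro tendsto_mult tendsto_const eprob_lim rmean_lim)
    then have "eventually (\<lambda>m. real (Suc k) * (eprob m * rmean m) < 1) sequentially"
      using order_tendstoD(2)[of "\<lambda>m. real (Suc k) * (eprob m * rmean m)" 0 sequentially 1] by simp
    then show ?thesis by (auto elim: eventually_mono)
  qed
  show ?thesis
    using ev_n1[of 2] ev_eprob_le_1 ev_rmean_le[OF zero_less_one] K
  proof eventually_elim
    case (elim m)
    let ?p = "eprob m" and ?x = "rmean m" and ?a = "n1 m"
    have bern: "1 - ?x \<le> (1 - ?p) ^ N" if "N \<le> ?a" for N
    proof -
      have "1 - real N * ?p \<le> (1 - ?p) ^ N" using Bernoulli_inequality[of "- ?p" N] elim(2) by simp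
      moreover have "real N * ?p \<le> ?x" unfolding rmean_def using that by (intro mult_right_mono eprob_nonneg) simp
      ultimately show ?thesis by linarith
    qed
    \<comment> \<open>Bernoulli's inequality for both terms of \<open>q_low\<close>; the
      contributions (k+1) p cancel and only the second-order term remains.\<close>
    have ql: "1 - real (Suc k) * (?p * ?x) \<le> q_low ?p ?a k"
    proof -
      have "1 - real (Suc k) * ?p \<le> (1 - ?p) ^ Suc k" using Bernoulli_inequality[of "- ?p" "Suc k"] elim(2) by simp
      moreover have "real (Suc k) * (?p * (1 - ?x)) \<le> real (Suc k) * (?p * (1 - ?p) ^ (?a - 1))"
        using bern[of "?a - 1"] by (intro mult_left_mono eprob_nonneg) auto
      ultimately show ?thesis unfolding q_low_def by (simp add: algebra_simps)
    qed
    have "conf_count ?a (n2 m) k * (?p\<^sup>2) ^ k * ((1 - ?x) ^ k * (1 - real (Suc k) * (?p * ?x)) ^ (n2 m - k))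
       \<le> conf_count ?a (n2 m) k * (?p\<^sup>2) ^ k * (((1 - ?p) ^ (?a - 2)) ^ k * q_low ?p ?a k ^ (n2 m - k))"
    proof (rule mult_left_mono)
      show "(1 - ?x) ^ k * (1 - real (Suc k) * (?p * ?x)) ^ (n2 m - k) \<le> ((1 - ?p) ^ (?a - 2)) ^ k * q_low ?p ?a k ^ (n2 m - k)"
        using elim bern[of "?a - 2"] ql by (intro mult_mono power_mono) auto
      show "0 \<le> conf_count ?a (n2 m) k * (?p\<^sup>2) ^ k" by (simp add: conf_count_nonneg)
    qed
    also have "\<dots> = conf_count ?a (n2 m) k * ((?p\<^sup>2 * (1 - ?p) ^ (?a - 2)) ^ k * q_low ?p ?a k ^ (n2 m - k))"
      by (simp add: power_mult_distrib algebra_simps)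
    also have "\<dots> \<le> comp_prob ?p ?a (n2 m) k / real ?a"
      using comp_prob_lower[OF eprob_nonneg elim(2), of ?a "n2 m" k] elim(1) by (simp add: field_simps)
    finally show ?case .
  qed
qed

text \<open>A lower bound for \<open>1 - q_up\<close>, the probability that a column meets both the
  k+1 vertices and their complement. That probability is a product of two factors, each estimated by
  \<open>one_minus_power_upper'\<close>.\<close>

definition cross :: "nat \<Rightarrow> nat \<Rightarrow> real" where
  "cross k m = (real (Suc k) * eprob m * (1 - real (Suc k) * eprob m)) * (real (n1 m - Suc k) * eprob m * (1 - rmean m))"

lemma comp_upper_lim:
  "(\<lambda>m. cnum k m * (1 - cross k m) ^ (n2 m - k)
      + real (Suc k) * (c * rmean m)) \<longlonglongrightarrow> comp_limit c k"
proof -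
  let ?K = "real (Suc k)"
  \<comment> \<open>The ratio of \<open>cross k m\<close> to \<open>eprob m * rmean m\<close>, which
    tends to k+1.\<close>
  define w where "w m = ?K * (1 - ?K * eprob m) * (1 - ?K * inverse (real (n1 m))) * (1 - rmean m)" for m
  have w: "w \<longlonglongrightarrow> ?K * (1 - ?K * 0) * (1 - ?K * 0) * (1 - 0)" unfolding w_def
    by (intro tendsto_intros eprob_lim rmean_lim inverse_n1)
  have zw: "eventually (\<lambda>m. cross k m = (eprob m * rmean m) * w m) sequentially"
    using ev_n1[of "Suc k"]
  proof eventually_elim
    case (elim m)
    then have "real (n1 m - Suc k) = real (n1 m) * (1 - ?K * inverse (real (n1 m)))"
      by (simp add: of_nat_diff field_simps)
    then show ?case unfolding cross_def w_def rmean_def by simp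
  qed
  have "(\<lambda>m. (eprob m * rmean m) * w m) \<longlonglongrightarrow> (0 * 0) * (?K * (1 - ?K * 0) * (1 - ?K * 0) * (1 - 0))"
    by (intro tendsto_mult[OF _ w] tendsto_mult eprob_lim rmean_lim)
  then have y0: "(\<lambda>m. (eprob m * rmean m) * w m) \<longlonglongrightarrow> 0" by simp
  have y: "cross k \<longlonglongrightarrow> 0"
    by (rule Lim_transform_eventually[OF y0]) (use zw in \<open>auto elim: eventually_mono\<close>)
  have wpos: "eventually (\<lambda>m. 0 < w m) sequentially" using order_tendstoD(1)[OF w, of 0] by simp
  have nn: "eventually (\<lambda>m. 0 \<le> cross k m) sequentially"
    using zw wpos by eventually_elim (simp add: eprob_nonneg rmean_nonneg)
  have "(\<lambda>m. c * w m - real k * ((eprob m * rmean m) * w m)) \<longlonglongrightarrow> c * (?K * (1 - ?K * 0) * (1 - ?K * 0) * (1 - 0)) - real k * 0"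
    by (intro tendsto_diff tendsto_mult[OF tendsto_const] w y0)
  then have "(\<lambda>m. c * w m - real k * ((eprob m * rmean m) * w m)) \<longlonglongrightarrow> c * ?K" by simp
  moreover have "eventually (\<lambda>m. c * w m - real k * ((eprob m * rmean m) * w m) = real (n2 m - k) * cross k m) sequentially"
    using ev_px ev_n2[of k] zw
  proof eventually_elim
    case (elim m)
    then have e: "real (n2 m - k) = real (n2 m) - real k" by (simp add: of_nat_diff)
    show ?case unfolding e elim(3) by (subst elim(1)[symmetric]) (simp add: algebra_simps)
  qed
  ultimately have "(\<lambda>m. real (n2 m - k) * cross k m) \<longlonglongrightarrow> c * ?K" by (rule Lim_transform_eventually)
  then have e: "(\<lambda>m. (1 - cross k m) ^ (n2 m - k)) \<longlonglongrightarrow> exp (- (c * ?K))"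
    by (intro one_minus_power_tendsto_exp y nn)
  have "(\<lambda>m. cnum k m * (1 - cross k m) ^ (n2 m - k)
      + ?K * (c * rmean m)) \<longlonglongrightarrow> borel_coeff k * c ^ k * exp (- (c * ?K)) + ?K * (c * 0)"
    by (intro tendsto_add tendsto_mult[OF conf_count_lim e] tendsto_mult tendsto_const rmean_lim)
  then show ?thesis by (simp add: comp_limit_def)
qed

lemma ev_comp_upper:
  "eventually (\<lambda>m. cprob m k / real (n1 m)
     \<le> cnum k m * (1 - cross k m) ^ (n2 m - k)
      + real (Suc k) * (c * rmean m)) sequentially"
proof -
  have "eventually (\<lambda>m. rmean m \<le> 1 / real (Suc k)) sequentially" by (rule ev_rmean_le) simp
  then show ?thesis
    using ev_n1[of "Suc k"] ev_eprob_le_1 ev_px ev_eprob_le_rmean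
  proof eventually_elim
    case (elim m)
    let ?p = "eprob m" and ?x = "rmean m" and ?a = "n1 m" and ?K = "real (Suc k)"
    have p1: "?p \<le> 1" and p0: "0 \<le> ?p" using elim eprob_nonneg by auto
    have x1: "?K * ?x \<le> 1" using elim(1) by (simp add: field_simps)
    have Kp: "?K * ?p \<le> 1" using elim(5) x1 by (meson mult_left_mono of_nat_0_le_iff order_trans)
    have x1': "?x \<le> 1"
    proof -
      have "1 * ?x \<le> ?K * ?x" by (intro mult_right_mono rmean_nonneg) simp
      then show ?thesis using x1 by linarith
    qed
    have f1: "?K * ?p * (1 - ?K * ?p) \<le> 1 - (1 - ?p) ^ Suc k"
      using one_minus_power_upper'[OF p0 p1, of "Suc k"] by linarith
    have f2: "real (?a - Suc k) * ?p * (1 - ?x) \<le> 1 - (1 - ?p) ^ (?a - Suc k)"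
    proof -
      have "real (?a - Suc k) * ?p \<le> ?x" unfolding rmean_def by (intro mult_right_mono p0) simp
      then have "real (?a - Suc k) * ?p * (1 - ?x) \<le> real (?a - Suc k) * ?p * (1 - real (?a - Suc k) * ?p)"
        using p0 by (intro mult_left_mono) auto
      then show ?thesis using one_minus_power_upper'[OF p0 p1, of "?a - Suc k"] by linarith
    qed
    have g1: "0 \<le> 1 - (1 - ?p) ^ N" for N using p0 p1 by (simp add: power_le_one)
    have "cross k m \<le> (1 - (1 - ?p) ^ Suc k) * (1 - (1 - ?p) ^ (?a - Suc k))"
      unfolding cross_def using f1 f2 g1 p0 x1' Kp by (intro mult_mono) (auto simp del: power_Suc)
    also have "\<dots> = 1 - q_up ?p ?a k"
    proof -
      have "(1 - ?p) ^ ?a = (1 - ?p) ^ Suc k * (1 - ?p) ^ (?a - Suc k)"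
        using elim(2) by (metis le_add_diff_inverse power_add)
      then show ?thesis by (simp add: q_up_def algebra_simps)
    qed
    finally have q1: "q_up ?p ?a k \<le> 1 - cross k m" by simp
    have q0: "0 \<le> q_up ?p ?a k"
    proof -
      have "(1 - ?p) ^ ?a \<le> (1 - ?p) ^ (?a - Suc k)" using p0 p1 by (intro power_decreasing) auto
      moreover have "0 \<le> (1 - ?p) ^ Suc k" using p1 by simp
      ultimately show ?thesis unfolding q_up_def by linarith
    qed
    have "comp_prob ?p ?a (n2 m) k / real ?a \<le> conf_count ?a (n2 m) k * ((?p\<^sup>2) ^ k * q_up ?p ?a k ^ (n2 m - k))
       + ?K * (real (n2 m) * ?x ^ 3) / real ?a"
      using comp_prob_upper[OF p0 p1, of ?a "n2 m" k] elim(2) by (simp add: rmean_def field_simps)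
    \<comment> \<open>The error from right vertices of degree at least 3: after division by n_1 it
      is a multiple of \<open>rmean m\<close> and vanishes.\<close>
    also have "real (n2 m) * ?x ^ 3 = c * (real ?a * ?x)"
      by (subst elim(4)[symmetric]) (simp add: rmean_def power3_eq_cube)
    also have "?K * (c * (real ?a * ?x)) / real ?a = ?K * (c * ?x)" using elim(2) by simp
    also have "conf_count ?a (n2 m) k * ((?p\<^sup>2) ^ k * q_up ?p ?a k ^ (n2 m - k))
       \<le> conf_count ?a (n2 m) k * ((?p\<^sup>2) ^ k * (1 - cross k m) ^ (n2 m - k))"
      using q0 q1 by (intro mult_left_mono power_mono) (auto simp: conf_count_nonneg)
    finally show ?case by (simp add: mult.assoc)
  qed
qed

lemma comp_prob_lim: "(\<lambda>m. cprob m k / real (n1 m)) \<longlonglongrightarrow> comp_limit c k"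
  by (rule tendsto_sandwich[OF ev_comp_lower ev_comp_upper comp_lower_lim comp_upper_lim])

end

section \<open>The limiting cyclomatic number\<close>

context sparse_bip
begin

lemma sum_comp_prob_le: "(\<Sum>k<K. cprob m k) \<le> real (n1 m)" if p: "eprob m \<le> 1"
proof -
  let ?G = "grid (n1 m) (n2 m)"
  have "(\<Sum>k<K. cprob m k)
      = (\<Sum>v<n1 m. bexp (eprob m) ?G (\<lambda>S. \<Sum>k<K. of_bool (card (lcomp (n1 m) S v) = Suc k)))"
    unfolding comp_prob_def bexp_sum by (rule sum.swap)
  also have "\<dots> \<le> (\<Sum>v<n1 m. bexp (eprob m) ?G (\<lambda>S. 1))"
  proof (intro sum_mono bexp_mono eprob_nonneg p)
    fix v S
    have "(\<Sum>k<K. of_bool (card (lcomp (n1 m) S v) = Suc k) :: real)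
        \<le> (\<Sum>k<K. if k = card (lcomp (n1 m) S v) - 1 then 1 else 0)"
      by (intro sum_mono) auto
    also have "\<dots> \<le> 1" by (subst sum.delta) auto
    finally show "(\<Sum>k<K. of_bool (card (lcomp (n1 m) S v) = Suc k) :: real) \<le> 1" .
  qed
  also have "\<dots> = real (n1 m)" by (simp add: bexp_const)
  finally show ?thesis .
qed

text \<open>A left vertex has one component size, so before the limit the sums are at most 1.
  Summability of the Borel series is thus read off from the random graph, for every
  \<open>c > 0\<close>.\<close>

lemma sum_comp_limit_le_1: "(\<Sum>k<K. comp_limit c k) \<le> 1"
proof -
  have "(\<lambda>m. \<Sum>k<K. cprob m k / real (n1 m)) \<longlonglongrightarrow> (\<Sum>k<K. comp_limit c k)"
    by (intro tendsto_sum comp_prob_lim)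
  moreover have "eventually (\<lambda>m. (\<Sum>k<K. cprob m k / real (n1 m)) \<le> 1) sequentially"
    using ev_eprob_le_1 ev_n1[of 1]
    by eventually_elim (use sum_comp_prob_le in \<open>simp add: sum_divide_distrib[symmetric]\<close>)
  ultimately show ?thesis by (rule tendsto_upperbound) simp
qed

lemma summable_comp_limit: "summable (comp_limit c)"
  using c by (intro summableI_nonneg_bounded[where x = 1] comp_limit_nonneg sum_comp_limit_le_1) simp

lemma suminf_comp_limit_le_1: "(\<Sum>k. comp_limit c k) \<le> 1"
  by (rule suminf_le_const[OF summable_comp_limit sum_comp_limit_le_1])

lemma summable_comp_limit': "summable (\<lambda>k. comp_limit c k / real (Suc k))"
proof (rule summable_comparison_test'[OF summable_comp_limit, of 0])
  fix k :: nat
  have "comp_limit c k / real (Suc k) \<le> comp_limit c k / 1"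
    using comp_limit_nonneg[of c k] c by (intro divide_left_mono) auto
  then show "norm (comp_limit c k / real (Suc k)) \<le> comp_limit c k"
    using comp_limit_nonneg[of c k] c by simp
qed

text \<open>Convergence is known only for each fixed size, so the sum over sizes is cut at a
  constant \<open>K\<close>: large components cost at most 1/\<open>K\<close> before the limit, the
  tail of the series costs little after it.\<close>

lemma lcomps_lim:
  "(\<lambda>m. mean m (\<lambda>S. real (lcomps (n1 m) S)) / real (n1 m)) \<longlonglongrightarrow> (\<Sum>k. comp_limit c k / real (Suc k))"
    (is "?E \<longlonglongrightarrow> ?s")
proof (rule LIMSEQ_I)
  fix r :: real assume r: "0 < r"
  have "(\<lambda>K. \<Sum>k<K. comp_limit c k / real (Suc k)) \<longlonglongrightarrow> ?s"
    using summable_comp_limit' by (rule summable_LIMSEQ)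
  then obtain K0 where K0: "\<And>K. K \<ge> K0 \<Longrightarrow> \<bar>(\<Sum>k<K. comp_limit c k / real (Suc k)) - ?s\<bar> < r / 3"
    using r LIMSEQ_D[of _ ?s "r / 3"] by force
  obtain K1 where K1: "inverse (real (Suc K1)) < r / 3" using reals_Archimedean[of "r / 3"] r by auto
  define K where "K = max K0 (Suc K1)"
  have Kpos: "K > 0" by (simp add: K_def)
  have Kinv: "1 / real K < r / 3"
  proof -
    have "1 / real K \<le> 1 / real (Suc K1)" by (intro divide_left_mono) (auto simp: K_def)
    then show ?thesis using K1 by (simp add: inverse_eq_divide)
  qed
  have Ks: "\<bar>(\<Sum>k<K. comp_limit c k / real (Suc k)) - ?s\<bar> < r / 3" by (rule K0) (simp add: K_def)
  have "(\<lambda>m. \<Sum>k<K. cprob m k / real (n1 m) / real (Suc k)) \<longlonglongrightarrow> (\<Sum>k<K. comp_limit c k / real (Suc k))"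
    by (intro tendsto_sum tendsto_divide comp_prob_lim tendsto_const) simp
  from tendstoD[OF this, of "r / 3"]
  have "eventually (\<lambda>m. \<bar>(\<Sum>k<K. cprob m k / real (n1 m) / real (Suc k)) - (\<Sum>k<K. comp_limit c k / real (Suc k))\<bar> < r / 3) sequentially"
    using r unfolding dist_real_def by simp
  then have "eventually (\<lambda>m. norm (?E m - ?s) < r) sequentially"
    using ev_eprob_le_1 ev_n1[of 1]
  proof eventually_elim
    case (elim m)
    have e: "(\<Sum>k<K. cprob m k / real (n1 m) / real (Suc k)) = (\<Sum>k<K. cprob m k / real (Suc k)) / real (n1 m)"
      by (simp add: sum_divide_distrib mult.commute)
    note b = bexp_kap_bounds[OF eprob_nonneg elim(2) Kpos, of "n1 m" "n2 m"]
    have "(\<Sum>k<K. cprob m k / real (Suc k)) / real (n1 m) \<le> ?E m"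
      by (intro divide_right_mono b(1)) simp
    moreover have "?E m \<le> ((\<Sum>k<K. cprob m k / real (Suc k)) + real (n1 m) / real K) / real (n1 m)"
      by (intro divide_right_mono b(2)) simp
    moreover have "\<dots> = (\<Sum>k<K. cprob m k / real (Suc k)) / real (n1 m) + 1 / real K"
      using elim(3) by (simp add: add_divide_distrib)
    ultimately show ?case using elim(1) Ks Kinv unfolding e real_norm_def by linarith
  qed
  then show "\<exists>no. \<forall>n\<ge>no. norm (?E n - ?s) < r" by (simp add: eventually_sequentially)
qed

text \<open>To leading order \<open>excess\<close> counts pairs of edges with a common right
  endpoint, on average n_2 binom(n_1, 2) p^2. The third-order correction, divided by n_1, is at most
  c times \<open>rmean m\<close>.\<close>

lemma excess_lim:
  "(\<lambda>m. mean m (\<lambda>S. real (excess (n2 m) S)) / real (n1 m)) \<longlonglongrightarrow> c / 2"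
proof (rule tendsto_sandwich)
  let ?f = "\<lambda>m. c / 2 * (1 - inverse (real (n1 m))) - c * rmean m"
  let ?h = "\<lambda>m. c / 2 * (1 - inverse (real (n1 m)))"
  have "?f \<longlonglongrightarrow> c / 2 * (1 - 0) - c * 0" by (intro tendsto_intros inverse_n1 rmean_lim)
  then show "?f \<longlonglongrightarrow> c / 2" by simp
  have "?h \<longlonglongrightarrow> c / 2 * (1 - 0)" by (intro tendsto_intros inverse_n1)
  then show "?h \<longlonglongrightarrow> c / 2" by simp
  have main: "real (n2 m) * (real (n1 m) * (real (n1 m) - 1) / 2 * (eprob m)\<^sup>2) / real (n1 m) = ?h m"
    if "real (n1 m) * real (n2 m) * (eprob m)\<^sup>2 = c" "1 \<le> n1 m" for m
    by (subst that(1)[symmetric]) (use that(2) in \<open>simp add: field_simps\<close>)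
  show "eventually (\<lambda>m. mean m (\<lambda>S. real (excess (n2 m) S)) / real (n1 m) \<le> ?h m) sequentially"
    using ev_pp ev_eprob_le_1 ev_n1[of 1]
  proof eventually_elim
    case (elim m)
    have "real (n1 m) * eprob m - 1 + (1 - eprob m) ^ n1 m \<le> real (n1 m) * (real (n1 m) - 1) / 2 * (eprob m)\<^sup>2"
      using one_minus_power_upper[OF eprob_nonneg elim(2), of "n1 m"] by linarith
    then show ?case unfolding bexp_exc main[OF elim(1,3), symmetric]
      by (intro divide_right_mono mult_left_mono) auto
  qed
  show "eventually (\<lambda>m. ?f m \<le> mean m (\<lambda>S. real (excess (n2 m) S)) / real (n1 m)) sequentially"
    using ev_pp ev_eprob_le_1 ev_n1[of 1] ev_px
  proof eventually_elim
    case (elim m)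
    let ?a = "real (n1 m)"
    have a1: "1 \<le> ?a" using elim(3) by simp
    have "?a * (?a - 1) * (?a - 2) / 6 * eprob m ^ 3 \<le> ?a ^ 3 * eprob m ^ 3"
    proof (rule mult_right_mono)
      have "?a * (?a - 1) * (?a - 2) \<le> ?a * (?a - 1) * ?a" using a1 by (intro mult_left_mono) auto
      also have "\<dots> \<le> ?a * ?a * ?a" using a1 by (intro mult_left_mono mult_right_mono) auto
      finally have "?a * (?a - 1) * (?a - 2) \<le> ?a ^ 3" by (simp add: power3_eq_cube)
      moreover have "0 \<le> ?a ^ 3" using a1 by simp
      ultimately show "?a * (?a - 1) * (?a - 2) / 6 \<le> ?a ^ 3" by linarith
    qed (use eprob_nonneg in simp)
    then have "?a * (?a - 1) / 2 * (eprob m)\<^sup>2 - ?a ^ 3 * eprob m ^ 3 \<le> ?a * eprob m - 1 + (1 - eprob m) ^ n1 m"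
      using one_minus_power_lower[OF eprob_nonneg elim(2), of "n1 m"] by linarith
    then have "real (n2 m) * (?a * (?a - 1) / 2 * (eprob m)\<^sup>2 - ?a ^ 3 * eprob m ^ 3) / ?a
       \<le> real (n2 m) * (?a * eprob m - 1 + (1 - eprob m) ^ n1 m) / ?a"
      by (intro divide_right_mono mult_left_mono) auto
    moreover have "real (n2 m) * (?a * (?a - 1) / 2 * (eprob m)\<^sup>2 - ?a ^ 3 * eprob m ^ 3) / ?a = ?f m"
    proof -
      have "real (n2 m) * (?a ^ 3 * eprob m ^ 3) / ?a = c * rmean m"
        by (subst elim(4)[symmetric]) (use a1 in \<open>simp add: rmean_def power3_eq_cube field_simps\<close>)
      then show ?thesis using main[OF elim(1,3)] by (simp add: right_diff_distrib diff_divide_distrib)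
    qed
    ultimately show ?case unfolding bexp_exc by linarith
  qed
qed

text \<open>The three terms of \<open>cyclo\<close> per left vertex: c/2 from \<open>excess\<close>,
  -1 from \<open>n1\<close>, and the series from \<open>lcomps\<close>.\<close>

lemma mu_eq: "c * mu c = c / 2 - 1 + (\<Sum>k. comp_limit c k / real (Suc k))"
proof -
  have t: "(c * exp (- c)) ^ Suc k * (real (Suc k) powr (real (Suc k) - 2)) / fact (Suc k) = c * (comp_limit c k / real (Suc k))" for k
  proof -
    have "real (Suc k) powr (real (Suc k) - 2) = real (Suc k) powr (real k - 1)" by simp
    also have "\<dots> = real (Suc k) ^ k / real (Suc k)" unfolding powr_diff by (simp add: powr_realpow[symmetric])
    finally have pw: "real (Suc k) powr (real (Suc k) - 2) = real (Suc k) ^ k / real (Suc k)" .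
    have ex: "exp (- c) ^ Suc k = exp (- (c * real (Suc k)))"
      by (subst exp_of_nat_mult[symmetric]) (simp add: mult.commute)
    show ?thesis unfolding pw comp_limit_def borel_coeff_def power_mult_distrib ex
      by (simp add: field_simps)
  qed
  have "mu c = 1 / 2 - 1 / c + 1 / c\<^sup>2 * (c * (\<Sum>k. comp_limit c k / real (Suc k)))"
    unfolding mu_def t suminf_mult[OF summable_comp_limit'] ..
  then show ?thesis using c by (simp add: right_diff_distrib distrib_left power2_eq_square)
qed

lemma cyclo_lim:
  "(\<lambda>m. mean m (cyclo (n1 m) (n2 m)) / real (n1 m)) \<longlonglongrightarrow> c * mu c"
proof -
  have "(\<lambda>m. mean m (\<lambda>S. real (lcomps (n1 m) S)) / real (n1 m)
      + mean m (\<lambda>S. real (excess (n2 m) S)) / real (n1 m) - 1) \<longlonglongrightarrow> (\<Sum>k. comp_limit c k / real (Suc k)) + c / 2 - 1"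
    by (intro tendsto_intros lcomps_lim excess_lim)
  moreover have "eventually (\<lambda>m. mean m (\<lambda>S. real (lcomps (n1 m) S)) / real (n1 m)
      + mean m (\<lambda>S. real (excess (n2 m) S)) / real (n1 m) - 1
      = mean m (cyclo (n1 m) (n2 m)) / real (n1 m)) sequentially"
    using ev_n1[of 1]
  proof eventually_elim
    case (elim m)
    have "mean m (cyclo (n1 m) (n2 m)) = mean m (\<lambda>S. real (lcomps (n1 m) S))
      + mean m (\<lambda>S. real (excess (n2 m) S)) - real (n1 m)"
      unfolding cyclo_def bexp_diff bexp_add by (simp add: bexp_const)
    then show ?case using elim by (simp add: add_divide_distrib diff_divide_distrib)
  qed
  ultimately have "(\<lambda>m. mean m (cyclo (n1 m) (n2 m)) / real (n1 m)) \<longlonglongrightarrow> (\<Sum>k. comp_limit c k / real (Suc k)) + c / 2 - 1"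
    by (rule Lim_transform_eventually)
  then show ?thesis unfolding mu_eq by (simp add: algebra_simps)
qed

lemma mu_nonneg: "0 \<le> c * mu c"
proof (rule tendsto_lowerbound[OF cyclo_lim])
  show "eventually (\<lambda>m. 0 \<le> mean m (cyclo (n1 m) (n2 m)) / real (n1 m)) sequentially"
    using ev_eprob_le_1
    by eventually_elim (intro divide_nonneg_nonneg bexp_nonneg eprob_nonneg cyclo_nonneg, auto)
qed simp

end

section \<open>Positivity of mu\<close>

definition tree_coeff :: "nat \<Rightarrow> real" where
  "tree_coeff n = (case n of 0 \<Rightarrow> 0 | Suc k \<Rightarrow> borel_coeff k / real (Suc k))"

text \<open>\<open>tree_coeff n\<close> is n^(n-2) / n!, the exponential generating coefficient of
  unrooted labelled trees; differentiating the series gives the Borel coefficients.\<close>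

lemma diffs_tree_coeff: "diffs tree_coeff = borel_coeff"
  by (auto simp: fun_eq_iff diffs_def tree_coeff_def)

lemma comp_limit_power: "x * comp_limit x k = borel_coeff k * (x * exp (- x)) ^ Suc k"
proof -
  have "exp (- x) ^ Suc k = exp (- (x * real (Suc k)))"
    by (subst exp_of_nat_mult[symmetric]) (simp add: mult.commute)
  then show ?thesis unfolding comp_limit_def power_mult_distrib by simp
qed

lemma x_exp_minus_antimono:
  fixes x y :: real assumes "1 \<le> x" "x \<le> y"
  shows "y * exp (- y) \<le> x * exp (- x)"
proof -
  have "y \<le> x * (1 + (y - x))"
  proof -
    have "1 * (y - x) \<le> x * (y - x)" using assms by (intro mult_right_mono) auto
    then show ?thesis by (simp add: algebra_simps)
  qed
  also have "\<dots> \<le> x * exp (y - x)" using assms exp_ge_add_one_self[of "y - x"] by (intro mult_left_mono) auto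
  finally have "y * exp (- y) \<le> x * exp (y - x) * exp (- y)" by (intro mult_right_mono) auto
  also have "\<dots> = x * exp (- x)" by (simp add: mult.assoc exp_add[symmetric])
  finally show ?thesis .
qed

context unbalanced
begin

lemma sparse_bipI: "x > 0 \<Longrightarrow> sparse_bip n1 n2 x"
  by unfold_locales

text \<open>With B the total mass, x B(x) is a power series with nonnegative coefficients in x
  exp(-x), which decreases for x \<ge> 1. Any y strictly between 1 and x gives x B(x) \<le> y B(y)
  \<le> y < x.\<close>

lemma suminf_comp_limit_less_1:
  assumes "1 < x" shows "(\<Sum>k. comp_limit x k) < 1"
proof -
  define y where "y = (1 + x) / 2"
  have y: "1 < y" "y < x" using assms by (auto simp: y_def)
  interpret X: sparse_bip n1 n2 x by (rule sparse_bipI) (use assms in simp)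
  interpret Y: sparse_bip n1 n2 y by (rule sparse_bipI) (use y in simp)
  have "x * (\<Sum>k. comp_limit x k) = (\<Sum>k. x * comp_limit x k)"
    by (rule suminf_mult[symmetric, OF X.summable_comp_limit])
  also have "\<dots> \<le> (\<Sum>k. y * comp_limit y k)"
  proof (rule suminf_le)
    fix k
    show "x * comp_limit x k \<le> y * comp_limit y k"
      unfolding comp_limit_power using y x_exp_minus_antimono[of y x]
      by (intro mult_left_mono power_mono borel_coeff_nonneg) auto
  qed (intro summable_mult X.summable_comp_limit Y.summable_comp_limit)+
  also have "\<dots> = y * (\<Sum>k. comp_limit y k)"
    by (rule suminf_mult[OF Y.summable_comp_limit])
  also have "\<dots> \<le> y * 1" using y Y.suminf_comp_limit_le_1 by (intro mult_left_mono) auto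
  also have "\<dots> < x * 1" using y by simp
  finally show ?thesis using assms by (simp add: mult_less_cancel_left)
qed

lemma tree_series:
  assumes "x > 0"
  shows "x * (x * mu x) = x\<^sup>2 / 2 - x + (\<Sum>n. tree_coeff n * (x * exp (- x)) ^ n)"
proof -
  interpret X: sparse_bip n1 n2 x by (rule sparse_bipI[OF assms])
  have t: "tree_coeff (Suc k) * (x * exp (- x)) ^ Suc k = x * (comp_limit x k / real (Suc k))" for k
  proof -
    have "tree_coeff (Suc k) * (x * exp (- x)) ^ Suc k = borel_coeff k * (x * exp (- x)) ^ Suc k / real (Suc k)"
      by (simp add: tree_coeff_def del: power_Suc)
    then show ?thesis unfolding comp_limit_power[symmetric] by simp
  qed
  have "summable (\<lambda>k. tree_coeff (Suc k) * (x * exp (- x)) ^ Suc k)"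
    unfolding t by (rule summable_mult[OF X.summable_comp_limit'])
  then have sm: "summable (\<lambda>n. tree_coeff n * (x * exp (- x)) ^ n)" by (subst (asm) summable_Suc_iff)
  have "(\<Sum>n. tree_coeff n * (x * exp (- x)) ^ n) = (\<Sum>k. tree_coeff (Suc k) * (x * exp (- x)) ^ Suc k)"
    using suminf_split_head[OF sm] by (simp add: tree_coeff_def)
  also have "\<dots> = x * (\<Sum>k. comp_limit x k / real (Suc k))"
    unfolding t by (rule suminf_mult[OF X.summable_comp_limit'])
  finally show ?thesis unfolding X.mu_eq by (simp add: algebra_simps power2_eq_square)
qed

text \<open>\<open>\<Phi> x\<close> is x^2 times \<open>mu x\<close>. It is nonnegative at
  \<open>a\<close> and strictly increasing from \<open>a\<close> to \<open>c\<close>.\<close>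

lemma mu_pos:
  assumes c: "1 < c" shows "0 < mu c"
proof -
  interpret I: sparse_bip n1 n2 1 by (rule sparse_bipI) simp
  \<comment> \<open>Any point strictly between 1 and \<open>c\<close> serves: starting above 1 keeps
    the series argument away from \<open>exp (- 1)\<close>, its value at x = 1.\<close>
  define a where "a = (1 + c) / 2"
  have a: "1 < a" "a < c" using c by (auto simp: a_def)
  define S where "S z = (\<Sum>n. tree_coeff n * z ^ n)" for z :: real
  define \<Phi> where "\<Phi> x = x\<^sup>2 / 2 - x + S (x * exp (- x))" for x :: real
  have sm: "summable (\<lambda>n. tree_coeff n * exp (- 1) ^ n)"
  proof -
    have "tree_coeff (Suc k) * exp (- 1) ^ Suc k = comp_limit 1 k / real (Suc k)" for k
      using comp_limit_power[of 1 k] by (simp add: tree_coeff_def)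
    then have "summable (\<lambda>k. tree_coeff (Suc k) * exp (- 1) ^ Suc k)" using I.summable_comp_limit' by simp
    then show ?thesis by (subst (asm) summable_Suc_iff)
  qed
  have der: "(\<Phi> has_real_derivative (x - 1) * (1 - (\<Sum>k. comp_limit x k))) (at x)" if x: "1 < x" for x
  proof -
    interpret X: sparse_bip n1 n2 x by (rule sparse_bipI) (use x in simp)
    \<comment> \<open>Strictness places \<open>x * exp (- x)\<close> below \<open>exp (- 1)\<close>,
      where the series converges by \<open>sm\<close>, so term-by-term differentiation
      applies.\<close>
    have "x < exp (x - 1)" using exp_lower_Taylor_quadratic[of "x - 1"] x by (smt (verit) zero_less_power divide_pos_pos)
    then have "x * exp (- x) < exp (x - 1) * exp (- x)" by simp
    also have "\<dots> = exp (- 1)" by (simp add: exp_add[symmetric])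
    finally have lt: "x * exp (- x) < exp (- 1)" .
    have "(S has_real_derivative (\<Sum>n. diffs tree_coeff n * (x * exp (- x)) ^ n)) (at (x * exp (- x)))"
      unfolding S_def using sm by (rule termdiffs_strong) (use lt x in \<open>auto simp: abs_mult\<close>)
    then have d: "(S has_real_derivative (\<Sum>n. borel_coeff n * (x * exp (- x)) ^ n)) (at (x * exp (- x)))"
      by (simp add: diffs_tree_coeff)
    have e: "(\<Sum>n. borel_coeff n * (x * exp (- x)) ^ n) = exp x * (\<Sum>k. comp_limit x k)"
    proof -
      have "borel_coeff n * (x * exp (- x)) ^ n = exp x * comp_limit x n" for n
      proof -
        have "x * (exp x * comp_limit x n) = exp x * (x * comp_limit x n)" by simp
        also have "\<dots> = x * (borel_coeff n * (x * exp (- x)) ^ n) * (exp x * exp (- x))"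
          unfolding comp_limit_power by simp
        also have "exp x * exp (- x) = 1" by (simp add: exp_add[symmetric])
        finally show ?thesis using x by simp
      qed
      then show ?thesis using suminf_mult[OF X.summable_comp_limit, of "exp x"] by simp
    qed
    have g: "((\<lambda>x. x * exp (- x)) has_real_derivative (1 - x) * exp (- x)) (at x)"
      by (auto intro!: derivative_eq_intros simp: algebra_simps)
    have "((\<lambda>x. S (x * exp (- x))) has_real_derivative (exp x * (\<Sum>k. comp_limit x k)) * ((1 - x) * exp (- x))) (at x)"
      using DERIV_chain2[OF d g] by (simp add: e)
    moreover have "(exp x * (\<Sum>k. comp_limit x k)) * ((1 - x) * exp (- x)) = (1 - x) * (\<Sum>k. comp_limit x k)"
      by (simp add: exp_minus field_simps)
    ultimately have "((\<lambda>x. S (x * exp (- x))) has_real_derivative (1 - x) * (\<Sum>k. comp_limit x k)) (at x)" by simp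
    then have "(\<Phi> has_real_derivative x - 1 + (1 - x) * (\<Sum>k. comp_limit x k)) (at x)"
      unfolding \<Phi>_def by (auto intro!: derivative_eq_intros)
    then show ?thesis by (simp add: algebra_simps)
  qed
  have "\<Phi> a < \<Phi> c"
  proof (rule DERIV_pos_imp_increasing[OF a(2)])
    fix x assume "a \<le> x" "x \<le> c"
    then have x: "1 < x" using a by simp
    have "0 < (x - 1) * (1 - (\<Sum>k. comp_limit x k))" using x suminf_comp_limit_less_1[OF x] by simp
    then show "\<exists>y. (\<Phi> has_real_derivative y) (at x) \<and> 0 < y" using der[OF x] by blast
  qed
  moreover have "0 \<le> \<Phi> a"
  proof -
    interpret A: sparse_bip n1 n2 a by (rule sparse_bipI) (use a in simp)
    have "\<Phi> a = a * (a * mu a)" using tree_series[of a] a by (simp add: \<Phi>_def S_def)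
    then show ?thesis using A.mu_nonneg a by simp
  qed
  moreover have "\<Phi> c = c * (c * mu c)" using tree_series[of c] c by (simp add: \<Phi>_def S_def)
  ultimately have "0 < c * (c * mu c)" by simp
  then show ?thesis using c by (simp add: zero_less_mult_iff)
qed

end

section \<open>The genus\<close>

text \<open>Error budget: 2 \<delta> N for the cyclomatic number and 2 \<delta> N for the faces,
  together min(\<epsilon>, 1) M N / 2. The minimum with 1 ensures 8 \<delta> \<le> M, so the face
  error stays below the cyclomatic number, as \<open>cyclo_genus\<close> requires.\<close>

lemma genus_close:
  fixes M \<epsilon> \<delta> N :: real and L :: nat
  assumes S: "S \<subseteq> grid n1 n2" and L: "L > 0" and \<delta>: "\<delta> = M * min \<epsilon> 1 / 8" and M: "0 < M" and \<epsilon>: "0 < \<epsilon>" and N: "0 \<le> N"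
    and cyclo: "\<bar>cyclo n1 n2 S - M * N\<bar> \<le> 2 * \<delta> * N"
    and heavy: "real (heavy_edges S) \<le> \<delta> * N * L"
    and cyc: "2 * real (card (short_cycles S L)) \<le> \<delta> * N"
  shows "\<bar>real (bip_genus S) - M * N / 2\<bar> \<le> \<epsilon> * (M * N / 2)"
proof -
  let ?B = "real (heavy_edges S) / L + 2 * real (card (short_cycles S L))"
  have "real (heavy_edges S) / L \<le> \<delta> * N" using heavy L by (simp add: field_simps)
  then have B: "?B \<le> 2 * (\<delta> * N)" using cyc by linarith
  have "M * min \<epsilon> 1 \<le> M * 1" using M by (intro mult_left_mono) auto
  then have "8 * \<delta> \<le> M" using \<delta> by simp
  then have "8 * \<delta> * N \<le> M * N" using N by (rule mult_right_mono)
  moreover have "0 \<le> M * N" using M N by simp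
  moreover have "0 \<le> \<delta> * N" unfolding \<delta> using M N \<epsilon> by simp
  ultimately have "?B \<le> cyclo n1 n2 S" using B cyclo by linarith
  note g = cyclo_genus[OF S L this]
  have "\<bar>2 * real (bip_genus S) - M * N\<bar> \<le> 4 * (\<delta> * N)" using g B cyclo by linarith
  also have "4 * (\<delta> * N) = min \<epsilon> 1 * (M * N / 2)" unfolding \<delta> by simp
  also have "\<dots> \<le> \<epsilon> * (M * N / 2)" using M N by (intro mult_right_mono) auto
  finally have "\<bar>2 * real (bip_genus S) - M * N\<bar> \<le> \<epsilon> * (M * N / 2)" .
  moreover have "0 \<le> \<epsilon> * (M * N / 2)" using M N \<epsilon> by simp
  ultimately show ?thesis by linarith
qed

text \<open>Union bound over three bad events: Chebyshev for the cyclomatic number, Markov for the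
  heavy edges and for the short cycles. Only the middle term does not vanish as n_1 grows; it is
  made small through \<open>L\<close>.\<close>

lemma Gbip_prob_lower:
  fixes p \<delta> M \<epsilon> :: real and L :: nat
  assumes p: "0 \<le> p" "p \<le> 1" and n1: "0 < n1" and cc: "real n1 * real n2 * p\<^sup>2 = c"
    and L: "L > 0" and \<delta>: "\<delta> = M * min \<epsilon> 1 / 8" and M: "0 < M" and \<epsilon>: "0 < \<epsilon>"
    and mean: "\<bar>bexp p (grid n1 n2) (cyclo n1 n2) - M * real n1\<bar> \<le> \<delta> * real n1"
  shows "1 - (c / (\<delta>\<^sup>2 * real n1) + c / (\<delta> * L) + 2 * (\<Sum>k\<le>L. c ^ k) / (\<delta> * real n1))
    \<le> Gbip_prob n1 n2 p (\<lambda>S. \<bar>real (bip_genus S) - M * real n1 / 2\<bar> \<le> \<epsilon> * (M * real n1 / 2))"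
proof -
  let ?G = "grid n1 n2"
  let ?N = "real n1"
  have d: "0 < \<delta>" unfolding \<delta> using M \<epsilon> by simp
  have dN: "0 < \<delta> * ?N" using d n1 by simp
  let ?Q = "\<lambda>S. \<bar>real (bip_genus S) - M * ?N / 2\<bar> \<le> \<epsilon> * (M * ?N / 2)"
  let ?b1 = "\<lambda>S. of_bool (\<delta> * ?N \<le> \<bar>cyclo n1 n2 S - bexp p ?G (cyclo n1 n2)\<bar>) :: real"
  let ?b2 = "\<lambda>S. of_bool (\<delta> * ?N * L \<le> real (heavy_edges S)) :: real"
  let ?b3 = "\<lambda>S. of_bool (\<delta> * ?N / 2 \<le> real (card (short_cycles S L))) :: real"
  have b1: "bexp p ?G ?b1 \<le> c / (\<delta>\<^sup>2 * ?N)"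
  proof -
    have "bexp p ?G ?b1 \<le> bvar p ?G (cyclo n1 n2) / (\<delta> * ?N)\<^sup>2" by (rule bexp_chebyshev[OF p dN])
    also have "\<dots> \<le> c * ?N / (\<delta> * ?N)\<^sup>2"
      using bvar_cyclo_le[OF p, of n1 n2] cc by (intro divide_right_mono) auto
    also have "\<dots> = c / (\<delta>\<^sup>2 * ?N)" using n1 by (simp add: power2_eq_square)
    finally show ?thesis .
  qed
  have b2: "bexp p ?G ?b2 \<le> c / (\<delta> * L)"
  proof -
    have "bexp p ?G ?b2 \<le> bexp p ?G (\<lambda>S. real (heavy_edges S)) / (\<delta> * ?N * L)"
      using p dN L by (intro bexp_markov) auto
    also have "\<dots> \<le> c * ?N / (\<delta> * ?N * L)"
      using bexp_heavy_le[OF p, of n1 n2] cc dN by (intro divide_right_mono) auto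
    also have "\<dots> = c / (\<delta> * L)" using n1 by simp
    finally show ?thesis .
  qed
  have b3: "bexp p ?G ?b3 \<le> 2 * (\<Sum>k\<le>L. c ^ k) / (\<delta> * ?N)"
  proof -
    have "bexp p ?G ?b3 \<le> bexp p ?G (\<lambda>S. real (card (short_cycles S L))) / (\<delta> * ?N / 2)"
      using p dN by (intro bexp_markov) auto
    also have "\<dots> \<le> (\<Sum>k\<le>L. c ^ k) / (\<delta> * ?N / 2)"
      using bexp_cycles_le[OF p, of n1 n2 L] cc dN by (intro divide_right_mono) auto
    also have "\<dots> = 2 * (\<Sum>k\<le>L. c ^ k) / (\<delta> * ?N)" by (simp add: mult.commute)
    finally show ?thesis .
  qed
  have "bexp p ?G (\<lambda>S. 1 - (?b1 S + ?b2 S + ?b3 S)) \<le> bexp p ?G (\<lambda>S. of_bool (?Q S))"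
  proof (rule bexp_mono[OF p])
    fix S assume S: "S \<subseteq> ?G"
    show "1 - (?b1 S + ?b2 S + ?b3 S) \<le> of_bool (?Q S)"
    proof (cases "?b1 S = 0 \<and> ?b2 S = 0 \<and> ?b3 S = 0")
      case True
      then have a: "\<bar>cyclo n1 n2 S - bexp p ?G (cyclo n1 n2)\<bar> < \<delta> * ?N" "real (heavy_edges S) < \<delta> * ?N * L"
        "real (card (short_cycles S L)) < \<delta> * ?N / 2" by (auto simp: not_le)
      have "\<bar>cyclo n1 n2 S - M * ?N\<bar> \<le> 2 * \<delta> * ?N" using a(1) mean by linarith
      moreover have "2 * real (card (short_cycles S L)) \<le> \<delta> * ?N" using a(3) by linarith
      ultimately have "?Q S"
        using a(2) by (intro genus_close[OF S L \<delta> M \<epsilon>]) auto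
      then show ?thesis by simp
    next
      case False
      then have "1 \<le> ?b1 S + ?b2 S + ?b3 S" by (auto simp: of_bool_def split: if_splits)
      then show ?thesis by simp
    qed
  qed
  moreover have "bexp p ?G (\<lambda>S. 1 - (?b1 S + ?b2 S + ?b3 S)) = 1 - (bexp p ?G ?b1 + bexp p ?G ?b2 + bexp p ?G ?b3)"
    unfolding bexp_diff bexp_add by (simp add: bexp_const)
  ultimately show ?thesis unfolding Gbip_prob_bexp using b1 b2 b3 by linarith
qed

theorem theorem1p6:
  fixes d :: real and n1 n2 :: "nat \<Rightarrow> nat"
  assumes "d > 1"
    and "filterlim n1 at_top sequentially"
    and "filterlim n2 at_top sequentially"
    and "(\<lambda>m. real (n1 m) / real (n2 m)) \<longlonglongrightarrow> 0"
  shows "\<forall>\<epsilon>>0. (\<lambda>m. Gbip_prob (n1 m) (n2 m) (d / sqrt (real (n1 m) * real (n2 m)))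
            (\<lambda>S. \<bar>real (bip_genus S) - mu (d^2) * d^2 * real (n1 m) / 2\<bar>
                   \<le> \<epsilon> * (mu (d^2) * d^2 * real (n1 m) / 2))) \<longlonglongrightarrow> 1"
proof (intro allI impI)
  fix \<epsilon> :: real assume \<epsilon>: "0 < \<epsilon>"
  define c where "c = d\<^sup>2"
  have c1: "1 < c" using assms(1) by (simp add: c_def one_less_power)
  have sqc: "sqrt c = d" using assms(1) by (simp add: c_def)
  interpret unbalanced n1 n2 using assms(2-4) by unfold_locales
  interpret sparse_bip n1 n2 c by (rule sparse_bipI) (use c1 in simp)
  define M where "M = mu (d^2) * d^2"
  have Mc: "M = c * mu c" by (simp add: M_def c_def)
  have M: "0 < M" using mu_pos[OF c1] c1 by (simp add: Mc)
  define \<delta> where "\<delta> = M * min \<epsilon> 1 / 8"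
  have \<delta>: "0 < \<delta>" using M \<epsilon> by (simp add: \<delta>_def)
  let ?P = "\<lambda>m. Gbip_prob (n1 m) (n2 m) (eprob m)
      (\<lambda>S. \<bar>real (bip_genus S) - M * real (n1 m) / 2\<bar> \<le> \<epsilon> * (M * real (n1 m) / 2))"
  have "?P \<longlonglongrightarrow> 1"
  proof (rule tendstoI)
    fix \<eta> :: real assume \<eta>: "0 < \<eta>"
    \<comment> \<open>\<open>L\<close> makes the heavy-edge term less than \<open>\<eta> / 2\<close>
      and is then fixed; the other two terms are a constant divided by \<open>n1 m\<close>.\<close>
    obtain L0 :: nat where L0: "2 * c / (\<delta> * \<eta>) < real L0" using reals_Archimedean2 by blast
    define L where "L = Suc L0"
    have "2 * c / (\<delta> * \<eta>) < real L" using L0 by (simp add: L_def)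
    then have L: "L > 0" "c / (\<delta> * real L) < \<eta> / 2"
      using \<delta> \<eta> by (simp_all add: L_def field_simps del: of_nat_Suc)
    have "(\<lambda>m. (c / \<delta>\<^sup>2 + 2 * (\<Sum>k\<le>L. c ^ k) / \<delta>) * inverse (real (n1 m))) \<longlonglongrightarrow> (c / \<delta>\<^sup>2 + 2 * (\<Sum>k\<le>L. c ^ k) / \<delta>) * 0"
      by (intro tendsto_intros inverse_n1)
    then have small: "eventually (\<lambda>m. (c / \<delta>\<^sup>2 + 2 * (\<Sum>k\<le>L. c ^ k) / \<delta>) * inverse (real (n1 m)) < \<eta> / 2) sequentially"
      using \<eta> by (intro order_tendstoD(2)[where y = 0]) auto
    have "eventually (\<lambda>m. \<bar>mean m (cyclo (n1 m) (n2 m)) / real (n1 m) - M\<bar> < \<delta>) sequentially"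
      using tendstoD[OF cyclo_lim \<delta>] unfolding dist_real_def Mc .
    then show "eventually (\<lambda>m. dist (?P m) 1 < \<eta>) sequentially"
      using small ev_pp ev_eprob_le_1 ev_n1[of 1]
    proof eventually_elim
      case (elim m)
      let ?N = "real (n1 m)" and ?E = "mean m (cyclo (n1 m) (n2 m))"
      have N: "0 < ?N" using elim(5) by simp
      have "?E / ?N - M = (?E - M * ?N) / ?N" using N by (simp add: field_simps)
      then have "\<bar>?E - M * ?N\<bar> / ?N < \<delta>" using elim(1) N by simp
      then have mean: "\<bar>?E - M * ?N\<bar> \<le> \<delta> * ?N" using N by (simp add: field_simps)
      have "1 - (c / (\<delta>\<^sup>2 * ?N) + c / (\<delta> * L) + 2 * (\<Sum>k\<le>L. c ^ k) / (\<delta> * ?N)) \<le> ?P m"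
        using elim(5) by (intro Gbip_prob_lower[OF eprob_nonneg elim(4) _ elim(3) L(1) \<delta>_def M \<epsilon> mean]) simp
      moreover have "c / (\<delta>\<^sup>2 * ?N) + 2 * (\<Sum>k\<le>L. c ^ k) / (\<delta> * ?N) = (c / \<delta>\<^sup>2 + 2 * (\<Sum>k\<le>L. c ^ k) / \<delta>) * inverse ?N"
        by (simp add: divide_inverse algebra_simps)
      ultimately have "1 - \<eta> < ?P m" using elim(2) L(2) by linarith
      moreover have "?P m \<le> 1"
      proof -
        have "?P m \<le> mean m (\<lambda>S. 1)"
          unfolding Gbip_prob_bexp by (intro bexp_mono eprob_nonneg elim(4)) simp
        then show ?thesis by (simp add: bexp_const)
      qed
      ultimately show ?case by (simp add: dist_real_def)
    qed
  qed
  then show "(\<lambda>m. Gbip_prob (n1 m) (n2 m) (d / sqrt (real (n1 m) * real (n2 m)))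
            (\<lambda>S. \<bar>real (bip_genus S) - mu (d^2) * d^2 * real (n1 m) / 2\<bar>
                   \<le> \<epsilon> * (mu (d^2) * d^2 * real (n1 m) / 2))) \<longlonglongrightarrow> 1"
    unfolding eprob_def sqc M_def .
qed

end
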